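(* Let $K(\mathcal{X})/K(x)$ be a linearized function field given by $L(y)=h(x)$, with $q$, $m$, $r$, $P_1,\dots,P_r$, $\lambda_1,\dots,\lambda_r$ and $Q_1,\dots,Q_r$ as in the context. Let $1\leq n\leq r$, let $\mathbf{Q}=(Q_1,\dots,Q_n)$ be an $n$-tuple of distinct totally ramified places of $K(\mathcal{X})/K(x)$ (not necessarily of degree one), let $\boldsymbol{\alpha}=(\alpha_1,\dots,\alpha_n)\in\mathbb{Z}^n$, and let $1\leq j\leq n$. Put $D_{\boldsymbol{\alpha}}(\mathbf{Q})=\sum_{k=1}^n\alpha_kQ_k$. Then $$\mathcal{L}(D_{\boldsymbol{\alpha}}(\mathbf{Q}))=\mathcal{L}(D_{\boldsymbol{\alpha}}(\mathbf{Q})-Q_j)$$ if and only if $$\sum_{k=1}^{n}\left\lfloor\frac{\alpha_k-t_j\lambda_k}{q^m}\right\rfloor\deg(P_k)<\sum_{k=n+1}^{r}\left\lceil\frac{t_j\lambda_k}{q^m}\right\rceil\deg(P_k),$$ where $t_j\in\{0,\dots,q^m-1\}$ is the unique integer such that $\alpha_j-t_j\lambda_j\equiv 0\pmod{q^m}$.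
   Context: Setting. Let $s,m$ be positive integers with $m\leq s$, let $q$ be a power of a prime $p$, and let $K=\mathbb{F}_{q^s}$. Let $L(y)=\sum_{k=0}^m a_k y^{q^k}\in K[y]$ be a linearized polynomial with $a_m\neq 0$, $a_0\neq 0$, all of whose roots lie in $K$. Let $h(x)\in K(x)$ be a rational function whose principal divisor in the rational function field $K(x)$ is $$(h(x))_{K(x)}=\gamma_1T_1+\cdots+\gamma_uT_u-\lambda_1P_1-\cdots-\lambda_rP_r,$$ where $T_1,\dots,T_u$ are the (distinct) places of $K(x)$ that are zeros of $h(x)$, $P_1,\dots,P_r$ are the (distinct) places of $K(x)$ that are poles of $h(x)$, and $\gamma_1,\dots,\gamma_u,\lambda_1,\dots,\lambda_r$ are positive integers with $p\nmid\lambda_k$ for all $1\leq k\leq r$. Let $\mathcal{X}$ be the curve over $K$ with affine equation $L(y)=h(x)$ and $K(\mathcal{X})=K(x,y)$ its function field (a linearized function field); one has $[K(\mathcal{X}):K(x)]=q^m$. The places $P_1,\dots,P_r$ are exactly the places of $K(x)$ totally ramified in $K(\mathcal{X})/K(x)$; for $1\leq i\leq r$, $Q_i$ denotes the unique place of $K(\mathcal{X})$ lying over $P_i$. For a divisor $G$ of $K(\mathcal{X})$, $\mathcal{L}(G)=\{z\in K(\mathcal{X}) : (z)+G\geq 0\}\cup\{0\}$ is its Riemann-Roch space, where $(z)$ denotes the principal divisor of $z$. *)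

theory Defs
  imports
    "HOL-Algebra.Algebra"
    "HOL-Algebra.Algebraic_Closure_Type"
    "HOL-Computational_Algebra.Computational_Algebra"
    "HOL-Number_Theory.Cong"
    "HOL-Library.Poly_Mapping"
begin

text \<open>
  A function field \<open>F/K\<close> is given by a type \<open>'f\<close> of class \<^class>\<open>field\<close> together with the set
  \<open>K :: 'f set\<close> of constants. Valuation rings, places, prime elements and valuations follow
  Stichtenoth, \<^emph>\<open>Algebraic Function Fields and Codes\<close>. A place is a set of elements of \<open>F\<close>,
  namely the maximal ideal of a valuation ring.
\<close>

abbreviation subring_of_type :: "'f::field set \<Rightarrow> 'f ring"
  where "subring_of_type S \<equiv> ring_of_type_algebra \<lparr>carrier := S\<rparr>"

definition valuation_ring :: "'f::field set \<Rightarrow> 'f set \<Rightarrow> bool"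
  where "valuation_ring K V \<longleftrightarrow>
    subring V ring_of_type_algebra \<and> K \<subset> V \<and> V \<subset> UNIV \<and> (\<forall>z. z \<in> V \<or> inverse z \<in> V)"

definition place :: "'f::field set \<Rightarrow> 'f set \<Rightarrow> bool"
  where "place K P \<longleftrightarrow> (\<exists>V. valuation_ring K V \<and> maximalideal P (subring_of_type V))"

text \<open>The valuation ring is determined by its maximal ideal: it is \<open>{z. z = 0 \<or> inverse z \<notin> P}\<close>.\<close>

definition place_ring :: "'f::field set \<Rightarrow> 'f set \<Rightarrow> 'f ring"
  where "place_ring K P =
    subring_of_type (THE V. valuation_ring K V \<and> maximalideal P (subring_of_type V))"

definition prime_element :: "'f::field set \<Rightarrow> 'f set \<Rightarrow> 'f \<Rightarrow> bool"
  where "prime_element K P t \<longleftrightarrow>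
    t \<in> carrier (place_ring K P) \<and> P = PIdl\<^bsub>place_ring K P\<^esub> t"

text \<open>Only meaningful for \<open>z \<noteq> 0\<close>; the value \<open>\<infinity>\<close> at \<open>0\<close> is not modelled.\<close>

definition valuation :: "'f::field set \<Rightarrow> 'f set \<Rightarrow> 'f \<Rightarrow> int"
  where "valuation K P z =
    (THE n. \<exists>t u. prime_element K P t \<and> u \<in> Units (place_ring K P) \<and> z = t powi n * u)"

text \<open>
  The degree of the residue field over the image of the constants. For a finite place of a
  rational function field this is the degree of the corresponding irreducible polynomial.
\<close>

definition place_degree :: "'f::field set \<Rightarrow> 'f set \<Rightarrow> nat"
  where "place_degree K P =
    (let k = place_ring K P Quot P
     in ring.dim k ((\<lambda>c. P +>\<^bsub>place_ring K P\<^esub> c) ` K) (carrier k))"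

text \<open>
  Divisors are elements of the free abelian group \<open>'f set \<Rightarrow>\<^sub>0 int\<close> whose keys are places. The
  principal divisor is given by its coefficient function, so that its definition does not have
  to refer to the theorem that a nonzero element has only finitely many zeros and poles.
\<close>

definition principal_divisor :: "'f::field set \<Rightarrow> 'f \<Rightarrow> 'f set \<Rightarrow> int"
  where "principal_divisor K z P = (if place K P then valuation K P z else 0)"

definition riemann_roch_space :: "'f::field set \<Rightarrow> ('f set \<Rightarrow>\<^sub>0 int) \<Rightarrow> 'f set"
  where "riemann_roch_space K G =
    {z. z \<noteq> 0 \<and> (\<forall>P. principal_divisor K z P + Poly_Mapping.lookup G P \<ge> 0)} \<union> {0}"

text \<open>
  For an extension \<open>F'/F\<close> given by an embedding \<open>\<phi>\<close>, the place \<open>Q\<close> of \<open>F'\<close> lies over \<open>P\<close>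
  iff \<open>P \<subseteq> Q\<close> after identifying \<open>F\<close> with its image.
\<close>

definition lies_over :: "('e \<Rightarrow> 'f) \<Rightarrow> 'f set \<Rightarrow> 'e set \<Rightarrow> bool"
  where "lies_over \<phi> Q P \<longleftrightarrow> \<phi> ` P \<subseteq> Q"

definition linearized_poly :: "nat \<Rightarrow> nat \<Rightarrow> (nat \<Rightarrow> 'k::comm_semiring_1) \<Rightarrow> 'k poly"
  where "linearized_poly q m a = (\<Sum>k\<le>m. Polynomial.monom (a k) (q ^ k))"

text \<open>The rational function field \<open>K(x)\<close> is \<open>'k poly fract\<close>; this embeds \<open>K\<close> into it.\<close>

definition const_fract :: "'k::field \<Rightarrow> 'k poly fract"
  where "const_fract c = to_fract [:c:]"

text \<open>
  \<open>'f\<close> with the embedding \<open>\<phi>\<close> of \<open>K(x)\<close> is the function field \<open>K(x, y)\<close> of the curve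
  \<open>L(y) = h(x)\<close>.
\<close>

definition curve_function_field ::
  "'k::field poly \<Rightarrow> 'k poly fract \<Rightarrow> ('k poly fract \<Rightarrow> 'f::field) \<Rightarrow> 'f \<Rightarrow> bool"
  where "curve_function_field L h \<phi> y \<longleftrightarrow>
    \<phi> \<in> ring_hom ring_of_type_algebra ring_of_type_algebra \<and>
    poly (map_poly (\<phi> \<circ> const_fract) L) y = \<phi> h \<and>
    generate_field ring_of_type_algebra (range \<phi> \<union> {y}) = UNIV"

end

theory Submission
  imports Defs "HOL-Number_Theory.Residues"
begin

text \<open>
  Put \<open>F = K(x)\<close>, \<open>F' = K(x, y)\<close> and \<open>N = q ^ m\<close>. Every \<open>z\<close> in \<open>F'\<close> has a unique expression
  \<open>c\<^sub>0 + c\<^sub>1 y + \<dots> + c\<^sub>N\<^sub>-\<^sub>1 y ^ (N - 1)\<close> with coefficients in \<open>F\<close>, and the proof reads off from the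
  coefficients whether \<open>z\<close> lies in a Riemann-Roch space.

  Let \<open>P\<close> be a pole of \<open>h\<close> of order \<open>\<lambda>\<close>, and \<open>Q\<close> a place above it. Comparing values in
  \<open>L(y) = h\<close> shows that \<open>c y ^ i\<close> has value \<open>N v(c) - i \<lambda>\<close> at \<open>Q\<close>, up to the factor that normalizes the
  valuation. Since \<open>\<lambda>\<close> is prime to \<open>N\<close>, these values are distinct for distinct \<open>i < N\<close>. So the
  value of \<open>z\<close> is the least of the values of its terms, the factor is \<open>1\<close>, the place \<open>Q\<close> is the
  only one above \<open>P\<close>, and the powers of \<open>y\<close> are linearly independent (\<open>ramified_valuation\<close>).

  Let \<open>P\<close> be a place of \<open>F\<close> at which \<open>h\<close> is regular. Then \<open>y\<close> is integral above \<open>P\<close>. Each of the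
  \<open>N\<close> roots \<open>b\<close> of \<open>L\<close> lies in \<open>K\<close> and gives an automorphism \<open>y \<mapsto> y + b\<close> of \<open>F'\<close> over \<open>F\<close>, which
  permutes the places above \<open>P\<close>. If \<open>z = f(y)\<close> is integral above \<open>P\<close>, then so are all its
  conjugates \<open>f(y + b)\<close>; Lagrange interpolation at the nodes \<open>y + b\<close>, whose differences are nonzero
  constants, recovers the coefficients of \<open>f\<close> from them without denominators. So \<open>z\<close> is integral
  above \<open>P\<close> exactly when all its coefficients are integral at \<open>P\<close> (\<open>unramified_coeffs\<close>).

  Together (\<open>riemann_roch_iff\<close>): \<open>z\<close> lies in the Riemann-Roch space of \<open>\<Sum> \<alpha>\<^sub>k Q\<^sub>k\<close> iff every \<open>c\<^sub>i\<close> lies in that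
  of the divisor \<open>E\<^sub>i\<close> of \<open>F\<close> whose coefficient at \<open>P\<^sub>k\<close> is the floor of \<open>(\<alpha>\<^sub>k - i \<lambda>\<^sub>k) / N\<close>, with
  \<open>\<alpha>\<^sub>k = 0\<close> for \<open>k > n\<close>. Subtracting \<open>Q\<^sub>j\<close> makes this space smaller iff it contains some \<open>c y ^ i\<close> of value
  exactly \<open>- \<alpha>\<^sub>j\<close> at \<open>Q\<^sub>j\<close>. By the congruence that defines \<open>t\<close> this forces \<open>i = t\<close>, and then \<open>c\<close> is a
  function in the Riemann-Roch space of \<open>E\<^sub>t\<close> that has the extreme order allowed at \<open>P\<^sub>j\<close>
  (\<open>riemann_roch_drop_iff\<close>). On the projective line there is such a function iff \<open>E\<^sub>t\<close> has degree at
  least \<open>0\<close> (\<open>genus_zero_exact\<close>), and this degree is the left side of the asserted inequality minus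
  its right side.

  The argument rests on three facts about places. The places of \<open>K(x)\<close> are those of the irreducible
  polynomials and the one at infinity, with the expected degrees (\<open>place_K_x_cases\<close>,
  \<open>fin_place_degree\<close>, \<open>inf_place_degree\<close>); every place of \<open>F\<close> has a place of \<open>F'\<close> above it (\<open>above_exists\<close>); and every valuation ring of \<open>F'\<close>
  over \<open>K\<close> is discrete (\<open>discrete_valuation_extension\<close>).
\<close>

hide_const (open) Divisibility.irreducible

section \<open>Valuation rings of a field and their maximal ideals\<close>

lemma type_ring_simps [simp]:
  "carrier ring_of_type_algebra = UNIV"
  "x \<otimes>\<^bsub>ring_of_type_algebra\<^esub> y = x * y"
  "x \<oplus>\<^bsub>ring_of_type_algebra\<^esub> y = x + y"
  "\<one>\<^bsub>ring_of_type_algebra\<^esub> = 1"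
  "\<zero>\<^bsub>ring_of_type_algebra\<^esub> = 0"
  by (simp_all add: ring_of_type_algebra_def)

lemma type_ring_a_inv [simp]: "\<ominus>\<^bsub>ring_of_type_algebra\<^esub> (x :: 'a::field) = - x"
proof -
  interpret ring "ring_of_type_algebra :: 'a ring" by (rule ring_from_type_algebra)
  show ?thesis by (rule minus_equality) auto
qed

lemma type_ring_m_inv [simp]:
  "(x :: 'a::field) \<noteq> 0 \<Longrightarrow> inv\<^bsub>ring_of_type_algebra\<^esub> x = inverse x"
proof -
  assume "x \<noteq> 0"
  interpret field "ring_of_type_algebra :: 'a ring" by (rule field_from_type_algebra)
  show ?thesis by (rule inv_char) (use \<open>x \<noteq> 0\<close> in auto)
qed

definition is_subring :: "'f::field set \<Rightarrow> bool"
  where "is_subring V \<longleftrightarrow> 1 \<in> V \<and> (\<forall>a\<in>V. - a \<in> V) \<and> (\<forall>a\<in>V. \<forall>b\<in>V. a + b \<in> V) \<and> (\<forall>a\<in>V. \<forall>b\<in>V. a * b \<in> V)"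

lemma is_subringD:
  assumes "is_subring V"
  shows "1 \<in> V" "0 \<in> V" "a \<in> V \<Longrightarrow> - a \<in> V" "a \<in> V \<Longrightarrow> b \<in> V \<Longrightarrow> a + b \<in> V"
    "a \<in> V \<Longrightarrow> b \<in> V \<Longrightarrow> a - b \<in> V" "a \<in> V \<Longrightarrow> b \<in> V \<Longrightarrow> a * b \<in> V"
    "a \<in> V \<Longrightarrow> a ^ n \<in> V"
proof -
  show *: "1 \<in> V" "\<And>a. a \<in> V \<Longrightarrow> - a \<in> V" "\<And>a b. a \<in> V \<Longrightarrow> b \<in> V \<Longrightarrow> a + b \<in> V"
      "\<And>a b. a \<in> V \<Longrightarrow> b \<in> V \<Longrightarrow> a * b \<in> V"
    using assms unfolding is_subring_def by blast+
  show "0 \<in> V" using *(3)[OF *(1) *(2)[OF *(1)]] by simp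
  show "a \<in> V \<Longrightarrow> b \<in> V \<Longrightarrow> a - b \<in> V" using *(3)[OF _ *(2), of a b] by simp
  show "a \<in> V \<Longrightarrow> a ^ n \<in> V" by (induction n) (use * in auto)
qed

lemma is_subring_sum:
  assumes "is_subring V" "\<And>i. i \<in> I \<Longrightarrow> f i \<in> V" shows "sum f I \<in> V"
  using assms(2)
    by (induction I rule: infinite_finite_induct) (auto intro: is_subringD[OF assms(1)])

lemma is_subring_poly:
  assumes "is_subring V" "\<And>i. coeff f i \<in> V" "a \<in> V" shows "poly f a \<in> V"
  unfolding poly_altdef
  by (intro is_subring_sum assms is_subringD(6)[OF assms(1)] is_subringD(7)[OF assms(1)])

lemma subring_iff_is_subring: "subring V (ring_of_type_algebra :: 'f::field ring) \<longleftrightarrow> is_subring V"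
proof
  assume "subring V (ring_of_type_algebra :: 'f ring)"
  from subringE[OF this] show "is_subring V"
    unfolding is_subring_def by auto
next
  interpret ring "ring_of_type_algebra :: 'f ring" by (rule ring_from_type_algebra)
  assume "is_subring V"
  then show "subring V (ring_of_type_algebra :: 'f ring)"
    by (intro subringI) (auto dest: is_subringD)
qed

lemma valuation_ring_iff:
  "valuation_ring K V \<longleftrightarrow> is_subring V \<and> K \<subset> V \<and> V \<noteq> UNIV \<and> (\<forall>z. z \<in> V \<or> inverse z \<in> V)"
  unfolding valuation_ring_def subring_iff_is_subring by auto

lemma valuation_ringD:
  assumes "valuation_ring K V"
  shows "is_subring V" "K \<subseteq> V" "z \<notin> V \<Longrightarrow> inverse z \<in> V" "V \<noteq> UNIV"
  using assms unfolding valuation_ring_iff by auto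

definition nonunits :: "'f::field set \<Rightarrow> 'f set"
  where "nonunits V = {z \<in> V. z = 0 \<or> inverse z \<notin> V}"

lemma subring_of_type_ring:
  assumes "is_subring (V :: 'f::field set)" shows "cring (subring_of_type V)"
proof -
  interpret cring "ring_of_type_algebra :: 'f ring" by (rule cring_from_type_algebra)
  have "subring V (ring_of_type_algebra :: 'f ring)"
    using assms subring_iff_is_subring by blast
  then show ?thesis
    using subcring_iff[of V] subcringI'[of V] by auto
qed

lemma ideal_subring_iff:
  assumes "is_subring (V :: 'f::field set)"
  shows "ideal I (subring_of_type V) \<longleftrightarrow>
    I \<subseteq> V \<and> 0 \<in> I \<and> (\<forall>a\<in>I. \<forall>b\<in>I. a + b \<in> I) \<and> (\<forall>x\<in>V. \<forall>a\<in>I. x * a \<in> I)" (is "_ \<longleftrightarrow> ?R")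
proof
  interpret V: cring "subring_of_type V" by (rule subring_of_type_ring[OF assms])
  assume "ideal I (subring_of_type V)"
  then interpret ideal I "subring_of_type V" .
  show ?R
    using a_subset zero_closed a_closed I_l_closed by auto
next
  interpret V: cring "subring_of_type V" by (rule subring_of_type_ring[OF assms])
  assume R: ?R
  have neg: "\<ominus>\<^bsub>subring_of_type V\<^esub> a = - a" if "a \<in> V" for a
    by (rule V.minus_equality) (use that assms in \<open>auto dest: is_subringD\<close>)
  show "ideal I (subring_of_type V)"
  proof (rule idealI)
    show "ring (subring_of_type V)" by (rule V.ring_axioms)
    show "subgroup I (add_monoid (subring_of_type V))"
    proof (rule V.add.subgroupI)
      fix a assume "a \<in> I"
      moreover from this R have "(-1) * a \<in> I" using is_subringD(1,3)[OF assms] by blast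
      ultimately show "\<ominus>\<^bsub>subring_of_type V\<^esub> a \<in> I" using neg R by auto
    qed (use R in auto)
    fix a x assume "a \<in> I" "x \<in> carrier (subring_of_type V)"
    then have "x * a \<in> I" using R by auto
    then show "x \<otimes>\<^bsub>subring_of_type V\<^esub> a \<in> I" "a \<otimes>\<^bsub>subring_of_type V\<^esub> x \<in> I"
      by (simp_all add: mult.commute)
  qed
qed

text \<open>
  Of two nonzero nonunits one divides the other, so their sum is a multiple of one of them. This
  is why the nonunits form an ideal.
\<close>
lemma nonunits_of_total_subring:
  assumes "is_subring V" "\<And>z. z \<notin> V \<Longrightarrow> inverse z \<in> V"
  shows "nonunits V \<subseteq> V" "0 \<in> nonunits V" "1 \<notin> nonunits V"
    "a \<in> nonunits V \<Longrightarrow> b \<in> nonunits V \<Longrightarrow> a + b \<in> nonunits V"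
    "x \<in> V \<Longrightarrow> a \<in> nonunits V \<Longrightarrow> x * a \<in> nonunits V"
proof -
  note V = is_subringD[OF assms(1)]
  show "nonunits V \<subseteq> V" "0 \<in> nonunits V" "1 \<notin> nonunits V"
    using V unfolding nonunits_def by auto
  show mult: "x * a \<in> nonunits V" if "x \<in> V" "a \<in> nonunits V" for x a
  proof -
    have "inverse a \<in> V" if "x * a \<noteq> 0" "inverse (x * a) \<in> V"
    proof -
      have "inverse a = inverse (x * a) * x" using that(1) by (simp add: field_simps)
      then show ?thesis using that \<open>x \<in> V\<close> V(6) by metis
    qed
    then show ?thesis using that V(6) unfolding nonunits_def by auto
  qed
  show "a + b \<in> nonunits V" if ab: "a \<in> nonunits V" "b \<in> nonunits V"
  proof (cases "a = 0 \<or> b = 0")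
    case False
    show ?thesis
    proof (cases "a / b \<in> V")
      case True
      have "(a / b + 1) * b \<in> nonunits V" by (rule mult) (use True V ab in auto)
      then show ?thesis using False by (simp add: field_simps)
    next
      case F: False
      have "b / a \<in> V" using assms(2)[OF F] by simp
      have "(b / a + 1) * a \<in> nonunits V" by (rule mult) (use \<open>b / a \<in> V\<close> V ab in auto)
      then show ?thesis using False by (simp add: field_simps)
    qed
  qed (use ab in auto)
qed

text \<open>
  A valuation ring is local: an element outside \<open>nonunits V\<close> is a unit, so every proper ideal lies
  in \<open>nonunits V\<close>. This is what makes the definite description in \<^const>\<open>place_ring\<close> proper.
\<close>
lemma maximalideal_iff_nonunits:
  assumes V: "valuation_ring K V"
  shows "maximalideal P (subring_of_type V) \<longleftrightarrow> P = nonunits V"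
proof -
  note VV = valuation_ringD[OF V] note C = is_subringD[OF VV(1)]
  note N = nonunits_of_total_subring[OF VV(1,3)]
  have id: "ideal (nonunits V) (subring_of_type V)"
    unfolding ideal_subring_iff[OF VV(1)] using N by blast
  have sub: "J \<subseteq> nonunits V" if J: "ideal J (subring_of_type V)" "J \<noteq> V" for J
  proof
    fix z assume z: "z \<in> J"
    note J' = J(1)[unfolded ideal_subring_iff[OF VV(1)]]
    have "1 \<notin> J"
    proof
      assume "1 \<in> J"
      then have "x \<in> J" if "x \<in> V" for x using J' that by (metis mult.right_neutral)
      with J J' show False by blast
    qed
    moreover have "1 \<in> J" if "z \<noteq> 0" "inverse z \<in> V"
      using J' that z left_inverse by metis
    ultimately show "z \<in> nonunits V" using z J' unfolding nonunits_def by blast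
  qed
  show ?thesis
  proof
    assume "maximalideal P (subring_of_type V)"
    then interpret maximalideal P "subring_of_type V" .
    have "P \<subseteq> nonunits V" by (rule sub) (use is_ideal I_notcarr in auto)
    with I_maximal[OF id] N show "P = nonunits V" using C(1) by auto
  next
    assume P: "P = nonunits V"
    show "maximalideal P (subring_of_type V)"
      unfolding P by (rule maximalidealI) (use id sub N C(1) in auto)
  qed
qed

lemma valuation_ring_of_nonunits:
  assumes V: "valuation_ring K V"
  shows "V = {z. z = 0 \<or> inverse z \<notin> nonunits V}"
  using valuation_ringD(3)[OF V] is_subringD(2)[OF valuation_ringD(1)[OF V]]
  unfolding nonunits_def by auto

lemma place_iff: "place K P \<longleftrightarrow> (\<exists>V. valuation_ring K V \<and> P = nonunits V)"
  unfolding place_def using maximalideal_iff_nonunits by blast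

lemma place_ring_nonunits:
  assumes V: "valuation_ring K V" shows "place_ring K (nonunits V) = subring_of_type V"
proof -
  have "(THE W. valuation_ring K W \<and> maximalideal (nonunits V) (subring_of_type W)) = V"
  proof (rule the_equality)
    fix W assume "valuation_ring K W \<and> maximalideal (nonunits V) (subring_of_type W)"
    then show "W = V"
      using maximalideal_iff_nonunits V valuation_ring_of_nonunits by metis
  qed (use maximalideal_iff_nonunits[OF V] V in auto)
  then show ?thesis unfolding place_ring_def by simp
qed

section \<open>Discrete valuations\<close>

text \<open>
  The value at \<open>0\<close> is left open, as for \<^const>\<open>valuation\<close>: every law is restricted to nonzero
  arguments, so that \<^const>\<open>valuation\<close> itself is an instance.
\<close>
locale discrete_valuation =
  fixes v :: "'f::field \<Rightarrow> int"
  assumes mult: "a \<noteq> 0 \<Longrightarrow> b \<noteq> 0 \<Longrightarrow> v (a * b) = v a + v b"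
    and ultrametric: "a \<noteq> 0 \<Longrightarrow> b \<noteq> 0 \<Longrightarrow> a + b \<noteq> 0 \<Longrightarrow> min (v a) (v b) \<le> v (a + b)"
    and uniformizer_exists: "\<exists>a. a \<noteq> 0 \<and> v a = 1"
begin

definition ring where "ring = {z. z = 0 \<or> 0 \<le> v z}"

lemma one [simp]: "v 1 = 0"
  using mult[of 1 1] by simp

lemma inverse [simp]: "a \<noteq> 0 \<Longrightarrow> v (inverse a) = - v a"
  using mult[of a "inverse a"] by simp

lemma divide: "a \<noteq> 0 \<Longrightarrow> b \<noteq> 0 \<Longrightarrow> v (a / b) = v a - v b"
  unfolding divide_inverse by (subst mult) auto

lemma power: "a \<noteq> 0 \<Longrightarrow> v (a ^ n) = int n * v a"
  by (induction n) (auto simp: mult algebra_simps)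

lemma powi: "a \<noteq> 0 \<Longrightarrow> v (a powi n) = n * v a"
  by (cases n rule: int_cases3) (auto simp: power power_int_minus)

lemma neg [simp]: "v (- a) = v a"
proof (cases "a = 0")
  case False
  have "2 * v (- 1) = 0" using mult[of "-1" "-1"] by simp
  then show ?thesis using mult[of "-1" a] False by simp
qed auto

lemma prod: "(\<And>i. i \<in> I \<Longrightarrow> f i \<noteq> 0) \<Longrightarrow> v (prod f I) = (\<Sum>i\<in>I. v (f i))"
  by (induction I rule: infinite_finite_induct) (auto simp: mult)

lemma is_subring_ring: "is_subring ring"
  unfolding is_subring_def
proof (intro conjI ballI)
  fix a b assume "a \<in> ring" "b \<in> ring"
  then show "a + b \<in> ring" "a * b \<in> ring"
    using ultrametric[of a b] mult[of a b] unfolding ring_def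
    by (cases "a = 0 \<or> b = 0 \<or> a + b = 0"; auto)+
qed (auto simp: ring_def)

lemma ring_total: "z \<in> ring \<or> inverse z \<in> ring"
  unfolding ring_def by (cases "z = 0") auto

lemma nonunits_ring: "nonunits ring = {z. z = 0 \<or> 0 < v z}"
  unfolding nonunits_def ring_def by auto

lemma val_prime_element:
  assumes K: "valuation_ring K ring"
  shows "prime_element K (nonunits ring) t \<longleftrightarrow> t \<noteq> 0 \<and> v t = 1"
proof -
  obtain u where u: "u \<noteq> 0" "v u = 1" using uniformizer_exists by blast
  have eq: "PIdl\<^bsub>subring_of_type ring\<^esub> t = {x * t | x. x \<in> ring}"
    unfolding cgenideal_def by simp
  show ?thesis
  proof
    assume "prime_element K (nonunits ring) t"
    then have "t \<in> ring" and t: "nonunits ring = {x * t | x. x \<in> ring}"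
      unfolding prime_element_def place_ring_nonunits[OF K] eq by auto
    have "u \<in> nonunits ring" unfolding nonunits_ring using u by simp
    then obtain x where x: "u = x * t" "x \<in> ring" using t by auto
    with u have nz: "x \<noteq> 0" "t \<noteq> 0" by auto
    then have "1 = v x + v t" using x u mult by metis
    moreover have "v x \<ge> 0" using x nz unfolding ring_def by auto
    moreover have "1 * t \<in> nonunits ring" unfolding t
      using is_subringD(1)[OF is_subring_ring] by blast
    then have "v t > 0" unfolding nonunits_ring using nz by simp
    ultimately show "t \<noteq> 0 \<and> v t = 1" using nz by simp
  next
    assume t: "t \<noteq> 0 \<and> v t = 1"
    have "\<exists>x. z = x * t \<and> x \<in> ring" if "z \<in> nonunits ring" for z
      by (rule exI[of _ "z / t"], cases "z = 0")
        (use that t in \<open>auto simp: nonunits_ring divide, auto simp: ring_def divide\<close>)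
    moreover have "x * t \<in> nonunits ring" if "x \<in> ring" for x
      using that t unfolding nonunits_ring by (cases "x = 0") (auto simp: mult ring_def)
    ultimately show "prime_element K (nonunits ring) t"
      unfolding prime_element_def place_ring_nonunits[OF K] eq using t by (auto simp: ring_def)
  qed
qed

lemma Units_ring: "Units (subring_of_type ring) = {u. u \<noteq> 0 \<and> v u = 0}"
proof -
  have "v u = 0" if "x \<in> ring" "u \<in> ring" "x * u = 1" for x u
  proof -
    have "x \<noteq> 0" "u \<noteq> 0" using that by auto
    then have "v x + v u = 0" using that(3) mult one by metis
    then show ?thesis using that \<open>x \<noteq> 0\<close> \<open>u \<noteq> 0\<close> unfolding ring_def by auto
  qed
  moreover have "\<exists>x\<in>ring. x * u = 1 \<and> u * x = 1" if "u \<noteq> 0" "v u = 0" for u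
    by (rule bexI[of _ "inverse u"]) (use that in \<open>auto simp: ring_def\<close>)
  moreover have "u \<in> ring" if "v u = 0" for u using that by (simp add: ring_def)
  moreover have "u \<noteq> 0" if "x * u = 1" for x u :: 'f using that by auto
  ultimately have "(u \<in> ring \<and> (\<exists>x\<in>ring. x * u = 1 \<and> u * x = 1)) \<longleftrightarrow> u \<noteq> 0 \<and> v u = 0" for u
    by (intro iffI conjI; (elim conjE bexE)?; blast?)
  then show ?thesis unfolding Units_def by simp
qed

lemma valuation_eq:
  assumes K: "valuation_ring K ring" and z: "z \<noteq> 0"
  shows "valuation K (nonunits ring) z = v z"
  unfolding valuation_def
proof (rule the_equality)
  obtain u where u: "u \<noteq> 0" "v u = 1" using uniformizer_exists by blast
  show "\<exists>t u. prime_element K (nonunits ring) t \<and>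
    u \<in> Units (place_ring K (nonunits ring)) \<and> z = t powi v z * u"
    unfolding place_ring_nonunits[OF K] Units_ring val_prime_element[OF K]
    by (rule exI[of _ u], rule exI[of _ "z / u powi v z"]) (use u z in \<open>auto simp: divide powi\<close>)
next
  fix n assume "\<exists>t u. prime_element K (nonunits ring) t \<and>
    u \<in> Units (place_ring K (nonunits ring)) \<and> z = t powi n * u"
  then show "n = v z"
    unfolding place_ring_nonunits[OF K] Units_ring val_prime_element[OF K]
    by (auto simp: mult powi)
qed

lemma discrete_valuation_valuation:
  assumes K: "valuation_ring K ring"
  shows "discrete_valuation (valuation K (nonunits ring))"
proof
  obtain u where "u \<noteq> 0" "v u = 1" using uniformizer_exists by blast
  then show "\<exists>a. a \<noteq> 0 \<and> valuation K (nonunits ring) a = 1"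
    using valuation_eq[OF K] by auto
  fix a b :: 'f assume ab: "a \<noteq> 0" "b \<noteq> 0"
  then have "a * b \<noteq> 0" by simp
  with ab show "valuation K (nonunits ring) (a * b)
      = valuation K (nonunits ring) a + valuation K (nonunits ring) b"
    by (simp add: valuation_eq[OF K] mult)
  assume "a + b \<noteq> 0"
  with ab show "min (valuation K (nonunits ring) a) (valuation K (nonunits ring) b)
      \<le> valuation K (nonunits ring) (a + b)"
    by (simp add: valuation_eq[OF K] ultrametric)
qed

text \<open>
  The strict triangle law: no cancellation is possible between terms of different value. For the
  terms \<open>c y ^ i\<close> the injectivity hypothesis holds because the pole orders of \<open>h\<close> are prime to \<open>q\<close>.
\<close>
lemma sum_distinct:
  assumes "finite I" "I \<noteq> {}" "\<And>i. i \<in> I \<Longrightarrow> a i \<noteq> 0" "inj_on (\<lambda>i. v (a i)) I"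
  shows "sum a I \<noteq> 0 \<and> v (sum a I) = Min ((\<lambda>i. v (a i)) ` I)"
  using assms
proof (induction I rule: finite_ne_induct)
  case (insert x F)
  then have IH: "sum a F \<noteq> 0" "v (sum a F) = Min ((\<lambda>i. v (a i)) ` F)"
    by (auto simp: inj_on_def)
  have "v (sum a F) \<in> (\<lambda>i. v (a i)) ` F" unfolding IH(2) by (rule Min_in) (use insert in auto)
  then obtain i where i: "i \<in> F" "v (sum a F) = v (a i)" by blast
  have ne: "v (a x) \<noteq> v (sum a F)"
  proof
    assume "v (a x) = v (sum a F)"
    then have "x = i" by (intro inj_onD[OF insert.prems(2)]) (simp_all add: i)
    then show False using i(1) insert.hyps(3) by simp
  qed
  have key: "b + c \<noteq> 0 \<and> v (b + c) = v b" if "b \<noteq> 0" "c \<noteq> 0" "v b < v c" for b c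
  proof -
    have nz: "b + c \<noteq> 0"
    proof
      assume "b + c = 0" then have "b = - c" by (simp add: eq_neg_iff_add_eq_0)
      then show False using that by simp
    qed
    have "v b \<le> v (b + c)" using ultrametric[OF that(1,2) nz] that(3) by simp
    moreover have "min (v (b + c)) (v (- c)) \<le> v (b + c + - c)"
      by (rule ultrametric) (use that nz in auto)
    ultimately show ?thesis using nz that(3) by (simp add: min_def split: if_splits)
  qed
  have ax: "a x \<noteq> 0" using insert.prems(1) by simp
  have "a x + sum a F \<noteq> 0 \<and> v (a x + sum a F) = min (v (a x)) (v (sum a F))"
  proof (cases "v (a x) < v (sum a F)")
    case True
    then show ?thesis using key[OF ax IH(1)] by simp
  next
    case False
    then show ?thesis using key[OF IH(1) ax] ne by (simp add: add.commute)
  qed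
  then show ?case using insert.hyps IH(2) by simp
qed simp

end

text \<open>
  A uniformizer is not a constant, since its inverse would have to lie in \<open>V\<close> as well.
\<close>
lemma valuation_ring_of_discrete_valuation:
  assumes v: "discrete_valuation v" "V = {z. z = 0 \<or> 0 \<le> v z}"
    and K: "K \<subseteq> V" "\<And>c. c \<in> K \<Longrightarrow> inverse c \<in> K"
  shows "valuation_ring K V"
proof -
  interpret discrete_valuation v by fact
  have V: "V = ring" unfolding ring_def v(2) ..
  obtain t where t: "t \<noteq> 0" "v t = 1" using uniformizer_exists by blast
  then have "Fields.inverse t \<notin> V" "t \<in> V" unfolding v(2) by simp_all
  moreover from this have "t \<notin> K" using K by blast
  ultimately show ?thesis
    unfolding valuation_ring_iff using K(1) is_subring_ring ring_total unfolding V by blast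
qed

text \<open>
  All discrete valuations below arise from this criterion. Since \<open>inverse p \<notin> V\<close>, a power of
  \<open>p\<close> times a unit lies in \<open>V\<close> only if the exponent is nonnegative; this makes the exponent in
  \<open>z = p powi n * u\<close> unique, and it is the value of \<open>z\<close>.
\<close>
lemma discrete_valuation_of_uniformizer:
  assumes C: "is_subring V" and p: "p \<in> V" "inverse p \<notin> V"
    and dec: "\<And>z. z \<noteq> 0 \<Longrightarrow> \<exists>n u. u \<noteq> 0 \<and> u \<in> V \<and> inverse u \<in> V \<and> z = p powi n * u"
  shows "\<exists>v. discrete_valuation v \<and> v p = 1 \<and> V = {z. z = 0 \<or> 0 \<le> v z}"
proof -
  note C = is_subringD[OF C]
  define U where "U = {u. u \<noteq> 0 \<and> u \<in> V \<and> inverse u \<in> V}"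
  have p0: "p \<noteq> 0" using p C by auto
  have pown: "p powi n \<in> V \<longleftrightarrow> n \<ge> 0" for n
  proof (cases n rule: int_cases2)
    case (nonneg k) then show ?thesis using C(7)[OF p(1), of k] by simp
  next
    case (nonpos k)
    show ?thesis
    proof (cases "k = 0")
      case False
      then obtain l where l: "k = Suc l" by (cases k) auto
      have "inverse p = p ^ l * p powi n"         using p0
        unfolding nonpos l power_int_minus power_int_of_nat by simp
      then have "p powi n \<notin> V" using p(2) C(6)[OF C(7)[OF p(1), of l]] by metis
      then show ?thesis using nonpos False by simp
    qed (use nonpos C in auto)
  qed
  have UV: "z * u \<in> V \<longleftrightarrow> z \<in> V" if "u \<in> U" for z u
  proof
    assume "z * u \<in> V"
    then have "z * u * inverse u \<in> V" using that unfolding U_def by (blast intro: C)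
    then show "z \<in> V" using that unfolding U_def by (simp add: mult.assoc)
  qed (use that in \<open>auto simp: U_def intro: C\<close>)
  have Uinv: "inverse u \<in> U" if "u \<in> U" for u using that unfolding U_def by auto
  have Um: "u * w \<in> U" if "u \<in> U" "w \<in> U" for u w
    using that unfolding U_def by (auto intro: C)
  have uniq: "n = m" if "p powi n * u = p powi m * w" "u \<in> U" "w \<in> U" for n m u w
  proof -
    have "p powi (n - m) * u = w" using that(1) p0 by (simp add: power_int_diff field_simps)
    then have 1: "n - m \<ge> 0" using UV[OF that(2), of "p powi (n - m)"] that(3) pown U_def by auto
    have "p powi (m - n) * w = u" using that(1) p0 by (simp add: power_int_diff field_simps)
    then have 2: "m - n \<ge> 0" using UV[OF that(3), of "p powi (m - n)"] that(2) pown U_def by auto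
    from 1 2 show ?thesis by simp
  qed
  define v where "v z = (THE n. \<exists>u\<in>U. z = p powi n * u)" for z
  have v: "v (p powi n * u) = n" if "u \<in> U" for n u
    unfolding v_def by (rule the_equality) (use that uniq in auto)
  have dec': "\<exists>u\<in>U. z = p powi v z * u" if z: "z \<noteq> 0" for z
    using dec[OF z] v unfolding U_def by fastforce
  have one: "1 \<in> U" using C unfolding U_def by auto
  have ring: "z \<in> V \<longleftrightarrow> 0 \<le> v z" if z: "z \<noteq> 0" for z
  proof -
    obtain u where "u \<in> U" "z = p powi v z * u" using dec'[OF z] by blast
    then show ?thesis using UV[of u "p powi v z"] pown by simp
  qed
  have m: "v (a * b) = v a + v b" if ab: "a \<noteq> 0" "b \<noteq> 0" for a b
  proof -
    obtain u where u: "u \<in> U" "a = p powi v a * u" using dec'[OF ab(1)] by blast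
    obtain w where w: "w \<in> U" "b = p powi v b * w" using dec'[OF ab(2)] by blast
    have "a * b = p powi (v a + v b) * (u * w)"
      by (subst u(2), subst w(2)) (simp add: power_int_add p0)
    then show ?thesis using v[OF Um[OF u(1) w(1)]] by simp
  qed
  have "v 1 = 0" using m[of 1 1] by simp
  then have i: "v (inverse a) = - v a" if "a \<noteq> 0" for a using m[of a "inverse a"] that by simp
  have le: "v a \<le> v (a + b)" if ab: "a \<noteq> 0" "b \<noteq> 0" "a + b \<noteq> 0" "v a \<le> v b" for a b
  proof -
    have "b / a \<in> V" using ring[of "b / a"] ab m[of b "inverse a"] i by (simp add: divide_inverse)
    then have "1 + b / a \<in> V" by (intro C)
    moreover have eq: "1 + b / a = (a + b) * inverse a" using ab by (simp add: field_simps)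
    ultimately have "0 \<le> v ((a + b) * inverse a)" using ring[of "1 + b / a"] ab by simp
    then show ?thesis using m[of "a + b" "inverse a"] i ab by simp
  qed
  have "discrete_valuation v"
  proof
    show "min (v a) (v b) \<le> v (a + b)" if "a \<noteq> 0" "b \<noteq> 0" "a + b \<noteq> 0" for a b
      using le[of a b] le[of b a] that by (auto simp: min_def add.commute)
    show "\<exists>a. a \<noteq> 0 \<and> v a = 1" using v[OF one, of 1] p0 by auto
  qed (rule m)
  moreover have "v p = 1" using v[OF one, of 1] by simp
  moreover have "z \<in> V \<longleftrightarrow> z = 0 \<or> 0 \<le> v z" for z using ring[of z] C(2) by (cases "z = 0") auto
  then have "V = {z. z = 0 \<or> 0 \<le> v z}" by blast
  ultimately show ?thesis by blast
qed

section \<open>Degrees of places of the rational function field\<close>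

abbreviation K_x :: "'k::field poly fract set" where "K_x \<equiv> range const_fract"

lemma const_fract_simps [simp]:
  "const_fract 0 = 0" "const_fract 1 = 1" "const_fract (a + b) = const_fract a + const_fract b"
  "const_fract (- a) = - const_fract a"
  "const_fract (a * b) = const_fract a * const_fract b" "const_fract a = 0 \<longleftrightarrow> a = 0"
  by (simp_all add: const_fract_def one_pCons[symmetric] flip: to_fract_add to_fract_mult to_fract_uminus)

lemma const_fract_inverse: "const_fract (inverse a) = inverse (const_fract a)"
proof (cases "a = 0")
  case False
  then have "const_fract (inverse a) * const_fract a = 1"
    unfolding const_fract_simps(5)[symmetric] by simp
  then show ?thesis using False by (simp add: field_simps)
qed simp

lemma const_fract_inverse_mem: "c \<in> K_x \<Longrightarrow> inverse c \<in> K_x"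
  by (auto simp flip: const_fract_inverse)

lemma fract_rep: obtains f g where "g \<noteq> 0" "z = to_fract f / to_fract g"
  by (cases z) (auto simp: Fract_conv_to_fract)

lemma to_fract_power: "to_fract (f ^ n) = to_fract f ^ n"
  by (induction n) auto

lemma to_fract_eq_divideD:
  "to_fract f / to_fract g = to_fract f' / to_fract g' \<Longrightarrow> g \<noteq> 0 \<Longrightarrow> g' \<noteq> 0 \<Longrightarrow> f * g' = f' * g"
  by (simp add: field_simps flip: to_fract_mult)

lemma K_x_subfield: "subfield (K_x :: 'k::field poly fract set) ring_of_type_algebra"
proof -
  interpret field "ring_of_type_algebra :: 'k poly fract ring" by (rule field_from_type_algebra)
  show ?thesis
  proof (rule subfieldI')
    show "subring K_x (ring_of_type_algebra :: 'k poly fract ring)"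
      unfolding subring_iff_is_subring is_subring_def
      by (auto simp flip: const_fract_simps(2-5))
    show "inv\<^bsub>ring_of_type_algebra\<^esub> z \<in> K_x"
      if "z \<in> K_x - {\<zero>\<^bsub>ring_of_type_algebra\<^esub>}" for z :: "'k poly fract"
      using that by (auto simp flip: const_fract_inverse)
  qed
qed

text \<open>
  The hypotheses say that the polynomials of degree less than \<open>d\<close> represent every residue class
  exactly once. The classes of \<open>1, x, \<dots>, x ^ (d - 1)\<close> then form a basis of the residue field; the proof
  adjoins them one at a time, along the inductive definition of dimension. The infinite place is
  covered with \<open>d = 1\<close>.
\<close>
lemma place_degree_eq:
  fixes V :: "'k::field poly fract set"
  assumes V: "valuation_ring K_x V"
    and in_ring: "\<And>f. degree f < d \<Longrightarrow> to_fract f \<in> V"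
    and indep: "\<And>f. f \<noteq> 0 \<Longrightarrow> degree f < d \<Longrightarrow> to_fract f \<notin> nonunits V"
    and span: "\<And>z. z \<in> V \<Longrightarrow> \<exists>f. degree f < d \<and> z - to_fract f \<in> nonunits V"
  shows "place_degree K_x (nonunits V) = d"
proof -
  define R where "R = subring_of_type V"
  define P where "P = nonunits V"
  define k where "k = R Quot P"
  define cl where "cl = (\<lambda>c. P +>\<^bsub>R\<^esub> c)"
  note VC = valuation_ringD(1)[OF V]
  note VV = is_subringD[OF VC]
  interpret R: cring R unfolding R_def by (rule subring_of_type_ring[OF VC])
  interpret P: maximalideal P R
    unfolding R_def P_def maximalideal_iff_nonunits[OF V] ..
  interpret k: field k unfolding k_def by (rule P.quotient_is_field) unfold_locales
  interpret cl: ring_hom_ring R k cl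
    unfolding k_def cl_def by (rule P.rcos_ring_hom_ring)
  have cl_add: "cl (a + b) = cl a \<oplus>\<^bsub>k\<^esub> cl b" if "a \<in> V" "b \<in> V" for a b
    using cl.hom_add[of a b] that unfolding R_def by simp
  have cl_mult: "cl (a * b) = cl a \<otimes>\<^bsub>k\<^esub> cl b" if "a \<in> V" "b \<in> V" for a b
    using cl.hom_mult[of a b] that unfolding R_def by simp
  have cl0: "cl 0 = \<zero>\<^bsub>k\<^esub>" using cl.hom_zero unfolding R_def by simp
  have neg: "\<ominus>\<^bsub>R\<^esub> a = - a" if "a \<in> V" for a
    by (rule R.minus_equality) (use that VV in \<open>auto simp: R_def\<close>)
  have cl_eq: "cl a = cl b \<longleftrightarrow> a - b \<in> P" if "a \<in> V" "b \<in> V" for a b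
  proof -
    have "a \<ominus>\<^bsub>R\<^esub> b = a - b" using neg[OF that(2)] unfolding a_minus_def by (simp add: R_def)
    moreover have ab: "a \<in> carrier R" "b \<in> carrier R" using that unfolding R_def by auto
    ultimately have "a \<in> P +>\<^bsub>R\<^esub> b \<longleftrightarrow> a - b \<in> P"
      using P.a_rcos_module[OF ab(2,1)] unfolding a_minus_def by simp
    moreover have "a \<in> P +>\<^bsub>R\<^esub> b \<longleftrightarrow> cl a = cl b"
      using P.a_rcos_self[OF ab(1)] R.a_repr_independence[OF _ ab(2) P.a_subgroup, of a]
      unfolding cl_def by auto
    ultimately show ?thesis by simp
  qed
  have car: "carrier k = cl ` V"
    unfolding k_def cl_def FactRing_def A_RCOSETS_def' by (auto simp: R_def)
  have sub: "subfield (cl ` K_x) k"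
  proof (rule cl.img_is_subfield(2))
    have "K_x \<subseteq> V" using valuation_ringD[OF V] by simp
    interpret F: field "ring_of_type_algebra :: 'k poly fract ring"
      by (rule field_from_type_algebra)
    have "field (R\<lparr>carrier := K_x\<rparr>)"
      using F.subfield_iff(2)[OF K_x_subfield] unfolding R_def by simp
    then show "subfield K_x R"
      using \<open>K_x \<subseteq> V\<close> by (intro R.subfield_iff(1)) (simp_all add: R_def)
    show "\<one>\<^bsub>k\<^esub> \<noteq> \<zero>\<^bsub>k\<^esub>" by simp
  qed
  define E where "E i = (\<lambda>f. cl (to_fract f)) ` {f. \<forall>j\<ge>i. coeff f j = 0}" for i
  have deg: "degree f < d" if "\<forall>j\<ge>i. coeff f j = 0" "i \<le> d" "0 < d" for f :: "'k poly" and i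
    using degree_le[of "d - 1" f] that by auto
  have d0: "0 < d" using span[OF VV(1)] by auto
  have dim: "k.dimension i (cl ` K_x) (E i)" if "i \<le> d" for i
    using that
  proof (induction i)
    case 0
    have "{f :: 'k poly. \<forall>j\<ge>0. coeff f j = 0} = {0}" by (auto simp: poly_eq_iff)
    then have "E 0 = {\<zero>\<^bsub>k\<^esub>}" unfolding E_def using cl0 by simp
    then show ?case by (simp add: k.zero_dim)
  next
    case (Suc i)
    define w where "w = to_fract (Polynomial.monom (1::'k) i)"
    have w: "w \<in> V" unfolding w_def by (rule in_ring) (use Suc.prems in \<open>simp add: degree_monom_eq\<close>)
    have "cl w \<notin> E i"
    proof
      assume "cl w \<in> E i"
      then obtain f where f: "\<forall>j\<ge>i. coeff f j = 0" "cl w = cl (to_fract f)" unfolding E_def by auto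
      have df: "degree f < d" using deg[OF f(1)] Suc.prems by simp
      define g where "g = Polynomial.monom 1 i - f"
      have "coeff g i = 1" unfolding g_def using f(1) by simp
      then have "g \<noteq> 0" by auto
      moreover have "degree g < d"
        unfolding g_def
          by (rule degree_diff_less) (use df Suc.prems in \<open>auto simp: degree_monom_eq\<close>)
      ultimately have "to_fract g \<notin> P" unfolding P_def by (rule indep)
      then show False using f(2) cl_eq[OF w in_ring[OF df]] unfolding g_def w_def by simp
    qed
    moreover have "E (Suc i) = k.line_extension (cl ` K_x) (cl w) (E i)"
    proof (intro equalityI subsetI)
      fix z assume "z \<in> E (Suc i)"
      then obtain f where f: "\<forall>j\<ge>Suc i. coeff f j = 0" "z = cl (to_fract f)" unfolding E_def by auto
      define g where "g = f - Polynomial.monom (coeff f i) i"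
      have g: "\<forall>j\<ge>i. coeff g j = 0" unfolding g_def using f(1)
        by (auto simp: le_Suc_eq)
      have gV: "to_fract g \<in> V" by (rule in_ring[OF deg[OF g _ d0]]) (use Suc.prems in simp)
      have "f = [:coeff f i:] * Polynomial.monom 1 i + g" unfolding g_def by (simp add: smult_monom)
      then have "to_fract f = const_fract (coeff f i) * w + to_fract g"
        unfolding const_fract_def w_def by (metis to_fract_add to_fract_mult)
      moreover have "const_fract (coeff f i) \<in> V" using valuation_ringD(2)[OF V] by auto
      ultimately have "z = cl (const_fract (coeff f i)) \<otimes>\<^bsub>k\<^esub> cl w \<oplus>\<^bsub>k\<^esub> cl (to_fract g)"
        using f(2) cl_add cl_mult w gV VV(6) by metis
      moreover have "cl (to_fract g) \<in> E i" unfolding E_def using g by auto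
      ultimately show "z \<in> k.line_extension (cl ` K_x) (cl w) (E i)"
        unfolding k.line_extension_mem_iff by blast
    next
      fix z assume "z \<in> k.line_extension (cl ` K_x) (cl w) (E i)"
      then obtain c g where g: "\<forall>j\<ge>i. coeff g j = 0"
          and z: "z = cl (const_fract c) \<otimes>\<^bsub>k\<^esub> cl w \<oplus>\<^bsub>k\<^esub> cl (to_fract g)"
        unfolding k.line_extension_mem_iff E_def by blast
      have gV: "to_fract g \<in> V" by (rule in_ring[OF deg[OF g _ d0]]) (use Suc.prems in simp)
      have "const_fract c \<in> V" using valuation_ringD(2)[OF V] by auto
      then have "z = cl (const_fract c * w + to_fract g)" unfolding z
        using cl_add cl_mult w gV VV(6) by metis
      also have "const_fract c * w + to_fract g = to_fract (Polynomial.monom c i + g)"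
        unfolding const_fract_def w_def by (simp add: smult_monom flip: to_fract_add to_fract_mult)
      finally have "z = cl (to_fract (Polynomial.monom c i + g))" .
      moreover have "\<forall>j\<ge>Suc i. coeff (Polynomial.monom c i + g) j = 0" using g by auto
      ultimately show "z \<in> E (Suc i)" unfolding E_def by blast
    qed
    moreover have "cl w \<in> carrier k" using car w by auto
    ultimately show ?case using k.Suc_dim[of "cl w" "E i" i "cl ` K_x"] Suc by auto
  qed
  have "E d = carrier k"
  proof -
    have "\<exists>f. (\<forall>j\<ge>d. coeff f j = 0) \<and> cl z = cl (to_fract f)" if "z \<in> V" for z
      using span[OF that] cl_eq[OF that in_ring] unfolding P_def
        by (meson coeff_eq_0 le_trans not_le order_less_le_trans)
    moreover have "to_fract f \<in> V" if "\<forall>j\<ge>d. coeff f j = 0" for f :: "'k poly"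
      by (rule in_ring[OF deg[OF that _ d0]]) simp
    ultimately show ?thesis unfolding car E_def by blast
  qed
  then have "k.dimension d (cl ` K_x) (carrier k)" using dim[of d] by simp
  then have "k.dim (cl ` K_x) (carrier k) = d"
    unfolding k.dim_def using k.dimension_is_inj[OF sub] by blast
  then show ?thesis
    unfolding place_degree_def place_ring_nonunits[OF V] Let_def k_def cl_def R_def P_def by simp
qed

section \<open>Places of the rational function field\<close>

lemma nonunits_of_valuation_ring:
  assumes "valuation_ring K V"
  shows "nonunits V \<subseteq> V" "0 \<in> nonunits V" "1 \<notin> nonunits V"
    "a \<in> nonunits V \<Longrightarrow> b \<in> nonunits V \<Longrightarrow> a + b \<in> nonunits V"
    "x \<in> V \<Longrightarrow> a \<in> nonunits V \<Longrightarrow> x * a \<in> nonunits V"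
  using nonunits_of_total_subring[OF valuation_ringD(1)[OF assms] valuation_ringD(3)[OF assms]]
    by blast+

definition fin_ring :: "'k::field poly \<Rightarrow> 'k poly fract set"
  where "fin_ring p = {to_fract f / to_fract g | f g. \<not> p dvd g}"

definition fin_place :: "'k::field poly \<Rightarrow> 'k poly fract set"
  where "fin_place p = nonunits (fin_ring p)"

definition inf_ring :: "'k::field poly fract set"
  where "inf_ring = {to_fract f / to_fract g | f g. g \<noteq> 0 \<and> degree f \<le> degree g}"

lemma irreducible_degree: "irreducible (p :: 'k::field poly) \<Longrightarrow> 0 < degree p"
  by (rule ccontr) (auto simp: Factorial_Ring.irreducible_def is_unit_iff_degree)

lemma prime_part_decomp:
  fixes f :: "'k::field poly"
  assumes p: "0 < degree p" and "f \<noteq> 0" shows "\<exists>n g. f = p ^ n * g \<and> \<not> p dvd g"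
  using assms(2)
proof (induction "degree f" arbitrary: f rule: less_induct)
  case less
  show ?case
  proof (cases "p dvd f")
    case True
    then obtain g where g: "f = p * g" by blast
    with less.prems have "g \<noteq> 0" "p \<noteq> 0" by auto
    then have "degree g < degree f" using p unfolding g by (simp add: degree_mult_eq)
    from less.hyps[OF this \<open>g \<noteq> 0\<close>] obtain n h where "g = p ^ n * h" "\<not> p dvd h" by blast
    then have "f = p ^ Suc n * h \<and> \<not> p dvd h" unfolding g by simp
    then show ?thesis by blast
  next
    case False
    then show ?thesis by (intro exI[of _ 0] exI[of _ f]) simp
  qed
qed

lemma irreducible_factor_exists:
  fixes f :: "'k::field poly"
  assumes "0 < degree f" shows "\<exists>p. irreducible p \<and> p dvd f"
  using assms
proof (induction "degree f" arbitrary: f rule: less_induct)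
  case less
  show ?case
  proof (cases "irreducible f")
    case False
    have "f \<noteq> 0" using less.prems by auto
    then have "\<not> is_unit f" using less.prems by (simp add: is_unit_iff_degree)
    with \<open>f \<noteq> 0\<close> False obtain a b where ab: "f = a * b" "\<not> is_unit a" "\<not> is_unit b"
      unfolding Factorial_Ring.irreducible_def by blast
    with \<open>f \<noteq> 0\<close> have nz: "a \<noteq> 0" "b \<noteq> 0" by auto
    then have "0 < degree a" "0 < degree b" using ab by (auto simp: is_unit_iff_degree)
    then have "degree a < degree f" using ab nz by (simp add: degree_mult_eq)
    from less.hyps[OF this \<open>0 < degree a\<close>] show ?thesis using ab by (metis dvd_mult2)
  qed (use dvd_refl in blast)
qed

text \<open>
  A nonzero combination of \<open>p\<close> and \<open>g\<close> of least degree divides both of them. The coefficients are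
  used to invert \<open>g\<close> modulo \<open>p\<close> in the residue field of a finite place.
\<close>
lemma irreducible_bezout:
  fixes p g :: "'k::field poly"
  assumes p: "irreducible p" and g: "\<not> p dvd g"
  shows "\<exists>a b. a * p + b * g = 1"
proof -
  define S where "S = {d. d \<noteq> 0 \<and> (\<exists>a b. d = a * p + b * g)}"
  have "p \<noteq> 0" using p by (auto simp: Factorial_Ring.irreducible_def)
  have "p = 1 * p + 0 * g" by simp
  then have "p \<in> S" unfolding S_def using \<open>p \<noteq> 0\<close> by blast
  define d where "d = arg_min degree (\<lambda>x. x \<in> S)"
  have dS: "d \<in> S" unfolding d_def by (rule arg_min_natI) fact
  have dmin: "degree d \<le> degree e" if "e \<in> S" for e unfolding d_def by (rule arg_min_nat_le) fact
  obtain a b where ab: "d = a * p + b * g" "d \<noteq> 0" using dS unfolding S_def by blast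
  have dvd: "d dvd a' * p + b' * g" for a' b'
  proof (rule ccontr)
    define e where "e = a' * p + b' * g"
    assume "\<not> d dvd a' * p + b' * g"
    then have nz: "e mod d \<noteq> 0" unfolding e_def by (simp add: dvd_eq_mod_eq_0)
    have "e mod d = e - e div d * d" by (simp add: minus_div_mult_eq_mod)
    also have "\<dots> = (a' - e div d * a) * p + (b' - e div d * b) * g"
      by (subst (2) ab(1)) (simp add: e_def algebra_simps)
    finally have "e mod d \<in> S" unfolding S_def using nz by blast
    then have "degree d \<le> degree (e mod d)" by (rule dmin)
    then show False using degree_mod_less[OF ab(2), of e] nz by simp
  qed
  have "d dvd p" using dvd[of 1 0] by simp
  moreover have "d dvd g" using dvd[of 0 1] by simp
  ultimately have "is_unit d"
    using p g irreducible_altdef[of p] by (metis dvd_trans)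
  then obtain e where "1 = d * e" by blast
  then have "(e * a) * p + (e * b) * g = 1" unfolding ab(1) by (simp add: algebra_simps)
  then show ?thesis by blast
qed

context
  fixes p :: "'k::field poly"
  assumes p: "irreducible p"
begin

lemma irreducible_dvd_mult_iff: "p dvd a * b \<longleftrightarrow> p dvd a \<or> p dvd b"
  using field_poly_irreducible_imp_prime[OF p] by (simp add: prime_elem_dvd_mult_iff)

lemma irreducible_nonzero_nonunit: "p \<noteq> 0" "\<not> p dvd 1"
  using p by (auto simp: Factorial_Ring.irreducible_def)

lemma fin_ringI: "\<not> p dvd g \<Longrightarrow> to_fract f / to_fract g \<in> fin_ring p"
  unfolding fin_ring_def by blast

lemma to_fract_fin_ring: "to_fract f \<in> fin_ring p"
  using fin_ringI[of 1 f] irreducible_nonzero_nonunit by simp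

lemma fin_ring_iff: "\<not> p dvd f \<Longrightarrow> to_fract f / to_fract g \<in> fin_ring p \<longleftrightarrow> \<not> p dvd g \<or> g = 0"
proof -
  assume f: "\<not> p dvd f"
  have "\<not> p dvd g" if *: "to_fract f / to_fract g \<in> fin_ring p" "g \<noteq> 0"
  proof -
    obtain f' g' where fg: "to_fract f / to_fract g = to_fract f' / to_fract g'" "\<not> p dvd g'"
      using *(1) unfolding fin_ring_def by blast
    then have "f * g' = f' * g" using * by (intro to_fract_eq_divideD) auto
    then show ?thesis using f fg irreducible_dvd_mult_iff by (metis dvd_mult)
  qed
  then show ?thesis using fin_ringI[of g f] to_fract_fin_ring[of 0] by auto
qed

lemma is_subring_fin_ring: "is_subring (fin_ring p)"
  unfolding is_subring_def
proof (intro conjI ballI)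
  show "1 \<in> fin_ring p" using to_fract_fin_ring[of 1] by simp
  fix a assume "a \<in> fin_ring p"
  then obtain f g where a: "a = to_fract f / to_fract g" "\<not> p dvd g" unfolding fin_ring_def by blast
  show "- a \<in> fin_ring p" using fin_ringI[OF a(2), of "- f"] a(1) by simp
  fix b assume "b \<in> fin_ring p"
  then obtain f' g' where b: "b = to_fract f' / to_fract g'" "\<not> p dvd g'" unfolding fin_ring_def
    by blast
  have nz: "g \<noteq> 0" "g' \<noteq> 0" using a b by auto
  have "\<not> p dvd g * g'" using a b irreducible_dvd_mult_iff by simp
  then have "to_fract (f * g' + f' * g) / to_fract (g * g') \<in> fin_ring p"
    "to_fract (f * f') / to_fract (g * g') \<in> fin_ring p" by (intro fin_ringI; assumption)+
  moreover have "to_fract (f * g' + f' * g) / to_fract (g * g') = a + b"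
    using a b nz by (simp add: add_frac_eq)
  ultimately show "a + b \<in> fin_ring p" "a * b \<in> fin_ring p"
    using a b by simp_all
qed

lemma fin_valuation_exists:
  "\<exists>v. discrete_valuation v \<and> v (to_fract p) = 1 \<and> fin_ring p = {z. z = 0 \<or> 0 \<le> v z}"
proof (rule discrete_valuation_of_uniformizer[OF is_subring_fin_ring to_fract_fin_ring])
  show "inverse (to_fract p) \<notin> fin_ring p"
    using fin_ring_iff[of 1 p] irreducible_nonzero_nonunit by (simp add: inverse_eq_divide)
  fix z :: "'k poly fract" assume "z \<noteq> 0"
  obtain f g where fg: "g \<noteq> 0" "z = to_fract f / to_fract g" by (rule fract_rep)
  with \<open>z \<noteq> 0\<close> have "f \<noteq> 0" by auto
  obtain n f' where f: "f = p ^ n * f'" "\<not> p dvd f'"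
    using prime_part_decomp[OF irreducible_degree[OF p] \<open>f \<noteq> 0\<close>] by blast
  obtain m g' where g: "g = p ^ m * g'" "\<not> p dvd g'"
    using prime_part_decomp[OF irreducible_degree[OF p] \<open>g \<noteq> 0\<close>] by blast
  have nz: "f' \<noteq> 0" "g' \<noteq> 0" using f g by auto
  have "z = to_fract p powi (int n - int m) * (to_fract f' / to_fract g')"
    unfolding fg f g using irreducible_nonzero_nonunit by (simp add: power_int_diff to_fract_power)
  moreover have "to_fract f' / to_fract g' \<in> fin_ring p" "to_fract g' / to_fract f' \<in> fin_ring p"
    using f g by (auto intro: fin_ringI)
  ultimately show "\<exists>n u. u \<noteq> 0 \<and> u \<in> fin_ring p \<and> inverse u \<in> fin_ring p
    \<and> z = to_fract p powi n * u"
    using nz by (intro exI[of _ "int n - int m"] exI[of _ "to_fract f' / to_fract g'"]) auto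
qed

lemma valuation_ring_fin: "valuation_ring K_x (fin_ring p)"
proof -
  have "K_x \<subseteq> fin_ring p" unfolding const_fract_def using to_fract_fin_ring by auto
  moreover obtain v where "discrete_valuation v" "fin_ring p = {z. z = 0 \<or> 0 \<le> v z}"
    using fin_valuation_exists by blast
  ultimately show ?thesis
    using valuation_ring_of_discrete_valuation const_fract_inverse_mem by blast
qed

lemma fin_place_val:
  shows "place K_x (fin_place p)" "discrete_valuation (valuation K_x (fin_place p))"
    "valuation K_x (fin_place p) (to_fract p) = 1"
    "f \<noteq> 0 \<Longrightarrow> 0 \<le> valuation K_x (fin_place p) (to_fract f)"
    "f \<noteq> 0 \<Longrightarrow> 0 < valuation K_x (fin_place p) (to_fract f) \<longleftrightarrow> p dvd f"
proof -
  obtain v where v: "discrete_valuation v" "v (to_fract p) = 1" "fin_ring p = {z. z = 0 \<or> 0 \<le> v z}"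
    using fin_valuation_exists by blast
  interpret discrete_valuation v by fact
  have r: "fin_ring p = ring" unfolding ring_def v(3) ..
  show "place K_x (fin_place p)" unfolding place_iff fin_place_def using valuation_ring_fin by blast
  note V = valuation_ring_fin[unfolded r]
  show "discrete_valuation (valuation K_x (fin_place p))"
    unfolding fin_place_def r by (rule discrete_valuation_valuation[OF V])
  show "valuation K_x (fin_place p) (to_fract p) = 1"
    unfolding fin_place_def r
      by (subst valuation_eq[OF V]) (use irreducible_nonzero_nonunit v in auto)
  assume f: "f \<noteq> 0"
  then have eq: "valuation K_x (fin_place p) (to_fract f) = v (to_fract f)"
    unfolding fin_place_def r by (subst valuation_eq[OF V]) auto
  show ge: "0 \<le> valuation K_x (fin_place p) (to_fract f)"
    unfolding eq using to_fract_fin_ring[of f] f unfolding v(3) by auto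
  show "0 < valuation K_x (fin_place p) (to_fract f) \<longleftrightarrow> p dvd f"
  proof
    assume "p dvd f"
    then obtain g where g: "f = p * g" by blast
    then have "g \<noteq> 0" using f by auto
    moreover have "0 \<le> v (to_fract g)" using to_fract_fin_ring[of g] \<open>g \<noteq> 0\<close> unfolding v(3) by auto
    ultimately show "0 < valuation K_x (fin_place p) (to_fract f)"
      unfolding eq unfolding g
        using mult[of "to_fract p" "to_fract g"] v(2) irreducible_nonzero_nonunit by simp
  next
    assume "0 < valuation K_x (fin_place p) (to_fract f)"
    then have "Fields.inverse (to_fract f) \<notin> fin_ring p" unfolding eq v(3) using f by auto
    then show "p dvd f" using fin_ringI[of f 1] by (auto simp: inverse_eq_divide)
  qed
qed

lemma to_fract_in_fin_place_iff:
  assumes "f \<noteq> 0" shows "to_fract f \<in> fin_place p \<longleftrightarrow> p dvd f"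
proof -
  have "to_fract f \<in> fin_place p \<longleftrightarrow> to_fract 1 / to_fract f \<notin> fin_ring p"
    unfolding fin_place_def nonunits_def using assms to_fract_fin_ring[of f]
      by (simp add: inverse_eq_divide)
  then show ?thesis using fin_ring_iff[of 1 f] irreducible_nonzero_nonunit assms by simp
qed

lemma fin_place_degree: "place_degree K_x (fin_place p) = degree p"
  unfolding fin_place_def
proof (rule place_degree_eq[OF valuation_ring_fin])
  fix f :: "'k poly"
  show "to_fract f \<in> fin_ring p" by (rule to_fract_fin_ring)
  assume "f \<noteq> 0" "degree f < degree p"
  then show "to_fract f \<notin> nonunits (fin_ring p)"
    using to_fract_in_fin_place_iff[of f] dvd_imp_degree_le[of p f] unfolding fin_place_def by auto
next
  fix z assume "z \<in> fin_ring p"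
  then obtain f g where z: "z = to_fract f / to_fract g" "\<not> p dvd g" unfolding fin_ring_def by blast
  then have "g \<noteq> 0" by auto
  obtain a b where ab: "a * p + b * g = 1" using irreducible_bezout[OF p z(2)] by blast
  define h where "h = (f * b) mod p"
  have dh: "degree h < degree p" unfolding h_def
    using degree_mod_less[OF irreducible_nonzero_nonunit(1), of "f * b"] irreducible_degree[OF p]
      by auto
  have "f - h * g = f * (a * p + b * g) - (f * b - (f * b) div p * p) * g"
    unfolding h_def minus_div_mult_eq_mod ab by simp
  also have "\<dots> = p * (f * a + (f * b) div p * g)" by (simp add: algebra_simps)
  finally have e: "f - h * g = p * (f * a + (f * b) div p * g)" .
  define w where "w = to_fract (f * a + (f * b) div p * g) / to_fract g"
  have "z - to_fract h = to_fract (f - h * g) / to_fract g" using z \<open>g \<noteq> 0\<close>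
    by (simp add: field_simps)
  also have "\<dots> = w * to_fract p" unfolding e w_def by simp
  finally have "z - to_fract h = w * to_fract p" .
  moreover have "w \<in> fin_ring p" unfolding w_def by (rule fin_ringI) fact
  moreover have "to_fract p \<in> nonunits (fin_ring p)"
    using to_fract_in_fin_place_iff[OF irreducible_nonzero_nonunit(1)] unfolding fin_place_def
      by simp
  ultimately have "z - to_fract h \<in> nonunits (fin_ring p)"
    using nonunits_of_valuation_ring(5)[OF valuation_ring_fin] by simp
  with dh show "\<exists>f. degree f < degree p \<and> z - to_fract f \<in> nonunits (fin_ring p)" by blast
qed

end

lemma inf_ringI: "g \<noteq> 0 \<Longrightarrow> degree f \<le> degree g \<Longrightarrow> to_fract f / to_fract g \<in> inf_ring"
  unfolding inf_ring_def by blast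

lemma inf_ring_iff:
  assumes "f \<noteq> 0" "g \<noteq> 0" shows "to_fract f / to_fract g \<in> inf_ring \<longleftrightarrow> degree f \<le> degree g"
proof
  assume "to_fract f / to_fract g \<in> inf_ring"
  then obtain f' g'
    where fg: "to_fract f / to_fract g = to_fract f' / to_fract g'" "g' \<noteq> 0" "degree f' \<le> degree g'"
    unfolding inf_ring_def mem_Collect_eq by metis
  then have "f * g' = f' * g" using assms by (intro to_fract_eq_divideD) auto
  moreover from this have "f' \<noteq> 0" using assms fg by auto
  ultimately have "degree f + degree g' = degree f' + degree g" using assms fg
    by (metis degree_mult_eq)
  then show "degree f \<le> degree g" using fg by simp
qed (use assms inf_ringI in auto)

lemma is_subring_inf_ring: "is_subring (inf_ring :: 'k::field poly fract set)"
  unfolding is_subring_def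
proof (intro conjI ballI)
  show "1 \<in> (inf_ring :: 'k poly fract set)" using inf_ringI[of 1 1] by simp
  fix a :: "'k poly fract" assume "a \<in> inf_ring"
  then obtain f g where a: "a = to_fract f / to_fract g" "g \<noteq> 0" "degree f \<le> degree g"
    unfolding inf_ring_def by blast
  show "- a \<in> inf_ring" using inf_ringI[OF a(2), of "- f"] a(1,3) by simp
  fix b :: "'k poly fract" assume "b \<in> inf_ring"
  then obtain f' g' where b: "b = to_fract f' / to_fract g'" "g' \<noteq> 0" "degree f' \<le> degree g'"
    unfolding inf_ring_def by blast
  have dg: "degree (g * g') = degree g + degree g'" using a b by (simp add: degree_mult_eq)
  have "degree (f * g' + f' * g) \<le> degree (g * g')" unfolding dg
    by (rule degree_add_le) (use degree_mult_le[of f g'] degree_mult_le[of f' g] a b in linarith)+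
  moreover have "degree (f * f') \<le> degree (g * g')" unfolding dg
    using degree_mult_le[of f f'] a b by linarith
  ultimately have "to_fract (f * g' + f' * g) / to_fract (g * g') \<in> inf_ring"
    "to_fract (f * f') / to_fract (g * g') \<in> inf_ring" by (intro inf_ringI; use a b in simp)+
  moreover have "to_fract (f * g' + f' * g) / to_fract (g * g') = a + b"
    using a b by (simp add: add_frac_eq)
  ultimately show "a + b \<in> inf_ring" "a * b \<in> inf_ring"
    using a b by simp_all
qed

lemma inf_valuation_exists:
  "\<exists>v. discrete_valuation v \<and> v (inverse (to_fract [:0,1::'k::field:])) = 1 \<and> inf_ring = {z. z = 0
    \<or> 0 \<le> v z}"
proof (rule discrete_valuation_of_uniformizer[OF is_subring_inf_ring])
  let ?X = "[:0,1::'k:]"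
  show "inverse (to_fract ?X) \<in> inf_ring" using inf_ringI[of ?X 1] by (simp add: inverse_eq_divide)
  show "inverse (inverse (to_fract ?X)) \<notin> inf_ring" using inf_ring_iff[of ?X 1] by simp
  fix z :: "'k poly fract" assume "z \<noteq> 0"
  obtain f g where fg: "g \<noteq> 0" "z = to_fract f / to_fract g" by (rule fract_rep)
  with \<open>z \<noteq> 0\<close> have "f \<noteq> 0" by auto
  define f' where "f' = f * ?X ^ degree g"
  define g' where "g' = g * ?X ^ degree f"
  have nz: "f' \<noteq> 0" "g' \<noteq> 0" unfolding f'_def g'_def using fg \<open>f \<noteq> 0\<close> by auto
  have dd: "degree f' = degree g'" unfolding f'_def g'_def using fg \<open>f \<noteq> 0\<close>
    by (simp add: degree_mult_eq degree_power_eq)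
  have "z = inverse (to_fract ?X) powi (int (degree g) - int (degree f)) * (to_fract f' / to_fract g')"
    unfolding fg f'_def g'_def
      by (simp add: power_int_diff to_fract_power power_inverse field_simps)
  then show "\<exists>n u. u \<noteq> 0 \<and> u \<in> inf_ring \<and> inverse u \<in> inf_ring
    \<and> z = inverse (to_fract ?X) powi n * u"
    using nz dd
      by (intro exI[of _ "int (degree g) - int (degree f)"] exI[of _ "to_fract f' / to_fract g'"])
      (auto intro!: inf_ringI)
qed

lemma valuation_ring_inf: "valuation_ring K_x (inf_ring :: 'k::field poly fract set)"
proof -
  have "K_x \<subseteq> (inf_ring :: 'k poly fract set)" unfolding const_fract_def
    using inf_ringI[of 1 "[:c:]" for c :: 'k] by auto
  moreover obtain v :: "'k poly fract \<Rightarrow> int"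
    where "discrete_valuation v" "inf_ring = {z. z = 0 \<or> 0 \<le> v z}"
    using inf_valuation_exists by blast
  ultimately show ?thesis
    using valuation_ring_of_discrete_valuation const_fract_inverse_mem by blast
qed

definition inf_place :: "'k::field poly fract set" where "inf_place = nonunits inf_ring"

lemma inf_place_val:
  fixes f :: "'k::field poly"
  shows "place K_x (inf_place :: 'k poly fract set)"
    "discrete_valuation (valuation K_x (inf_place :: 'k poly fract set))"
    "f \<noteq> 0 \<Longrightarrow> valuation K_x inf_place (to_fract f) = - int (degree f)"
proof -
  let ?X = "[:0,1::'k:]"
  obtain v :: "'k poly fract \<Rightarrow> int" where v: "discrete_valuation v" "v (inverse (to_fract ?X)) = 1"
    "inf_ring = {z. z = 0 \<or> 0 \<le> v z}"
    using inf_valuation_exists by blast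
  interpret discrete_valuation v by fact
  have r: "inf_ring = ring" unfolding ring_def v(3) ..
  show "place K_x (inf_place :: 'k poly fract set)" unfolding place_iff inf_place_def
    using valuation_ring_inf by blast
  note V = valuation_ring_inf[where ?'k = 'k, unfolded r]
  show "discrete_valuation (valuation K_x (inf_place :: 'k poly fract set))"
    unfolding inf_place_def r by (rule discrete_valuation_valuation[OF V])
  assume f: "f \<noteq> 0"
  have "valuation K_x inf_place (to_fract f) = v (to_fract f)"
    unfolding inf_place_def r by (subst valuation_eq[OF V]) (use f in auto)
  moreover have vX: "v (to_fract ?X) = - 1" using v(2) by simp
  have "0 \<le> v (to_fract f / to_fract (?X ^ degree f))" "0 \<le> v (to_fract (?X ^ degree f) / to_fract f)"
    using inf_ringI[of "?X ^ degree f" f] inf_ringI[of f "?X ^ degree f"] f unfolding v(3)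
    by (auto simp: degree_power_eq)
  then have "v (to_fract f) = v (to_fract (?X ^ degree f))" using f by (simp add: divide)
  ultimately show "valuation K_x inf_place (to_fract f) = - int (degree f)"
    using vX by (simp add: to_fract_power power)
qed

lemma inf_place_degree: "place_degree K_x (inf_place :: 'k::field poly fract set) = 1"
  unfolding inf_place_def
proof (rule place_degree_eq[OF valuation_ring_inf])
  fix f :: "'k poly" assume f: "degree f < 1"
  then show "to_fract f \<in> inf_ring" using inf_ringI[of 1 f] by simp
  assume "f \<noteq> 0"
  then show "to_fract f \<notin> nonunits inf_ring" using inf_ringI[of f 1] f
    unfolding nonunits_def by (simp add: inverse_eq_divide)
next
  fix z :: "'k poly fract" assume "z \<in> inf_ring"
  then obtain f g where z: "z = to_fract f / to_fract g" "g \<noteq> 0" "degree f \<le> degree g"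
    unfolding inf_ring_def by blast
  define c where "c = coeff f (degree g) / lead_coeff g"
  define h where "h = f - [:c:] * g"
  have zz: "z - to_fract [:c:] = to_fract h / to_fract g"    
    unfolding h_def to_fract_diff to_fract_mult using z(1,2) by (simp add: diff_divide_distrib)
  have "z - to_fract [:c:] \<in> nonunits inf_ring"
  proof (cases "h = 0")
    case True
    then show ?thesis unfolding zz using is_subringD[OF is_subring_inf_ring] unfolding nonunits_def
      by simp
  next
    case False
    have "degree h \<le> degree g" unfolding h_def by (rule degree_diff_le) (use z in auto)
    moreover have "coeff h (degree g) = 0" unfolding h_def c_def using z by simp
    ultimately have "degree h < degree g" using False by (metis leading_coeff_0_iff order_le_less)
    then have "to_fract h / to_fract g \<in> inf_ring" "to_fract g / to_fract h \<notin> inf_ring"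
      using inf_ring_iff[of h g] inf_ring_iff[of g h] False z(2) by auto
    then show ?thesis unfolding zz nonunits_def by simp
  qed
  moreover have "degree [:c:] < 1" by simp
  ultimately show "\<exists>f. degree f < 1 \<and> z - to_fract f \<in> nonunits inf_ring" by blast
qed

text \<open>
  If \<open>x \<in> V\<close>, then \<open>V\<close> contains all polynomials and its nonunits among them are the multiples of
  one irreducible polynomial. Otherwise \<open>1 / x\<close> is a nonunit; then \<open>f / x ^ n\<close>, with \<open>n\<close> the degree of
  \<open>f\<close>, is the leading coefficient of \<open>f\<close> plus a nonunit, hence a unit, and membership in \<open>V\<close>
  depends on degrees alone.
\<close>
lemma valuation_ring_K_x_cases:
  fixes V :: "'k::field poly fract set"
  assumes V: "valuation_ring K_x V"
  shows "V = inf_ring \<or> (\<exists>p. irreducible p \<and> V = fin_ring p)"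
proof (cases "to_fract [:0,1:] \<in> V")
  case True
  note C = is_subringD[OF valuation_ringD(1)[OF V]]
  note N = nonunits_of_valuation_ring[OF V]
  have const: "to_fract [:c:] \<in> V" for c using valuation_ringD(2)[OF V] unfolding const_fract_def
    by auto
  have poly: "to_fract f \<in> V" for f
  proof (induction f)
    case (pCons c f)
    have "pCons c f = [:c:] + [:0,1:] * f" by simp
    then have "to_fract (pCons c f) = to_fract [:c:] + to_fract [:0,1:] * to_fract f"
      by (metis to_fract_add to_fract_mult)
    then show ?case using pCons const True C(4,6) by simp
  qed (use C in simp)
  define S where "S = {f. f \<noteq> 0 \<and> to_fract f \<in> nonunits V}"
  have "\<exists>g. g \<in> S"
  proof (rule ccontr)
    assume no: "\<nexists>g. g \<in> S"
    have "z \<in> V" for z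
    proof -
      obtain f g where fg: "g \<noteq> 0" "z = to_fract f / to_fract g" by (rule fract_rep)
      have "inverse (to_fract g) \<in> V" using no fg poly[of g] unfolding S_def nonunits_def by blast
      then show ?thesis using C(6)[OF poly[of f]] fg by (simp add: divide_inverse)
    qed
    then show False using valuation_ringD(4)[OF V] by blast
  qed
  then obtain g0 where "g0 \<in> S" by blast
  define p where "p = arg_min degree (\<lambda>x. x \<in> S)"
  have pS: "p \<in> S" unfolding p_def by (rule arg_min_natI) fact
  have pmin: "degree p \<le> degree e" if "e \<in> S" for e unfolding p_def by (rule arg_min_nat_le) fact
  have pnz: "p \<noteq> 0" and pN: "to_fract p \<in> nonunits V" using pS unfolding S_def by auto
  have dvd: "to_fract f \<in> nonunits V \<longleftrightarrow> p dvd f" for f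
  proof
    assume f: "to_fract f \<in> nonunits V"
    have "f mod p = f + (- (f div p)) * p" by (simp add: minus_div_mult_eq_mod[symmetric])
    then have "to_fract (f mod p) = to_fract f + to_fract (- (f div p)) * to_fract p"
      by (metis to_fract_add to_fract_mult)
    then have "to_fract (f mod p) \<in> nonunits V"      
      using N(4)[OF f N(5)[OF poly[of "- (f div p)"] pN]] by simp
    then have "f mod p \<noteq> 0 \<Longrightarrow> degree p \<le> degree (f mod p)" using pmin unfolding S_def by blast
    then have "f mod p = 0" using degree_mod_less[OF pnz, of f] by linarith
    then show "p dvd f" by (simp add: dvd_eq_mod_eq_0)
  next
    assume "p dvd f"
    then obtain g where "f = g * p" by (metis dvd_def mult.commute)
    then show "to_fract f \<in> nonunits V" using N(5)[OF poly pN, of g] by simp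
  qed
  have unit: "inverse (to_fract g) \<in> V" if "\<not> p dvd g" for g
    using dvd[of g] that poly[of g] unfolding nonunits_def by auto
  have irr: "irreducible p"
  proof (rule Factorial_Ring.irreducibleI)
    show "p \<noteq> 0" by fact
    have "\<not> p dvd 1" using dvd[of 1] N(3) by simp
    then show "\<not> p dvd 1" .
    fix a b assume ab: "p = a * b"
    then have nz: "a \<noteq> 0" "b \<noteq> 0" using pnz by auto
    have "p dvd a \<or> p dvd b"
    proof (rule ccontr)
      assume "\<not> (p dvd a \<or> p dvd b)"
      then have "inverse (to_fract a) * inverse (to_fract b) \<in> V" using unit C(6) by blast
      then have "inverse (to_fract p) \<in> V" unfolding ab by (simp add: mult.commute)
      then show False using pN pnz unfolding nonunits_def by simp
    qed
    then have "degree p \<le> degree a \<or> degree p \<le> degree b" using nz dvd_imp_degree_le by blast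
    then have "degree a = 0 \<or> degree b = 0" using nz unfolding ab by (auto simp: degree_mult_eq)
    then show "a dvd 1 \<or> b dvd 1" using nz by (auto simp: is_unit_iff_degree)
  qed
  have "V = fin_ring p"
  proof
    show sub: "fin_ring p \<subseteq> V"
      unfolding fin_ring_def using unit C(6)[OF poly] by (auto simp: divide_inverse)
    show "V \<subseteq> fin_ring p"
    proof
      fix z assume z: "z \<in> V"
      show "z \<in> fin_ring p"
      proof (rule ccontr)
        assume zn: "z \<notin> fin_ring p"
        then have "inverse z \<in> nonunits (fin_ring p)"
          using valuation_ringD(3)[OF valuation_ring_fin[OF irr] zn] unfolding nonunits_def by simp
        then obtain f g where fg: "inverse z = to_fract f / to_fract g" "\<not> p dvd g"
          unfolding nonunits_def fin_ring_def by blast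
        have z0: "z \<noteq> 0" using zn to_fract_fin_ring[OF irr, of 0] by auto
        then have f0: "f \<noteq> 0" "g \<noteq> 0" using fg by auto
        have "z = to_fract g / to_fract f" using fg by (metis inverse_divide inverse_inverse_eq)
        then have "p dvd f" using zn fin_ringI[OF irr, of f g] by blast
        then have "to_fract f \<in> nonunits V" using dvd by simp
        moreover have "inverse (to_fract g) \<in> V" by (rule unit) fact
        ultimately have "inverse (to_fract g) * to_fract f \<in> nonunits V" by (intro N(5))
        then have "inverse z \<in> nonunits V" unfolding fg by (simp add: field_simps)
        then show False using z z0 unfolding nonunits_def by simp
      qed
    qed
  qed
  then show ?thesis using irr by blast
next
  case False
  let ?X = "to_fract [:0,1::'k:]"
  note C = is_subringD[OF valuation_ringD(1)[OF V]]
  note N = nonunits_of_valuation_ring[OF V]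
  have iX: "inverse ?X \<in> V" by (rule valuation_ringD(3)[OF V False])
  then have iXn: "inverse ?X \<in> nonunits V" using False unfolding nonunits_def by simp
  have const: "to_fract [:c:] \<in> V" for c using valuation_ringD(2)[OF V] unfolding const_fract_def
    by auto
  have lt: "to_fract f / ?X ^ n \<in> nonunits V" if "degree f < n" for f n
    using that
  proof (induction f arbitrary: n)
    case (pCons c f)
    obtain m where n: "n = Suc m" using pCons.prems by (cases n) auto
    have "pCons c f = [:c:] + [:0,1:] * f" by simp
    then have "to_fract (pCons c f) = to_fract [:c:] + ?X * to_fract f"
      by (metis to_fract_add to_fract_mult)
    then have eq: "to_fract (pCons c f) / ?X ^ n = to_fract [:c:] * inverse ?X ^ m * inverse ?X + to_fract f / ?X ^ m"
      unfolding n by (simp add: field_simps)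
    have "to_fract f / ?X ^ m \<in> nonunits V"
    proof (cases "f = 0")
      case True then show ?thesis using N by simp
    next
      case F: False then show ?thesis using pCons n by simp
    qed
    then show ?case unfolding eq by (intro N(4,5) C const iX iXn)
  qed (use N in simp)
  have unit: "to_fract f / ?X ^ degree f \<in> V \<and> inverse (to_fract f / ?X ^ degree f) \<in> V"
    if "f \<noteq> 0" for f
  proof -
    define n where "n = degree f"
    define c where "c = lead_coeff f"
    define g where "g = f - Polynomial.monom c n"
    have c0: "c \<noteq> 0" using that unfolding c_def by simp
    have dg: "degree g < n \<or> g = 0"
    proof -
      have "degree g \<le> n" unfolding g_def n_def
        by (rule degree_diff_le) (auto simp: degree_monom_le)
      moreover have "coeff g n = 0" unfolding g_def n_def c_def by simp
      ultimately show ?thesis by (metis leading_coeff_0_iff order_le_less)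
    qed
    then have gN: "to_fract g / ?X ^ n \<in> nonunits V" using lt[of g n] N by auto
    have "f = [:c:] * [:0,1:] ^ n + g" unfolding g_def
      by (simp add: monom_altdef)
    then have "to_fract f = to_fract [:c:] * ?X ^ n + to_fract g"
      by (metis to_fract_add to_fract_mult to_fract_power)
    then have eq: "to_fract f / ?X ^ n = to_fract [:c:] + to_fract g / ?X ^ n"
      by (simp add: field_simps)
    then have 1: "to_fract f / ?X ^ n \<in> V" using const gN N(1) C(4) by (metis subsetD)
    have "to_fract f / ?X ^ n \<notin> nonunits V"
    proof
      assume "to_fract f / ?X ^ n \<in> nonunits V"
      moreover have "(- 1) * (to_fract g / ?X ^ n) \<in> nonunits V" by (intro N(5) gN C)
      ultimately have "to_fract [:c:] \<in> nonunits V" using N(4) eq by fastforce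
      then have "inverse (const_fract c) \<notin> V" using c0 unfolding nonunits_def const_fract_def
        by simp
      then show False using valuation_ringD(2)[OF V] by (auto simp flip: const_fract_inverse)
    qed
    then show ?thesis using 1 unfolding nonunits_def n_def by simp
  qed
  have "V = inf_ring"
  proof -
    have main: "z \<in> V" if "z \<in> inf_ring" for z
    proof -
      obtain f g where z: "z = to_fract f / to_fract g" "g \<noteq> 0" "degree f \<le> degree g"
        using \<open>z \<in> inf_ring\<close> unfolding inf_ring_def by blast
      show ?thesis
      proof (cases "f = 0")
        case False
        obtain k where k: "degree g = degree f + k" using z(3) by (metis le_iff_add)
        have "z = (to_fract f / ?X ^ degree f) * inverse (to_fract g / ?X ^ degree g) * inverse ?X ^ k"
          unfolding z k using z(2) by (simp add: field_simps power_add)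
        also have "\<dots> \<in> V" using unit[OF False] unit[OF z(2)] iX by (intro C) auto
        finally show ?thesis .
      qed (use z C in simp)
    qed
    moreover have "z \<in> inf_ring" if "z \<in> V" for z
    proof (rule ccontr)
      assume zn: "z \<notin> inf_ring"
      obtain f g where fg: "g \<noteq> 0" "z = to_fract f / to_fract g" by (rule fract_rep)
      have f0: "f \<noteq> 0" using zn fg is_subringD(2)[OF is_subring_inf_ring] by auto
      then have "degree g < degree f" using zn fg inf_ringI[of g f] by fastforce
      then obtain k where k: "degree f = Suc (degree g + k)" by (metis less_iff_Suc_add)

      have "?X = z * inverse (to_fract f / ?X ^ degree f) * (to_fract g / ?X ^ degree g) * inverse ?X ^ k"
        unfolding fg k using fg(1) f0 by (simp add: field_simps power_add)
      also have "\<dots> \<in> V" using unit[OF f0] unit[OF fg(1)] iX that by (intro C) auto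
      finally show False using False by simp
    qed
    ultimately show ?thesis by blast
  qed
  then show ?thesis by blast
qed

corollary place_K_x_cases:
  assumes "place K_x (P :: 'k::field poly fract set)"
  shows "P = inf_place \<or> (\<exists>p. irreducible p \<and> P = fin_place p)"
proof -
  obtain V where V: "valuation_ring K_x V" "P = nonunits V" using assms unfolding place_iff by blast
  from valuation_ring_K_x_cases[OF V(1)] show ?thesis
    unfolding V(2) inf_place_def fin_place_def by blast
qed

section \<open>Functions on the projective line with prescribed poles\<close>

lemma place_K_x_discrete:
  assumes "place K_x (P :: 'k::field poly fract set)"
  shows "discrete_valuation (valuation K_x P)"
  using place_K_x_cases[OF assms] inf_place_val(2) fin_place_val(2) by metis

lemma fin_place_ne_inf:
  assumes p: "irreducible (p :: 'k::field poly)" shows "fin_place p \<noteq> inf_place"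
  using fin_place_val(3)[OF p] inf_place_val(3)[of p] irreducible_nonzero_nonunit[OF p] by auto

lemma fin_place_dvd_eq:
  fixes p q :: "'k::field poly"
  assumes p: "irreducible p" and q: "irreducible q" and "p dvd q"
  shows "fin_place p = fin_place q"
proof -
  from q \<open>p dvd q\<close> have "q dvd p \<or> is_unit p" unfolding irreducible_altdef by blast
  then have "q dvd p" using p by (auto simp: Factorial_Ring.irreducible_def)
  then have "p dvd g \<longleftrightarrow> q dvd g" for g using \<open>p dvd q\<close> dvd_trans by blast
  then have "fin_ring p = fin_ring q" unfolding fin_ring_def by simp
  then show ?thesis unfolding fin_place_def by simp
qed

text \<open>
  An irreducible factor of the denominator must divide the numerator, since the value there is
  nonnegative, and can be cancelled.
\<close>
lemma no_finite_poles_imp_poly: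
  fixes w :: "'k::field poly fract"
  assumes "w \<noteq> 0" and val: "\<And>p. irreducible p \<Longrightarrow> 0 \<le> valuation K_x (fin_place p) w"
  shows "\<exists>f. w = to_fract f"
proof -
  have "w = to_fract f / to_fract g \<Longrightarrow> g \<noteq> 0 \<Longrightarrow> \<exists>f. w = to_fract f" for f g
  proof (induction "degree g" arbitrary: f g rule: less_induct)
    case less
    show ?case
    proof (cases "degree g = 0")
      case True
      then obtain c where c: "g = [:c:]" by (meson degree_eq_zeroE)
      then have "c \<noteq> 0" using less.prems by simp
      have "w = to_fract (smult (inverse c) f)"
      proof -
        have "to_fract (smult (inverse c) f) * to_fract g = to_fract f"
          unfolding c using \<open>c \<noteq> 0\<close> by (simp flip: to_fract_mult)
        then show ?thesis using less.prems
          by (metis nonzero_mult_div_cancel_right to_fract_eq_0_iff)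
      qed
      then show ?thesis by blast
    next
      case False
      then obtain p where p: "irreducible p" "p dvd g"
        using irreducible_factor_exists by blast
      interpret discrete_valuation "valuation K_x (fin_place p)" by (rule fin_place_val[OF p(1)])
      have f0: "f \<noteq> 0" using less.prems assms(1) by auto
      have "0 \<le> valuation K_x (fin_place p) (to_fract f) - valuation K_x (fin_place p) (to_fract g)"
        using val[OF p(1)] f0 less.prems by (simp add: divide)
      moreover have "0 < valuation K_x (fin_place p) (to_fract g)"
        using fin_place_val(5)[OF p(1) less.prems(2)] p(2) by simp
      ultimately have "p dvd f" using fin_place_val(5)[OF p(1) f0] by linarith
      then obtain f' g' where fg: "f = p * f'" "g = p * g'" using p(2) by blast
      have nz: "g' \<noteq> 0" "p \<noteq> 0" using fg less.prems by auto
      have "degree g' < degree g" unfolding fg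
        using nz irreducible_degree[OF p(1)] by (simp add: degree_mult_eq)
      moreover have "w = to_fract f' / to_fract g'" using less.prems nz unfolding fg by simp
      ultimately show ?thesis using less.hyps nz by blast
    qed
  qed
  then show ?thesis using fract_rep[of w] by metis
qed

text \<open>
  This is the Riemann-Roch input, and in genus zero it is explicit. Let \<open>b\<close> be the product of the
  powers \<open>p ^ E(P)\<close> over the finite places \<open>P\<close> with polynomial \<open>p\<close>. If \<open>c\<close> is admissible, then \<open>c b\<close>
  has no finite pole, so it is a polynomial and its value at infinity is at most \<open>0\<close>; this says that
  the degree of \<open>E\<close> is nonnegative. Conversely \<open>1 / b\<close> has the exact order at each finite place,
  and the slack at infinity is the degree of \<open>E\<close>; if \<open>P0\<close> is the infinite place, the slack is used
  up by a power of \<open>x\<close>.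
\<close>
lemma genus_zero_exact:
  fixes E :: "'k::field poly fract set \<Rightarrow> int"
  assumes S: "finite S" "\<And>P. P \<in> S \<Longrightarrow> place K_x P" "\<And>P. P \<notin> S \<Longrightarrow> E P = 0" and P0: "P0 \<in> S"
  shows "(\<exists>c. c \<noteq> 0 \<and> (\<forall>P. place K_x P \<longrightarrow> 0 \<le> valuation K_x P c + E P)
    \<and> valuation K_x P0 c + E P0 = 0)
    \<longleftrightarrow> 0 \<le> (\<Sum>P\<in>S. E P * int (place_degree K_x P))"
proof -
  define v where "v = valuation (K_x :: 'k poly fract set)"
  define F where "F = S - {inf_place}"
  have "\<exists>p. P \<noteq> inf_place \<longrightarrow> irreducible p \<and> P = fin_place p"
    if "place K_x P" for P :: "'k poly fract set"
    using place_K_x_cases[OF that] by blast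
  then obtain \<pi> :: "'k poly fract set \<Rightarrow> 'k poly" where
    "\<And>P. place K_x P \<Longrightarrow> P \<noteq> inf_place \<Longrightarrow> irreducible (\<pi> P) \<and> P = fin_place (\<pi> P)" by metis
  then have \<pi>: "irreducible (\<pi> P)" "fin_place (\<pi> P) = P" if "place K_x P" "P \<noteq> inf_place" for P
    using that by auto
  have F: "place K_x P" "P \<noteq> inf_place" if "P \<in> F" for P using that S(2) unfolding F_def by auto
  have nz: "\<pi> P \<noteq> 0" if "P \<in> F" for P using irreducible_nonzero_nonunit \<pi>[OF F[OF that]] by blast
  have finF: "finite F" unfolding F_def using S(1) by simp
  define b where "b = (\<Prod>P\<in>F. to_fract (\<pi> P) powi E P)"
  have b0: "b \<noteq> 0" unfolding b_def using finF nz by simp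
  have vb: "v P b = (\<Sum>Q\<in>F. E Q * v P (to_fract (\<pi> Q)))" if "place K_x P" for P
  proof -
    interpret discrete_valuation "valuation K_x P" by (rule place_K_x_discrete[OF that])
    show ?thesis unfolding b_def v_def
      by (subst prod) (use nz in \<open>auto simp: powi intro!: sum.cong\<close>)
  qed
  have vfin: "v P b = E P" if P: "place K_x P" "P \<noteq> inf_place" for P
  proof -
    have zero: "v P (to_fract (\<pi> Q)) = 0" if Q: "Q \<in> F" "Q \<noteq> P" for Q
    proof -
      note a = \<pi>[OF P] and b = \<pi>[OF F[OF Q(1)]]
      have "\<not> \<pi> P dvd \<pi> Q" using fin_place_dvd_eq[OF a(1) b(1)] a b Q by auto
      then show ?thesis using fin_place_val(4,5)[OF a(1) nz[OF Q(1)]] unfolding a(2) v_def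
        by linarith
    qed
    have one: "v P (to_fract (\<pi> P)) = 1" using fin_place_val(3)[OF \<pi>(1)[OF P]] \<pi>(2)[OF P]
      unfolding v_def by simp
    have "v P b = (\<Sum>Q\<in>F. if Q = P then E P else 0)"
      unfolding vb[OF P(1)] by (rule sum.cong) (use zero one in auto)
    also have "\<dots> = E P" using finF S(3)[of P] P(2) unfolding F_def by (auto simp: sum.delta)
    finally show ?thesis .
  qed
  have vinf: "v inf_place b = - (\<Sum>Q\<in>F. E Q * int (place_degree K_x Q))"
  proof -
    have "v inf_place (to_fract (\<pi> Q)) = - int (place_degree K_x Q)" if "Q \<in> F" for Q
      using inf_place_val(3)[OF nz[OF that]] fin_place_degree[OF \<pi>(1)[OF F[OF that]]] \<pi>(2)[OF F[OF that]]
      unfolding v_def by simp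
    then show ?thesis unfolding vb[OF inf_place_val(1)] by (simp add: sum_negf)
  qed
  have sumS: "(\<Sum>P\<in>S. E P * int (place_degree K_x P)) = E inf_place + (\<Sum>Q\<in>F. E Q * int (place_degree K_x Q))"
  proof (cases "inf_place \<in> S")
    case True
    then show ?thesis unfolding F_def using S(1)
      by (subst sum.remove[of _ inf_place]) (auto simp: inf_place_degree)
  next
    case False
    then show ?thesis unfolding F_def using S(3) by simp
  qed
  define N where "N = (\<Sum>P\<in>S. E P * int (place_degree K_x P))"
  interpret inf: discrete_valuation "v inf_place" unfolding v_def by (rule inf_place_val)
  have "0 \<le> N" if c: "c \<noteq> 0" "\<And>P. place K_x P \<Longrightarrow> 0 \<le> v P c + E P" for c
  proof -
    have "0 \<le> valuation K_x (fin_place p) (c * b)" if p: "irreducible p" for p :: "'k poly"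
    proof -
      note pl = fin_place_val(1)[OF p]
      interpret discrete_valuation "valuation K_x (fin_place p)" by (rule place_K_x_discrete[OF pl])
      show ?thesis using c(2)[OF pl] vfin[OF pl fin_place_ne_inf[OF p]] mult[OF c(1) b0]
        unfolding v_def by simp
    qed
    then obtain w where w: "c * b = to_fract w" using no_finite_poles_imp_poly[of "c * b"] c(1) b0
      by auto
    then have "w \<noteq> 0" using c(1) b0 by auto
    have "v inf_place c + v inf_place b = v inf_place (to_fract w)" using inf.mult[OF c(1) b0] w
      by simp
    also have "\<dots> \<le> 0" using inf_place_val(3)[OF \<open>w \<noteq> 0\<close>] unfolding v_def by simp
    finally show ?thesis using c(2)[OF inf_place_val(1)] unfolding N_def sumS vinf by linarith
  qed
  moreover have "\<exists>c. c \<noteq> 0 \<and> (\<forall>P. place K_x P \<longrightarrow> 0 \<le> v P c + E P) \<and> v P0 c + E P0 = 0" if N: "0 \<le> N"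
  proof -
    define e where "e = (if P0 = inf_place then nat N else 0)"
    define M where "M = to_fract ([:0, 1:] ^ e :: 'k poly)"

    have M0: "M \<noteq> 0" unfolding M_def by simp
    define c where "c = M * inverse b"
    have c0: "c \<noteq> 0" unfolding c_def using M0 b0 by simp
    have vc: "v P c = v P M - v P b" if "place K_x P" for P
    proof -
      interpret discrete_valuation "valuation K_x P" by (rule place_K_x_discrete[OF that])
      show ?thesis unfolding c_def v_def divide_inverse[symmetric] using divide[OF M0 b0] .
    qed
    have vcinf: "v inf_place c + E inf_place = N - (if P0 = inf_place then N else 0)"
    proof -
      have "v inf_place M = - (if P0 = inf_place then N else 0)"
        unfolding M_def v_def
          by (subst inf_place_val(3)) (use N in \<open>auto simp: degree_power_eq e_def\<close>)
      then show ?thesis unfolding vc[OF inf_place_val(1)] vinf N_def sumS by simp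
    qed
    have vcfin: "v P c + E P = v P M" if "place K_x P" "P \<noteq> inf_place" for P
      using vc vfin that by simp
    have Xfin: "0 \<le> v P M" if "place K_x P" "P \<noteq> inf_place" for P
      using fin_place_val(4)[OF \<pi>(1)[OF that]] \<pi>(2)[OF that] unfolding v_def M_def by simp
    have "0 \<le> v P c + E P" if "place K_x P" for P
      using vcinf vcfin Xfin that N by (cases "P = inf_place") auto
    moreover have "v P0 c + E P0 = 0"
    proof (cases "P0 = inf_place")
      case False
      interpret discrete_valuation "valuation K_x P0" by (rule place_K_x_discrete[OF S(2)[OF P0]])
      show ?thesis using vcfin[OF S(2)[OF P0] False] False unfolding M_def e_def v_def by simp
    qed (use vcinf in simp)
    ultimately show ?thesis using c0 by blast
  qed
  ultimately show ?thesis unfolding N_def v_def by blast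
qed

section \<open>Extending a valuation ring\<close>

text \<open>
  A form of Chevalley's extension theorem that suits discrete valuation rings: take for \<open>A\<close> the
  valuation ring below and for \<open>w\<close> the inverse of a uniformizer, so that excluding \<open>w\<close> keeps the
  uniformizer a nonunit. Let \<open>M\<close> be maximal among the overrings without \<open>w\<close>. By maximality, if
  neither \<open>z\<close> nor \<open>1 / z\<close> is in \<open>M\<close>, then \<open>w\<close> is a polynomial in \<open>z\<close> and also one in \<open>1 / z\<close>. The
  expression of lower degree gives a monic relation that reduces the degree of the other one, so
  two expressions of least degree contradict each other.
\<close>
lemma maximal_overring_valuation:
  fixes A :: "'f::field set"
  assumes A: "is_subring A" and w: "w \<notin> A" "inverse w \<in> A"
  shows "\<exists>V. is_subring V \<and> A \<subseteq> V \<and> w \<notin> V \<and> (\<forall>z. z \<in> V \<or> inverse z \<in> V)"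
proof -
  define F where "F = {B. is_subring B \<and> A \<subseteq> B \<and> w \<notin> B}"
  have "\<exists>M\<in>F. \<forall>B\<in>F. M \<subseteq> B \<longrightarrow> B = M"
  proof (rule subset_Zorn_nonempty)
    show "F \<noteq> {}" using A w unfolding F_def by blast
    fix C assume C: "C \<noteq> {}" "subset.chain F C"
    then have sub: "B \<in> C \<Longrightarrow> B \<in> F" for B unfolding subset.chain_def by blast
    have tot: "B \<in> C \<Longrightarrow> B' \<in> C \<Longrightarrow> B \<subseteq> B' \<or> B' \<subseteq> B" for B B'
      using C(2) unfolding subset.chain_def by blast
    have "is_subring (\<Union>C)"
      unfolding is_subring_def
    proof (intro conjI ballI)
      show "1 \<in> \<Union>C" using C(1) sub is_subringD(1) unfolding F_def by blast
      fix a assume "a \<in> \<Union>C"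
      then obtain B where B: "B \<in> C" "a \<in> B" by blast
      then show "- a \<in> \<Union>C" using sub is_subringD(3) unfolding F_def by blast
      fix b assume "b \<in> \<Union>C"
      then obtain B' where B': "B' \<in> C" "b \<in> B'" by blast
      obtain D where D: "D \<in> C" "a \<in> D" "b \<in> D" using tot[OF B(1) B'(1)] B B' by blast
      then have "is_subring D" using sub unfolding F_def by blast
      from is_subringD(4,6)[OF this D(2,3)] show "a + b \<in> \<Union>C" "a * b \<in> \<Union>C" using D(1) by blast+
    qed
    then show "\<Union>C \<in> F" using sub C(1) unfolding F_def by blast
  qed
  then obtain M where MF: "M \<in> F" and max: "\<And>B. B \<in> F \<Longrightarrow> M \<subseteq> B \<Longrightarrow> B = M" by blast
  have M: "is_subring M" "A \<subseteq> M" "w \<notin> M" using MF unfolding F_def by auto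
  note C = is_subringD[OF M(1)]
  have w0: "w \<noteq> 0" using M(3) C(2) by auto
  have iw: "inverse w \<in> M" using w M by blast
  have gen: "\<exists>f. (\<forall>i. coeff f i \<in> M) \<and> w = poly f z" if z: "z \<notin> M" for z
  proof -
    define B where "B = {poly f z | f. \<forall>i. coeff f i \<in> M}"
    have inB: "poly f z \<in> B" if "\<And>i. coeff f i \<in> M" for f using that unfolding B_def by blast
    have const: "a \<in> B" if "a \<in> M" for a
      using inB[of "[:a:]"] that C(2) by (auto simp: coeff_pCons split: nat.splits)
    have "z \<in> B" using inB[of "[:0, 1:]"] C by (auto simp: coeff_pCons split: nat.splits)
    have "is_subring B" unfolding is_subring_def
    proof (intro conjI ballI)
      show "1 \<in> B" using const C(1) by blast
      fix a assume "a \<in> B"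
      then obtain f where f: "a = poly f z" "\<And>i. coeff f i \<in> M" unfolding B_def by blast
      show "- a \<in> B" using inB[of "- f"] f C(3) by simp
      fix b assume "b \<in> B"
      then obtain g where g: "b = poly g z" "\<And>i. coeff g i \<in> M" unfolding B_def by blast
      show "a + b \<in> B" using inB[of "f + g"] f g C(4) by simp
      have "coeff (f * g) i \<in> M" for i unfolding coeff_mult
        by (intro is_subring_sum[OF M(1)] C(6) f g)
      then show "a * b \<in> B" using inB[of "f * g"] f g by simp
    qed
    moreover have "M \<subseteq> B" "B \<noteq> M" using const \<open>z \<in> B\<close> z by auto
    ultimately have "w \<in> B" using max[of B] M(2) unfolding F_def by blast
    then show ?thesis unfolding B_def by blast
  qed
  have refl_coeff: "coeff (reflect_poly f) i \<in> M" if "\<And>i. coeff f i \<in> M" for f i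
    using that C(2) by (simp add: coeff_reflect_poly)
  \<comment> \<open>By maximality \<open>inverse w\<close> is in the Jacobson radical of \<open>M\<close>.\<close>
  have unit: "1 - inverse w * b \<noteq> 0 \<and> inverse (1 - inverse w * b) \<in> M" if b: "b \<in> M" for b
  proof -
    define u where "u = 1 - inverse w * b"
    have uM: "u \<in> M" unfolding u_def by (intro C iw b)
    have wu: "w * u = w - b" unfolding u_def using w0 by (simp add: algebra_simps)
    have u0: "u \<noteq> 0" using wu b M(3) by auto
    \<comment> \<open>Modulo \<open>M\<close>, multiplying \<open>w\<close> by a power of \<open>u\<close> changes nothing.\<close>
    have desc: "w * u ^ n \<in> M \<Longrightarrow> w \<in> M" for n
    proof (induction n)
      case (Suc n)
      have "w * u ^ Suc n = (w - b) * u ^ n" unfolding wu[symmetric] by simp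
      then have "w * u ^ n = w * u ^ Suc n + b * u ^ n" by (simp add: algebra_simps)
      also have "\<dots> \<in> M" by (rule C(4)[OF Suc.prems C(6)[OF b C(7)[OF uM]]])
      finally show ?case by (rule Suc.IH)
    qed simp
    have "inverse u \<in> M"
    proof (rule ccontr)
      assume "inverse u \<notin> M"
      then obtain f where f: "\<And>i. coeff f i \<in> M" "w = poly f (inverse u)" using gen by blast
      have "w * u ^ degree f = poly (reflect_poly f) u"
        using poly_reflect_poly_nz[OF u0, of f] f(2) by (simp add: mult.commute)
      also have "\<dots> \<in> M" by (rule is_subring_poly[OF M(1) refl_coeff[OF f(1)] uM])
      finally show False using desc M(3) by blast
    qed
    then show ?thesis using u0 unfolding u_def by blast
  qed
  \<comment> \<open>An expression of \<open>w\<close> in \<open>1 / z\<close>, multiplied by \<open>z ^ degree g\<close>, becomes a monic equation for \<open>z\<close>: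
      the leading coefficient is \<open>w - b\<close>, which is \<open>w\<close> times a unit.\<close>
  have lower: "\<exists>s. (\<forall>i. coeff s i \<in> M) \<and> degree s < degree g \<and> z ^ degree g = poly s z"
    if z0: "z \<noteq> 0" and g: "\<And>i. coeff g i \<in> M" "w = poly g (inverse z)" for z g
  proof -
    define k where "k = degree g"
    define b where "b = coeff g 0"
    define h where "h = reflect_poly g - Polynomial.monom b k"
    define u where "u = 1 - inverse w * b"
    have bM: "b \<in> M" unfolding b_def by (rule g)
    have u: "u \<noteq> 0" "inverse u \<in> M" using unit[OF bM] unfolding u_def by auto
    have k0: "k > 0"
    proof (rule ccontr)
      assume "\<not> k > 0"
      then obtain c where c: "g = [:c:]" unfolding k_def by (metis degree_eq_zeroE not_gr_zero)
      have "coeff g 0 \<in> M" by (rule g(1))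
      then have "c \<in> M" unfolding c by simp
      then show False using g(2) M(3) unfolding c by simp
    qed
    have hM: "coeff h i \<in> M" for i unfolding h_def using refl_coeff[OF g(1)] bM C by auto
    have "degree h \<le> k" unfolding h_def
      by (rule degree_diff_le) (auto simp: degree_monom_le k_def degree_reflect_poly_le)
    moreover have "coeff h k = 0" unfolding h_def b_def k_def by (simp add: coeff_reflect_poly)
    ultimately have dh: "degree h < k" using k0
      by (metis degree_0 leading_coeff_0_iff order_le_less)
    have "w * z ^ k = poly (reflect_poly g) z"
      using poly_reflect_poly_nz[OF z0, of g] g(2) unfolding k_def by (simp add: mult.commute)
    also have "\<dots> = poly h z + b * z ^ k" unfolding h_def by (simp add: poly_monom)
    finally have "inverse w * (w * z ^ k - b * z ^ k) = inverse w * poly h z" by simp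
    moreover have "u * z ^ k = inverse w * (w * z ^ k - b * z ^ k)"
      unfolding u_def using w0 by (simp add: right_diff_distrib left_diff_distrib flip: mult.assoc)
    ultimately have "u * z ^ k = inverse w * poly h z" by simp
    moreover have "z ^ k = inverse u * (u * z ^ k)" using u(1) by simp
    ultimately have "z ^ k = poly (smult (inverse u * inverse w) h) z" by (simp add: mult.assoc)
    moreover have "coeff (smult (inverse u * inverse w) h) i \<in> M" for i
      using u iw hM by (simp add: C del: inverse_mult_distrib)
    moreover have "degree (smult (inverse u * inverse w) h) < k"
      using dh degree_smult_le[of "inverse u * inverse w" h] by linarith
    ultimately show ?thesis unfolding k_def by blast
  qed
  define R where "R z f \<longleftrightarrow> (\<forall>i. coeff f i \<in> M) \<and> w = poly f z" for z f
  have no: False if z0: "z \<noteq> 0" and f: "R z f" "\<And>f'. R z f' \<Longrightarrow> degree f \<le> degree f'"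
    and g: "R (inverse z) g" and le: "degree g \<le> degree f" for z f g
  proof -
    obtain s where s: "\<And>i. coeff s i \<in> M" "degree s < degree g" "z ^ degree g = poly s z"
      using lower[OF z0, of g] g unfolding R_def by blast
    define c where "c = lead_coeff f"
    define t where "t = Polynomial.monom 1 (degree g) - s"
    define f' where "f' = f - Polynomial.monom c (degree f - degree g) * t"
    have ct: "coeff t i \<in> M" for i unfolding t_def using s(1) C by auto
    have cM: "c \<in> M" unfolding c_def using f(1) unfolding R_def by blast
    have "coeff f' i \<in> M" for i
    proof -
      have "coeff (Polynomial.monom c (degree f - degree g) * t) i \<in> M"
        unfolding coeff_mult using cM ct C(2) by (intro is_subring_sum[OF M(1)] C(6)) auto
      then show ?thesis unfolding f'_def using f(1) C(5) unfolding R_def by simp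
    qed
    moreover have "poly f' z = w" using f(1) s(3) unfolding f'_def t_def R_def
      by (simp add: poly_monom)
    ultimately have "R z f'" unfolding R_def by simp
    then have le': "degree f \<le> degree f'" by (rule f(2))
    have dt: "degree t \<le> degree g" unfolding t_def
      by (rule degree_diff_le) (use s in \<open>auto simp: degree_monom_le\<close>)
    have ctop: "coeff t (degree g) = 1" unfolding t_def using s(2) by (simp add: coeff_eq_0)
    have "degree (Polynomial.monom c (degree f - degree g) * t) \<le> degree f"
      using degree_mult_le[of "Polynomial.monom c (degree f - degree g)" t]
        degree_monom_le[of c "degree f - degree g"] dt le by linarith
    then have "degree f' \<le> degree f" unfolding f'_def by (intro degree_diff_le) auto
    moreover have "coeff f' (degree f) = 0" unfolding f'_def
      using le ctop by (simp add: coeff_monom_mult c_def)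
    ultimately have "f' = 0" using le' by (metis leading_coeff_0_iff le_antisym)
    then show False using \<open>R z f'\<close> w0 unfolding R_def by simp
  qed
  have "z \<in> M \<or> inverse z \<in> M" for z
  proof (rule ccontr)
    assume "\<not> (z \<in> M \<or> inverse z \<in> M)"
    then have zn: "z \<notin> M" "inverse z \<notin> M" by auto
    then have z0: "z \<noteq> 0" using C(2) by auto
    have ex: "\<exists>f. R x f \<and> (\<forall>f'. R x f' \<longrightarrow> degree f \<le> degree f')" if x: "x \<notin> M" for x
    proof -
      obtain f0 where f0: "R x f0" using gen[OF x] unfolding R_def by blast
      show ?thesis
        by (intro exI[of _ "arg_min degree (R x)"] conjI allI impI arg_min_natI[of "R x", OF f0] arg_min_nat_le)
    qed
    obtain f where f: "R z f" "\<And>f'. R z f' \<Longrightarrow> degree f \<le> degree f'" using ex[OF zn(1)] by blast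
    obtain g where g: "R (inverse z) g" "\<And>f'. R (inverse z) f' \<Longrightarrow> degree g \<le> degree f'"
      using ex[OF zn(2)] by blast
    show False
    proof (cases "degree g \<le> degree f")
      case True
      show ?thesis by (rule no[OF z0 f g(1) True])
    next
      case False
      show ?thesis by (rule no[of "inverse z" g f]) (use False z0 f g in auto)
    qed
  qed
  then show ?thesis using M by blast
qed

section \<open>Discrete valuations of a finite extension\<close>

locale field_embedding =
  fixes \<phi> :: "'e::field \<Rightarrow> 'f::field"
  assumes phi_one [simp]: "\<phi> 1 = 1" and phi_add: "\<phi> (a + b) = \<phi> a + \<phi> b"
    and phi_mult: "\<phi> (a * b) = \<phi> a * \<phi> b"
begin

lemma phi_zero [simp]: "\<phi> 0 = 0"
  using phi_add[of 0 0] by (metis add_0_left add_right_imp_eq)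

lemma phi_neg: "\<phi> (- a) = - \<phi> a"
  using phi_add[of a "- a"] by (simp add: eq_neg_iff_add_eq_0 add.commute)

lemma phi_diff: "\<phi> (a - b) = \<phi> a - \<phi> b"
  using phi_add[of a "- b"] phi_neg by simp

lemma phi_eq_0_iff [simp]: "\<phi> a = 0 \<longleftrightarrow> a = 0"
proof
  assume "\<phi> a = 0"
  show "a = 0"
  proof (rule ccontr)
    assume "a \<noteq> 0"
    then have "\<phi> a * \<phi> (inverse a) = 1" by (simp flip: phi_mult)
    then show False using \<open>\<phi> a = 0\<close> by simp
  qed
qed simp

lemma phi_inj: "\<phi> a = \<phi> b \<longleftrightarrow> a = b"
  using phi_eq_0_iff[of "a - b"] by (simp add: phi_diff)

lemma phi_inverse: "\<phi> (inverse a) = inverse (\<phi> a)"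
proof (cases "a = 0")
  case False
  then have "\<phi> a * \<phi> (inverse a) = 1" by (simp flip: phi_mult)
  then show ?thesis by (metis inverse_unique)
qed simp

lemma phi_divide: "\<phi> (a / b) = \<phi> a / \<phi> b"
  by (simp add: divide_inverse phi_mult phi_inverse)

lemma phi_power: "\<phi> (a ^ n) = \<phi> a ^ n"
  by (induction n) (auto simp: phi_mult)

lemma phi_powi: "\<phi> (a powi n) = \<phi> a powi n"
  by (cases n rule: int_cases2) (auto simp: phi_power phi_inverse power_int_minus)

lemma phi_sum: "\<phi> (sum f I) = (\<Sum>i\<in>I. \<phi> (f i))"
  by (induction I rule: infinite_finite_induct) (auto simp: phi_add)

definition ev :: "'e poly \<Rightarrow> 'f \<Rightarrow> 'f" where "ev f = poly (map_poly \<phi> f)"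

lemma map_poly_phi_simps:
  "map_poly \<phi> (f + g) = map_poly \<phi> f + map_poly \<phi> g"
  "map_poly \<phi> (f - g) = map_poly \<phi> f - map_poly \<phi> g"
  "map_poly \<phi> (- f) = - map_poly \<phi> f"
  "map_poly \<phi> (f * g) = map_poly \<phi> f * map_poly \<phi> g"
  by (rule poly_eqI; simp add: coeff_map_poly phi_add phi_diff phi_neg coeff_mult phi_sum phi_mult)+

lemma ev_simps:
  "ev (f + g) z = ev f z + ev g z" "ev (f - g) z = ev f z - ev g z" "ev (- f) z = - ev f z"
  "ev (f * g) z = ev f z * ev g z" "ev [:c:] z = \<phi> c" "ev 0 z = 0" "ev 1 z = 1"
  "ev [:0, 1:] z = z" "ev (pCons c f) z = \<phi> c + z * ev f z"
  "ev (Polynomial.monom c n) z = \<phi> c * z ^ n"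
  unfolding ev_def map_poly_phi_simps
  by (simp_all add: map_poly_pCons map_poly_monom poly_monom)

lemma ev_sum: "ev (sum f I) z = (\<Sum>i\<in>I. ev (f i) z)"
  by (induction I rule: infinite_finite_induct) (auto simp: ev_simps)

lemma ev_altdef:
  assumes "degree f < n" shows "ev f z = (\<Sum>i<n. \<phi> (coeff f i) * z ^ i)"
proof -
  have "f = (\<Sum>i\<le>degree f. Polynomial.monom (coeff f i) i)"
    by (rule poly_as_sum_of_monoms[symmetric])
  also have "\<dots> = (\<Sum>i<n. Polynomial.monom (coeff f i) i)"
    by (rule sum.mono_neutral_left) (use assms in \<open>auto simp: coeff_eq_0 not_le\<close>)
  finally have "ev f z = ev (\<Sum>i<n. Polynomial.monom (coeff f i) i) z" by simp
  also have "\<dots> = (\<Sum>i<n. \<phi> (coeff f i) * z ^ i)" unfolding ev_sum ev_simps ..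
  finally show ?thesis .
qed

lemma valuation_ring_total_max:
  assumes V: "is_subring V" "\<And>z. z \<in> V \<or> inverse z \<in> V" and I: "finite I" "I \<noteq> {}" "\<And>i. i \<in> I
    \<Longrightarrow> a i \<noteq> (0::'f)"
  shows "\<exists>j\<in>I. \<forall>i\<in>I. a i / a j \<in> V"
  using I
proof (induction I rule: finite_ne_induct)
  case (singleton x) then show ?case using is_subringD(1)[OF V(1)] by simp
next
  case (insert x I)
  then obtain j where j: "j \<in> I" "\<And>i. i \<in> I \<Longrightarrow> a i / a j \<in> V" by auto
  have nz: "a x \<noteq> 0" "a j \<noteq> 0" using insert.prems j by auto
  show ?case
  proof (cases "a x / a j \<in> V")
    case True
    then show ?thesis using j by blast
  next
    case False
    then have "inverse (a x / a j) \<in> V" using V(2) by blast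
    then have ajx: "a j / a x \<in> V" by simp
    have "a i / a x \<in> V" if "i \<in> I" for i
    proof -
      have "a i / a x = (a i / a j) * (a j / a x)" using nz by simp
      then show ?thesis using is_subringD(6)[OF V(1) j(2)[OF that] ajx] by metis
    qed
    moreover have "a x / a x \<in> V" using nz is_subringD(1)[OF V(1)] by simp
    ultimately show ?thesis by blast
  qed
qed

text \<open>
  In a vanishing sum the term of least value cannot stand alone. So two terms of an algebraic
  equation for \<open>z\<close> have the same value, and a power of \<open>z\<close> with exponent at most \<open>N\<close> has the value of
  an element of the base field.
\<close>
lemma equal_value_terms:
  assumes V: "is_subring V" "\<And>z. z \<in> V \<or> inverse z \<in> V"
    and f: "f \<noteq> 0" "degree f \<le> N" "ev f z = 0" and z: "z \<noteq> 0"
  shows "\<exists>n c. 0 < n \<and> n \<le> N \<and> c \<noteq> 0 \<and> z ^ n / \<phi> c \<in> V \<and> \<phi> c / z ^ n \<in> V"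
proof -
  define I where "I = {i. i \<le> N \<and> coeff f i \<noteq> 0}"
  define a where "a i = \<phi> (coeff f i) * z ^ i" for i
  have nz: "i \<in> I \<Longrightarrow> a i \<noteq> 0" for i unfolding I_def a_def using z by simp
  have fin: "finite I" unfolding I_def by simp
  have ne: "I \<noteq> {}" using f leading_coeff_0_iff unfolding I_def by blast
  have "(\<Sum>i<Suc N. a i) = 0" unfolding a_def using ev_altdef[of f "Suc N"] f by simp
  moreover have "(\<Sum>i<Suc N. a i) = (\<Sum>i\<in>I. a i)"
    by (rule sum.mono_neutral_right) (auto simp: I_def a_def)
  ultimately have s0: "(\<Sum>i\<in>I. a i) = 0" by simp
  have "\<exists>j\<in>I. \<forall>i\<in>I. a i / a j \<in> V" by (rule valuation_ring_total_max[OF V fin ne nz])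
  then obtain j where j: "j \<in> I" "\<And>i. i \<in> I \<Longrightarrow> a i / a j \<in> V" by blast
  have N: "0 \<in> nonunits V" "1 \<notin> nonunits V"
    "\<And>a b. a \<in> nonunits V \<Longrightarrow> b \<in> nonunits V \<Longrightarrow> a + b \<in> nonunits V"
    "\<And>a b. a \<in> V \<Longrightarrow> b \<in> nonunits V \<Longrightarrow> a * b \<in> nonunits V"
    using nonunits_of_total_subring[OF V(1)] V(2) by blast+
  have "\<exists>i\<in>I - {j}. a i / a j \<notin> nonunits V"
  proof (rule ccontr)
    assume no: "\<not> ?thesis"
    have "(\<Sum>i\<in>I - {j}. a i / a j) \<in> nonunits V"
    proof -
      have "(\<Sum>i\<in>J. a i / a j) \<in> nonunits V" if "J \<subseteq> I - {j}" for J
        using finite_subset[OF that] that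
        by (induction J rule: infinite_finite_induct) (use fin no N in auto)
      then show ?thesis by blast
    qed
    then have "(- 1) * (\<Sum>i\<in>I - {j}. a i / a j) \<in> nonunits V"
      by (intro N(4)) (use is_subringD[OF V(1)] in auto)
    moreover have "(\<Sum>i\<in>I - {j}. a i / a j) = (\<Sum>i\<in>I. a i / a j) - 1"
      using fin j(1) nz[OF j(1)] by (simp add: sum_diff1)
    moreover have "(\<Sum>i\<in>I. a i / a j) = 0" using s0 by (simp flip: sum_divide_distrib)
    ultimately show False using N(2) by simp
  qed
  then obtain i where i: "i \<in> I" "i \<noteq> j" "a i / a j \<notin> nonunits V" by blast
  then have u: "a i / a j \<in> V" "a j / a i \<in> V" using j(2)[OF i(1)] unfolding nonunits_def by auto
  have key: "\<exists>n c. 0 < n \<and> n \<le> N \<and> c \<noteq> 0 \<and> z ^ n / \<phi> c \<in> V \<and> \<phi> c / z ^ n \<in> V"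
    if "i < j" "i \<in> I" "j \<in> I" "a i / a j \<in> V" "a j / a i \<in> V" for i j
  proof -
    define c where "c = coeff f i / coeff f j"
    have nzc: "coeff f i \<noteq> 0" "coeff f j \<noteq> 0" "j \<le> N" using that unfolding I_def by auto
    have "z ^ j = z ^ i * z ^ (j - i)" using \<open>i < j\<close> by (simp flip: power_add)
    then have "z ^ (j - i) / \<phi> c = a j / a i" "\<phi> c / z ^ (j - i) = a i / a j"
      unfolding a_def c_def phi_divide using z nzc by simp_all
    then show ?thesis using that nzc unfolding c_def
      by (intro exI[of _ "j - i"] exI[of _ c]) (auto simp: c_def)
  qed
  show ?thesis using key[of i j] key[of j i] i j u by (cases "i < j") auto
qed

text \<open>
  By \<open>equal_value_terms\<close> the power \<open>z ^ M\<close>, with \<open>M\<close> the factorial of \<open>N\<close>, has the value of a power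
  of the uniformizer \<open>p\<close> of the base field, with exponent \<open>g z\<close> say. So the value group above embeds
  into the integers through \<open>g\<close>, and an element \<open>t\<close> with the least positive \<open>g t\<close> is a uniformizer.
\<close>
lemma discrete_valuation_extension:
  assumes V: "is_subring V" "\<And>z. z \<in> V \<or> inverse z \<in> V" and v: "discrete_valuation v"
    and res: "\<And>c. c \<noteq> 0 \<Longrightarrow> \<phi> c \<in> V \<longleftrightarrow> 0 \<le> v c"
    and alg: "\<And>z. \<exists>f. f \<noteq> 0 \<and> degree f \<le> N \<and> ev f z = 0"
  shows "\<exists>v'. discrete_valuation v' \<and> V = {z. z = 0 \<or> 0 \<le> v' z} \<and> (\<exists>e>0. \<forall>c. c \<noteq> 0
    \<longrightarrow> v' (\<phi> c) = e * v c)"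
proof -
  interpret v: discrete_valuation v by fact
  note C = is_subringD[OF V(1)]
  define U where "U = {u. u \<noteq> 0 \<and> u \<in> V \<and> inverse u \<in> V}"
  have U1: "1 \<in> U" unfolding U_def using C by simp
  have Um: "a * b \<in> U" if "a \<in> U" "b \<in> U" for a b using that C(6) unfolding U_def by simp
  have Ui: "inverse a \<in> U" if "a \<in> U" for a using that unfolding U_def by simp
  have Ud: "a / b \<in> U" if "a \<in> U" "b \<in> U" for a b using Um[OF that(1) Ui[OF that(2)]]
    by (simp add: divide_inverse)
  have Up: "a ^ n \<in> U" if "a \<in> U" for a n using that by (induction n) (use U1 Um in auto)
  have Uphi: "\<phi> c \<in> U" if "c \<noteq> 0" "v c = 0" for c
    using that res[of c] res[of "inverse c"] unfolding U_def by (simp add: phi_inverse)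
  have pow_V: "z \<in> V" if "z ^ n \<in> V" "0 < n" for z n
  proof (rule ccontr)
    assume zn: "z \<notin> V"
    then have "inverse z \<in> V" using V(2) by blast
    then have "z ^ n * inverse z ^ (n - 1) \<in> V" by (rule C(6)[OF that(1) C(7)])
    moreover have "z ^ n * inverse z ^ (n - 1) = z"
    proof -
      have "z \<noteq> 0" using zn C(2) by blast
      then show ?thesis using that(2) by (cases n) (auto simp: power_inverse)
    qed
    ultimately show False using zn by metis
  qed
  obtain p where p: "p \<noteq> 0" "v p = 1" using v.uniformizer_exists by blast
  define M where "M = (fact N :: nat)"
  have M0: "0 < M" unfolding M_def by simp
  have "\<exists>k. \<exists>u\<in>U. z ^ M = \<phi> p powi k * u" if z: "z \<noteq> 0" for z
  proof -
    obtain f where f: "f \<noteq> 0" "degree f \<le> N" "ev f z = 0" using alg by blast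
    obtain n c where nc: "0 < n" "n \<le> N" "c \<noteq> 0" "z ^ n / \<phi> c \<in> V" "\<phi> c / z ^ n \<in> V"
      using equal_value_terms[OF V f z] by blast
    define u where "u = z ^ n / \<phi> c"
    have uU: "u \<in> U" unfolding u_def U_def using nc z by simp
    define c' where "c' = c / p powi (v c)"
    have "c' \<noteq> 0" "v c' = 0" unfolding c'_def using p nc by (simp_all add: v.divide v.powi)
    then have c'U: "\<phi> c' \<in> U" by (rule Uphi)
    have "z ^ n = u * \<phi> c" unfolding u_def using nc by simp
    also have "\<phi> c = \<phi> p powi (v c) * \<phi> c'" unfolding c'_def using p
      by (simp flip: phi_powi phi_mult)
    finally have zn: "z ^ n = \<phi> p powi (v c) * (u * \<phi> c')" by simp
    have "n dvd M" unfolding M_def using nc by (intro dvd_fact) auto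
    then obtain l where l: "M = n * l" by blast
    have "z ^ M = (z ^ n) ^ l" unfolding l by (rule power_mult)
    also have "\<dots> = \<phi> p powi (v c * int l) * (u * \<phi> c') ^ l"
      unfolding zn power_mult_distrib by (simp add: power_int_mult)
    finally show ?thesis using Up[OF Um[OF uU c'U]] by blast
  qed
  then obtain g u where gu: "\<And>z. z \<noteq> 0 \<Longrightarrow> u z \<in> U \<and> z ^ M = \<phi> p powi (g z) * u z"
    by metis
  have powi_V: "\<phi> p powi k * w \<in> V \<longleftrightarrow> 0 \<le> k" if "w \<in> U" for k w
  proof -
    have "\<phi> p powi k \<in> V \<longleftrightarrow> 0 \<le> k" using res[of "p powi k"] p by (simp add: phi_powi v.powi)
    moreover have "\<phi> p powi k = (\<phi> p powi k * w) * inverse w" using that unfolding U_def by simp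
    ultimately show ?thesis using that C(6) unfolding U_def
      by (metis (no_types, lifting) mem_Collect_eq)
  qed
  have g_V: "z \<in> V \<longleftrightarrow> 0 \<le> g z" if "z \<noteq> 0" for z
  proof -
    have "z ^ M \<in> V \<longleftrightarrow> 0 \<le> g z" using gu[OF that] powi_V by simp
    then show ?thesis using pow_V[OF _ M0] C(7) by blast
  qed
  have g_uniq: "g z = k" if "z \<noteq> 0" "z ^ M = \<phi> p powi k * w" "w \<in> U" for z k w
  proof -
    have eq: "\<phi> p powi (g z) * u z = \<phi> p powi k * w" using gu[OF that(1)] that by simp
    have uz: "u z \<in> U" using gu[OF that(1)] by simp
    have p0: "\<phi> p \<noteq> 0" using p by simp
    have uz0: "u z \<noteq> 0" "w \<noteq> 0" using uz that unfolding U_def by auto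
    have "\<phi> p powi (g z - k) * (u z / w) = 1" "\<phi> p powi (k - g z) * (w / u z) = 1"
      using eq p0 uz0 by (simp_all add: power_int_diff field_simps)
    then have "0 \<le> g z - k" "0 \<le> k - g z"
      using powi_V[OF Ud[OF uz that(3)], of "g z - k"] powi_V[OF Ud[OF that(3) uz], of "k - g z"] C(1) by simp_all
    then show ?thesis by simp
  qed
  have g_mult: "g (a * b) = g a + g b" if "a \<noteq> 0" "b \<noteq> 0" for a b
  proof (rule g_uniq)
    show "(a * b) ^ M = \<phi> p powi (g a + g b) * (u a * u b)"
      using gu[OF that(1)] gu[OF that(2)] p by (simp add: power_mult_distrib power_int_add)
    show "u a * u b \<in> U" using gu that Um by blast
  qed (use that in auto)
  have g_one: "g 1 = 0" using g_mult[of 1 1] by simp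
  have g_inv: "g (inverse a) = - g a" if "a \<noteq> 0" for a
    using g_mult[of a "inverse a"] that g_one by simp
  have g_pow: "g (a ^ n) = int n * g a" if "a \<noteq> 0" for a n
    using that by (induction n) (auto simp: g_one g_mult algebra_simps)
  have g_powi: "g (a powi n) = n * g a" if "a \<noteq> 0" for a n
    using that by (cases n rule: int_cases2) (auto simp: g_pow g_inv power_int_minus)
  have "g (\<phi> p) = int M"
    by (rule g_uniq[of _ _ 1]) (use p U1 in auto)
  then have "\<exists>z. z \<noteq> 0 \<and> 0 < g z" using p M0 by (intro exI[of _ "\<phi> p"]) auto
  define G where "G z \<longleftrightarrow> z \<noteq> 0 \<and> 0 < g z" for z
  have "\<exists>z. G z" unfolding G_def by fact
  then obtain z0 where "G z0" by blast
  define t where "t = arg_min (\<lambda>z. nat (g z)) G"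
  have tG: "G t" unfolding t_def by (rule arg_min_natI) fact
  have tmin: "nat (g t) \<le> nat (g z)" if "G z" for z unfolding t_def by (rule arg_min_nat_le) fact
  have t0: "t \<noteq> 0" "0 < g t" using tG unfolding G_def by auto
  have "\<exists>v'. discrete_valuation v' \<and> v' t = 1 \<and> V = {z. z = 0 \<or> 0 \<le> v' z}"
  proof (rule discrete_valuation_of_uniformizer[OF V(1)])
    show "t \<in> V" "inverse t \<notin> V" using g_V t0 g_inv[of t] by auto
    fix z :: 'f assume z: "z \<noteq> 0"
    define n where "n = g z div g t"
    define r where "r = z / t powi n"
    have r0: "r \<noteq> 0" unfolding r_def using z t0 by simp
    have gr: "g r = g z mod g t" unfolding r_def divide_inverse n_def
      using z t0 by (subst g_mult) (auto simp: g_inv g_powi minus_div_mult_eq_mod)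
    have lt: "0 \<le> g r" "g r < g t" unfolding gr using t0 by simp_all
    have "g r = 0"
    proof (rule ccontr)
      assume "g r \<noteq> 0"
      then have "G r" using lt r0 unfolding G_def by simp
      from tmin[OF this] lt show False by simp
    qed
    then have "r \<in> V" "inverse r \<in> V" using g_V[of r] g_V[of "inverse r"] g_inv[of r] r0 by auto
    moreover have "z = t powi n * r" unfolding r_def using t0 by simp
    ultimately show "\<exists>n u. u \<noteq> 0 \<and> u \<in> V \<and> inverse u \<in> V \<and> z = t powi n * u" using r0 by blast
  qed
  then obtain v' where v': "discrete_valuation v'" "v' t = 1" "V = {z. z = 0 \<or> 0 \<le> v' z}" by blast
  interpret v': discrete_valuation v' by fact
  have v'U: "v' u = 0" if "u \<in> U" for u
    using that unfolding U_def v'(3) by auto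
  have "v' (\<phi> c) = v' (\<phi> p) * v c" if "c \<noteq> 0" for c
  proof -
    define c' where "c' = c / p powi (v c)"
    have c': "c' \<noteq> 0" "v c' = 0" unfolding c'_def using p that by (simp_all add: v.divide v.powi)
    have "\<phi> c = \<phi> p powi (v c) * \<phi> c'" unfolding c'_def using p by (simp flip: phi_powi phi_mult)
    then show ?thesis using v'U[OF Uphi[OF c']] p c' by (simp add: v'.mult v'.powi)
  qed
  moreover have "0 < v' (\<phi> p)"
  proof -
    have "\<phi> (inverse p) \<notin> V" using res[of "inverse p"] p by simp
    then show ?thesis using p unfolding v'(3) by (auto simp: phi_inverse)
  qed
  ultimately show ?thesis using v' by blast
qed

text \<open>
  Valuation rings are integrally closed. This shows that a place of the extension does not
  restrict to the trivial valuation on the base field.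
\<close>
lemma algebraic_in_valuation_ring:
  assumes V: "is_subring V" "\<And>z. z \<in> V \<or> inverse z \<in> V"
    and sub: "range \<phi> \<subseteq> V" and f: "f \<noteq> 0" "ev f z = 0"
  shows "z \<in> V"
proof (rule ccontr)
  assume zn: "z \<notin> V"
  note C = is_subringD[OF V(1)]
  have z0: "z \<noteq> 0" using zn C by auto
  obtain n c where nc: "0 < n" "c \<noteq> 0" "z ^ n / \<phi> c \<in> V"
    using equal_value_terms[OF V f(1) order.refl f(2) z0] by blast
  have "z ^ n / \<phi> c * \<phi> c \<in> V" using nc sub by (intro C) auto
  then have zV: "z ^ n \<in> V" using nc by simp
  have "inverse z \<in> V" using zn V(2) by blast
  then have "z ^ n * inverse z ^ (n - 1) \<in> V" by (rule C(6)[OF zV C(7)])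
  moreover have "z ^ n * inverse z ^ (n - 1) = z"
    using z0 nc(1) by (cases n) (auto simp: power_inverse)
  ultimately show False using zn by metis
qed

end

text \<open>
  Only an annihilating polynomial \<open>M\<close> of \<open>y\<close> is given. That it is the minimal one follows later,
  from ramification.
\<close>
locale simple_extension = field_embedding \<phi> for \<phi> :: "'e::field \<Rightarrow> 'f::field" +
  fixes y :: 'f and M :: "'e poly"
  assumes M_nz: "0 < degree M" and M_root: "ev M y = 0"
    and gen: "generate_field ring_of_type_algebra (range \<phi> \<union> {y}) = UNIV"
begin

lemma ev_reduce: "\<exists>g. degree g < degree M \<and> ev g y = ev f y"
proof (intro exI conjI)
  have "M \<noteq> 0" using M_nz by auto
  then show "degree (f mod M) < degree M" using degree_mod_less[of M f] M_nz by auto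
  have "f = f div M * M + f mod M" by simp
  then have "ev f y = ev (f div M) y * ev M y + ev (f mod M) y" by (metis ev_simps(1,4))
  then show "ev (f mod M) y = ev f y" using M_root by simp
qed

lemma powers_dependent:
  assumes "z \<in> range (\<lambda>f. ev f y)"
  shows "\<exists>f. f \<noteq> 0 \<and> degree f \<le> degree M \<and> ev f z = 0"
proof -
  interpret vs: vector_space "\<lambda>c v. \<phi> c * v"
    by unfold_locales (auto simp: phi_add phi_mult algebra_simps)
  define N where "N = degree M"
  define T where "T = (\<lambda>i. y ^ i) ` {..<N}"
  have span: "ev f y \<in> vs.span T" for f
  proof -
    obtain g where g: "degree g < N" "ev g y = ev f y" using ev_reduce unfolding N_def by blast
    have "ev g y = (\<Sum>i<N. \<phi> (coeff g i) * y ^ i)" by (rule ev_altdef) fact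
    also have "\<dots> \<in> vs.span T"
      by (intro vs.span_sum vs.span_scale vs.span_base) (auto simp: T_def)
    finally show ?thesis using g by simp
  qed
  obtain f where f: "z = ev f y" using assms by blast
  have pow: "z ^ i = ev (f ^ i) y" for i unfolding f by (induction i) (auto simp: ev_simps)
  define S where "S = (\<lambda>i. z ^ i) ` {..N}"
  show ?thesis
  proof (cases "inj_on (\<lambda>i. z ^ i) {..N}")
    case False
    then obtain i j where ij: "i \<le> N" "j \<le> N" "i \<noteq> j" "z ^ i = z ^ j" unfolding inj_on_def by auto
    define g where "g = Polynomial.monom (1::'e) i - Polynomial.monom 1 j"
    have "coeff g i = 1" unfolding g_def using ij by simp
    then have "g \<noteq> 0" by auto
    moreover have "degree g \<le> N" unfolding g_def
      by (rule degree_diff_le) (use ij in \<open>auto simp: degree_monom_eq\<close>)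
    moreover have "ev g z = 0" unfolding g_def using ij by (simp add: ev_simps)
    ultimately show ?thesis unfolding N_def by blast
  next
    case True
    then have "card S = Suc N" unfolding S_def by (simp add: card_image)
    moreover have "card T \<le> N" unfolding T_def using card_image_le[of "{..<N}" "\<lambda>i. y ^ i"] by simp
    moreover have "S \<subseteq> vs.span T" unfolding S_def using span pow by auto
    moreover have "finite T" unfolding T_def by simp
    ultimately have "vs.dependent S" using vs.independent_span_bound[of T S] by fastforce
    then obtain t u where tu: "finite t" "t \<subseteq> S" "(\<Sum>v\<in>t. \<phi> (u v) * v) = 0" "\<exists>v\<in>t. u v \<noteq> 0"
      unfolding vs.dependent_explicit by blast
    define I where "I = {i. i \<le> N \<and> z ^ i \<in> t}"
    have tI: "t = (\<lambda>i. z ^ i) ` I" using tu(2) unfolding I_def S_def by auto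
    have injI: "inj_on (\<lambda>i. z ^ i) I" by (rule inj_on_subset[OF True]) (auto simp: I_def)
    have finI: "finite I" unfolding I_def by simp
    define g where "g = (\<Sum>i\<in>I. Polynomial.monom (u (z ^ i)) i)"
    have "ev g z = (\<Sum>i\<in>I. \<phi> (u (z ^ i)) * z ^ i)" unfolding g_def ev_sum ev_simps ..
    also have "\<dots> = (\<Sum>v\<in>t. \<phi> (u v) * v)" unfolding tI by (simp add: sum.reindex[OF injI])
    finally have "ev g z = 0" using tu by simp
    moreover have "degree g \<le> N" unfolding g_def
      by (rule degree_sum_le) (auto simp: finI I_def intro: order.trans[OF degree_monom_le])
    moreover have "g \<noteq> 0"
    proof -
      obtain i where i: "i \<in> I" "u (z ^ i) \<noteq> 0" using tu(4) unfolding tI by blast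
      have "coeff g i = (\<Sum>k\<in>I. if k = i then u (z ^ i) else 0)"
        unfolding g_def coeff_sum by (rule sum.cong) auto
      also have "\<dots> = u (z ^ i)" using finI i by simp
      finally show ?thesis using i by auto
    qed
    ultimately show ?thesis unfolding N_def by blast
  qed
qed

text \<open>
  The polynomials in \<open>y\<close> form a field: the constant coefficient of an equation of least degree
  for \<open>z \<noteq> 0\<close> is nonzero, and solving for it exhibits \<open>1 / z\<close> as a polynomial in \<open>z\<close>.
\<close>
lemma ev_surj: "range (\<lambda>f. ev f y) = UNIV"
proof -
  define S where "S = range (\<lambda>f. ev f y)"
  have S: "ev f y \<in> S" for f unfolding S_def by blast
  have "1 \<in> S" using S[of 1] by (simp add: ev_simps)
  then have C: "is_subring S" unfolding is_subring_def S_def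
    by (auto simp flip: ev_simps(1,3,4))
  note C = is_subringD[OF C]
  have phiS: "\<phi> c \<in> S" for c using S[of "[:c:]"] by (simp add: ev_simps)
  have evS: "ev f z \<in> S" if "z \<in> S" for f z
    by (induction f) (use that phiS C in \<open>auto simp: ev_simps\<close>)
  have inv: "inverse z \<in> S" if z: "z \<in> S" "z \<noteq> 0" for z
  proof -
    define R where "R f \<longleftrightarrow> f \<noteq> 0 \<and> ev f z = 0" for f
    obtain f0 where "R f0" using powers_dependent z(1) unfolding S_def R_def by blast
    define f where "f = arg_min degree R"
    have fR: "R f" unfolding f_def by (rule arg_min_natI) fact
    have fmin: "degree f \<le> degree g" if "R g" for g unfolding f_def by (rule arg_min_nat_le) fact
    obtain c g where f: "f = pCons c g" by (cases f)
    have "c \<noteq> 0"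
    proof
      assume "c = 0"
      then have "g \<noteq> 0" "ev g z = 0" using fR z unfolding R_def f by (auto simp: ev_simps)
      then have "degree f \<le> degree g" using fmin unfolding R_def by blast
      then show False using \<open>g \<noteq> 0\<close> unfolding f by simp
    qed
    have "\<phi> c + z * ev g z = 0" using fR unfolding R_def f by (simp add: ev_simps)
    then have "z * ev g z = - \<phi> c" by (simp add: eq_neg_iff_add_eq_0 add.commute)
    then have "z * (ev g z * \<phi> (- inverse c)) = - \<phi> c * \<phi> (- inverse c)" by (simp flip: mult.assoc)
    also have "\<dots> = 1" using \<open>c \<noteq> 0\<close> by (simp add: phi_neg phi_inverse)
    finally have "z * (ev g z * \<phi> (- inverse c)) = 1" .
    then have "inverse z = ev g z * \<phi> (- inverse c)" by (rule inverse_unique)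
    then show ?thesis using C(6)[OF evS[OF z(1)] phiS] by metis
  qed
  have "z \<in> S" if "z \<in> generate_field ring_of_type_algebra (range \<phi> \<union> {y})" for z
    using that
  proof induction
    case (incl h)
    then show ?case using phiS S[of "[:0, 1:]"] by (auto simp: ev_simps)
  qed (use C inv in auto)
  then show ?thesis using gen unfolding S_def by auto
qed

lemma rep: "\<exists>f. degree f < degree M \<and> z = ev f y"
proof -
  obtain f where "z = ev f y" using ev_surj by blast
  then show ?thesis using ev_reduce[of f] by metis
qed

lemma algebraic: "\<exists>f. f \<noteq> 0 \<and> degree f \<le> degree M \<and> ev f z = 0"
  by (rule powers_dependent) (simp add: ev_surj)

end

section \<open>Places of the curve\<close>

lemma card_roots_separable:
  fixes L :: "'k::field poly"
  assumes L0: "L \<noteq> 0" and d: "pderiv L = [:d:]" "d \<noteq> 0"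
    and roots: "\<And>z :: 'k alg_closure. poly (map_poly to_ac L) z = 0 \<Longrightarrow> z \<in> range to_ac"
  shows "card {b. poly L b = 0} = degree L"
proof -
  interpret ac: field_embedding "to_ac :: 'k \<Rightarrow> 'k alg_closure" by unfold_locales simp_all
  define LA where "LA = map_poly to_ac L"
  have deg: "degree LA = degree L" unfolding LA_def by (simp add: degree_map_poly)
  have LA0: "LA \<noteq> 0" unfolding LA_def using L0 by (simp add: map_poly_eq_0_iff)
  have dLA: "pderiv LA = [:to_ac d:]"
  proof -
    have "pderiv LA = map_poly to_ac (pderiv L)"
      by (rule poly_eqI) (simp add: LA_def coeff_pderiv coeff_map_poly)
    then show ?thesis unfolding d(1) by (simp add: map_poly_pCons)
  qed
  obtain A where A: "size A = degree LA" "LA = smult (lead_coeff LA) (\<Prod>x\<in>#A. [:-x, 1:])"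
    using alg_closed_imp_factorization[OF LA0] by blast
  have one: "count A x \<le> 1" for x
  proof (rule ccontr)
    assume "\<not> count A x \<le> 1"
    then have "{#x, x#} \<subseteq># A" by (intro mset_subset_eqI) (auto simp: not_le)
    then obtain B where B: "A = {#x, x#} + B" by (metis subset_mset.le_iff_add)
    define g where "g = (\<Prod>x\<in>#B. [:-x, 1:])"
    have "LA = smult (lead_coeff LA) ([:-x, 1:] * ([:-x, 1:] * g))"
      by (subst A(2)) (simp add: B g_def)
    then have "pderiv LA = smult (lead_coeff LA) (pderiv ([:-x, 1:] * ([:-x, 1:] * g)))"
      by (metis pderiv_smult)
    then have "poly (pderiv LA) x = 0" by (simp add: pderiv_mult del: mult_pCons_left)
    then show False unfolding dLA using d(2) by simp
  qed
  have roots_A: "poly LA x = 0 \<longleftrightarrow> x \<in># A" for x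
  proof -
    have "poly (\<Prod>x\<in>#B. [:-x, 1:]) x = 0 \<longleftrightarrow> x \<in># B" for B by (induction B) auto
    then show ?thesis using LA0 by (subst A(2)) simp
  qed
  have "card (set_mset A) = size A"
  proof -
    have "A = mset_set (set_mset A)"
    proof (rule multiset_eqI)
      fix x show "count A x = count (mset_set (set_mset A)) x"
        using one[of x]
          by (cases "x \<in># A") (auto simp: count_mset_set' not_in_iff le_Suc_eq simp flip: not_in_iff)
    qed
    then show ?thesis by (metis size_mset_set)
  qed
  moreover have "set_mset A = to_ac ` {b. poly L b = 0}"
  proof -
    have ev: "poly LA (to_ac b) = to_ac (poly L b)" for b
    proof -
      have "ac.ev f (to_ac b) = to_ac (poly f b)" for f
        by (induction f) (simp_all add: ac.ev_simps)
      then show ?thesis unfolding LA_def ac.ev_def by blast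
    qed
    show ?thesis
    proof (intro equalityI subsetI)
      fix z assume "z \<in># A"
      then have "poly LA z = 0" by (simp add: roots_A)
      moreover from this obtain b where "z = to_ac b" using roots[of z] unfolding LA_def by blast
      ultimately show "z \<in> to_ac ` {b. poly L b = 0}" using ev by auto
    next
      fix z assume "z \<in> to_ac ` {b. poly L b = 0}"
      then obtain b where "z = to_ac b" "poly L b = 0" by blast
      then have "poly LA z = 0" using ev by simp
      then show "z \<in># A" unfolding roots_A .
    qed
  qed
  moreover have "card (to_ac ` {b. poly L b = 0}) = card {b. poly L b = 0}"
    by (intro card_image inj_onI) simp
  ultimately show ?thesis using A(1) deg by simp
qed

lemma valuation_of_ring:
  assumes K: "valuation_ring K V" and v: "discrete_valuation v" "V = {z. z = 0 \<or> 0 \<le> v z}"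
  shows "discrete_valuation (valuation K (nonunits V))"
    and "V = {z. z = 0 \<or> 0 \<le> valuation K (nonunits V) z}"
    and "z \<noteq> 0 \<Longrightarrow> valuation K (nonunits V) z = v z"
proof -
  interpret discrete_valuation v by fact
  have V: "V = ring" unfolding ring_def v(2) ..
  note K' = K[unfolded V]
  show "discrete_valuation (valuation K (nonunits V))" unfolding V
    by (rule discrete_valuation_valuation[OF K'])
  show eq: "valuation K (nonunits V) z = v z" if "z \<noteq> 0" for z unfolding V
    by (rule valuation_eq[OF K' that])
  have "z \<in> V \<longleftrightarrow> z = 0 \<or> 0 \<le> valuation K (nonunits V) z" for z
    using eq[of z] by (cases "z = 0") (subst v(2), simp)+
  then show "V = {z. z = 0 \<or> 0 \<le> valuation K (nonunits V) z}" by blast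
qed

lemma K_x_valuation_ring:
  assumes V: "valuation_ring K_x (V :: 'k::field poly fract set)"
  shows "V = {z. z = 0 \<or> 0 \<le> valuation K_x (nonunits V) z}"
  using valuation_ring_K_x_cases[OF V]
proof
  assume "V = inf_ring"
  moreover obtain v :: "'k poly fract \<Rightarrow> int"
    where "discrete_valuation v" "inf_ring = {z. z = 0 \<or> 0 \<le> v z}"
    using inf_valuation_exists by blast
  ultimately show ?thesis using valuation_of_ring(2)[OF V] by blast
next
  assume "\<exists>p. irreducible p \<and> V = fin_ring p"
  then obtain p where "irreducible p" "V = fin_ring p" by blast
  moreover obtain v :: "'k poly fract \<Rightarrow> int"
    where "discrete_valuation v" "fin_ring p = {z. z = 0 \<or> 0 \<le> v z}"
    using fin_valuation_exists[OF \<open>irreducible p\<close>] by blast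
  ultimately show ?thesis using valuation_of_ring(2)[OF V] by blast
qed

lemma place_K_x_eqI:
  assumes P: "place K_x (P :: 'k::field poly fract set)" and Q: "place K_x Q"
    and eq: "\<And>c. c \<noteq> 0 \<Longrightarrow> 0 \<le> valuation K_x P c \<longleftrightarrow> 0 \<le> valuation K_x Q c"
  shows "P = Q"
proof -
  obtain V where V: "valuation_ring K_x V" "P = nonunits V" using P unfolding place_iff by blast
  obtain W where W: "valuation_ring K_x W" "Q = nonunits W" using Q unfolding place_iff by blast
  have "V = W" using K_x_valuation_ring[OF V(1)] K_x_valuation_ring[OF W(1)] eq
    unfolding V(2) W(2) by blast
  then show ?thesis using V W by simp
qed

lemma place_K_x_mem_iff:
  assumes P: "place K_x (P :: 'k::field poly fract set)"
  shows "c \<in> P \<longleftrightarrow> c = 0 \<or> 0 < valuation K_x P c"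
proof -
  obtain V where V: "valuation_ring K_x V" "P = nonunits V" using P unfolding place_iff by blast
  interpret discrete_valuation "valuation K_x P" by (rule place_K_x_discrete[OF P])
  have "V = ring" using K_x_valuation_ring[OF V(1)] unfolding ring_def V(2)[symmetric] .
  then have "P = {z. z = 0 \<or> 0 < valuation K_x P z}" using nonunits_ring V(2) by simp
  then show ?thesis by blast
qed

lemma valuation_const:
  assumes P: "place K_x (P :: 'k::field poly fract set)" and "a \<noteq> 0"
  shows "valuation K_x P (const_fract a) = 0"
proof -
  obtain V where V: "valuation_ring K_x V" "P = nonunits V" using P unfolding place_iff by blast
  have "0 \<le> valuation K_x P (const_fract b)" if "b \<noteq> 0" for b
  proof -
    have "const_fract b \<in> V" using valuation_ringD(2)[OF V(1)] by blast
    then show ?thesis using K_x_valuation_ring[OF V(1)] that unfolding V(2)[symmetric]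
      by (metis (mono_tags, lifting) const_fract_simps(6) mem_Collect_eq)
  qed
  from this[OF \<open>a \<noteq> 0\<close>] this[of "inverse a"] show ?thesis
    using discrete_valuation.inverse[OF place_K_x_discrete[OF P], of "const_fract a"] \<open>a \<noteq> 0\<close>
    by (simp add: const_fract_inverse)
qed

lemma le_div_iff_mult_le:
  assumes "0 < (c::int)" shows "a \<le> b div c \<longleftrightarrow> a * c \<le> b"
proof
  assume "a \<le> b div c"
  then have "a * c \<le> b div c * c" using assms by (intro mult_right_mono) auto
  moreover have "b div c * c \<le> b" using assms pos_mod_sign[of c b] div_mult_mod_eq[of b c]
    by linarith
  ultimately show "a * c \<le> b" by (rule order.trans)
next
  assume "a * c \<le> b"
  then have "a * c div c \<le> b div c" using assms by (rule zdiv_mono1)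
  then show "a \<le> b div c" using assms by simp
qed

text \<open>
  What the argument uses of the linearized polynomial: it has as many roots in the constant
  field as its degree says, and is invariant under translation by them. The last hypotheses say
  that \<open>h\<close> has a pole and that the orders of its poles are prime to the degree.
\<close>
locale additive_curve = field_embedding \<phi>
  for \<phi> :: "'k::field poly fract \<Rightarrow> 'f::field" +
  fixes L :: "'k poly" and h :: "'k poly fract" and y :: 'f
  assumes L_pos: "0 < degree L"
    and curve: "curve_function_field L h \<phi> y"
    and shift: "\<And>b z. poly L b = 0 \<Longrightarrow>
      poly (map_poly (\<phi> \<circ> const_fract) L) (z + \<phi> (const_fract b)) = poly (map_poly (\<phi> \<circ> const_fract) L) z"
    and roots: "card {b. poly L b = 0} = degree L"
    and pole_exists: "\<exists>P. place K_x P \<and> valuation K_x P h < 0"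
    and pole_order_coprime: "\<And>P. place K_x P \<Longrightarrow> valuation K_x P h < 0
      \<Longrightarrow> coprime (valuation K_x P h) (int (degree L))"
    and h0: "h \<noteq> 0"
begin

definition N where "N = degree L"
definition \<kappa> where "\<kappa> = \<phi> \<circ> const_fract"
definition M where "M = map_poly const_fract L - [:h:]"
abbreviation K' where "K' \<equiv> \<phi> ` K_x"
abbreviation vx where "vx \<equiv> valuation K_x"
abbreviation vy where "vy V \<equiv> valuation K' (nonunits V)"

sublocale const: field_embedding \<kappa>
  by unfold_locales (simp_all add: \<kappa>_def phi_add phi_mult)

lemma N_pos: "0 < N" unfolding N_def by (rule L_pos)

lemma degree_M: "degree M = N"
proof -
  have "degree (map_poly const_fract L) = N" unfolding N_def by (simp add: degree_map_poly)
  then show ?thesis unfolding M_def diff_conv_add_uminus using N_pos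
    by (subst degree_add_eq_left) simp_all
qed

lemma const_ev: "const.ev f = poly (map_poly (\<phi> \<circ> const_fract) f)"
  by (subst const.ev_def) (simp add: \<kappa>_def)

lemma L_y: "const.ev L y = \<phi> h"
  using curve unfolding curve_function_field_def const_ev by simp

lemma ev_M: "ev M z = const.ev L z - \<phi> h"
  unfolding M_def ev_simps unfolding ev_def const_ev
  by (simp add: map_poly_map_poly)

sublocale simple_extension \<phi> y M
proof
  show "0 < degree M" unfolding degree_M by (rule N_pos)
  show "ev M y = 0" unfolding ev_M L_y by simp
  show "generate_field ring_of_type_algebra (range \<phi> \<union> {y}) = UNIV"
    using curve unfolding curve_function_field_def by simp
qed

text \<open>
  \<open>V\<close> is the valuation ring of a place of the curve that lies over the place \<open>P\<close> of the line. This
  is stated through valuation rings rather than maximal ideals, because restriction along \<open>\<phi>\<close> is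
  then just taking preimages.
\<close>
definition above
  where "above V P \<longleftrightarrow> valuation_ring K' V \<and> place K_x P \<and> (\<forall>c. c \<noteq> 0 \<longrightarrow> (\<phi> c \<in> V \<longleftrightarrow> 0 \<le> vx P c))"

lemma aboveI:
  assumes V: "is_subring V" "\<And>z. z \<in> V \<or> inverse z \<in> V" and P: "place K_x P"
    and res: "\<And>c. c \<noteq> 0 \<Longrightarrow> \<phi> c \<in> V \<longleftrightarrow> 0 \<le> vx P c"
  shows "above V P"
proof -
  interpret discrete_valuation "vx P" by (rule place_K_x_discrete[OF P])
  obtain t where t: "t \<noteq> 0" "vx P t = 1" using uniformizer_exists by blast
  have "\<phi> c \<in> V" if "c \<in> K_x" for c
  proof (cases "c = 0")
    case False
    then show ?thesis using that res[of c] valuation_const[OF P] by fastforce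
  qed (use is_subringD(2)[OF V(1)] in simp)
  then have "K' \<subseteq> V" by blast
  moreover have "\<phi> t \<in> V" "\<phi> t \<notin> K'"
    using res[of t] t valuation_const[OF P] by (auto simp: phi_inj)
  moreover have "\<phi> (Fields.inverse t) \<notin> V" using res[of "Fields.inverse t"] t by simp
  ultimately have "valuation_ring K' V" unfolding valuation_ring_iff using V by blast
  then show ?thesis unfolding above_def using P res by blast
qed

text \<open>
  The ring \<open>V\<close> contains the valuation ring of \<open>P\<close> and avoids \<open>inverse t\<close> for a uniformizer \<open>t\<close>. An
  element \<open>c\<close> of negative value in \<open>V\<close> would bring in \<open>inverse t = c * inverse (t * c)\<close>.
\<close>
lemma above_exists:
  assumes P: "place K_x P" shows "\<exists>V. above V P"
proof -
  interpret v: discrete_valuation "vx P" by (rule place_K_x_discrete[OF P])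
  obtain t where t: "t \<noteq> 0" "vx P t = 1" using v.uniformizer_exists by blast
  define A where "A = \<phi> ` v.ring"
  have tr: "t \<in> v.ring" "inverse t \<notin> v.ring" using t unfolding v.ring_def by auto
  have "is_subring A"
    using is_subringD[OF v.is_subring_ring] unfolding is_subring_def A_def
    by (auto simp flip: phi_add phi_mult phi_neg) (metis imageI phi_one)
  moreover have "\<phi> (inverse t) \<notin> A" "inverse (\<phi> (inverse t)) \<in> A"
    using tr unfolding A_def by (auto simp: phi_inj simp flip: phi_inverse)
  ultimately obtain V
    where V: "is_subring V" "A \<subseteq> V" "\<phi> (inverse t) \<notin> V" "\<And>z. z \<in> V \<or> inverse z \<in> V"
    using maximal_overring_valuation by metis
  have "above V P"
  proof (rule aboveI[OF V(1,4) P])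
    fix c :: "'k poly fract" assume c: "c \<noteq> 0"
    show "\<phi> c \<in> V \<longleftrightarrow> 0 \<le> vx P c"
    proof
      assume "0 \<le> vx P c"
      then have "c \<in> v.ring" unfolding v.ring_def by simp
      then show "\<phi> c \<in> V" using V(2) unfolding A_def by blast
    next
      assume cV: "\<phi> c \<in> V"
      show "0 \<le> vx P c"
      proof (rule ccontr)
        assume "\<not> 0 \<le> vx P c"
        then have "inverse (t * c) \<in> v.ring" unfolding v.ring_def
          using t c v.mult[OF t(1) c] v.inverse[of "t * c"] by auto
        then have "\<phi> (inverse (t * c)) \<in> V" using V(2) unfolding A_def by blast
        then have "\<phi> c * \<phi> (inverse (t * c)) \<in> V" using cV is_subringD(6)[OF V(1)] by blast
        moreover have "\<phi> c * \<phi> (inverse (t * c)) = \<phi> (inverse t)"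
        proof -
          have "c * inverse (t * c) = inverse t" using c by simp
          then show ?thesis by (metis phi_mult)
        qed
        ultimately show False using V(3) by simp
      qed
    qed
  qed
  then show ?thesis by blast
qed

lemma above_restriction:
  assumes V: "valuation_ring K' V" shows "\<exists>P. above V P"
proof -
  note VV = valuation_ringD[OF V] note C = is_subringD[OF VV(1)]
  define W where "W = {c. \<phi> c \<in> V}"
  have W: "valuation_ring K_x W"
    unfolding valuation_ring_iff
  proof (intro conjI psubsetI allI)
    show "is_subring W" unfolding is_subring_def W_def using C
      by (auto simp: phi_add phi_mult phi_neg)
    show sub: "K_x \<subseteq> W" using VV(2) unfolding W_def by blast
    show tot: "c \<in> W \<or> inverse c \<in> W" for c using VV(3) unfolding W_def by (auto simp: phi_inverse)
    show "W \<noteq> UNIV"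
    proof
      assume "W = UNIV"
      then have "range \<phi> \<subseteq> V" unfolding W_def by auto
      then have "z \<in> V" for z
        using algebraic_in_valuation_ring[OF VV(1), of _ z] VV(3) algebraic[of z] by blast
      then show False using VV(4) by blast
    qed
    show "K_x \<noteq> W"
    proof
      assume eq: "K_x = W"
define x :: "'k poly fract" where "x = to_fract [:0, 1:]"
      have nx: "x \<noteq> const_fract a" for a unfolding x_def const_fract_def by simp
      have "x \<in> K_x \<or> inverse x \<in> K_x" unfolding eq by (rule tot)
      then obtain a where "inverse x = const_fract a" using nx by auto
      then have "x = const_fract (inverse a)" by (metis const_fract_inverse inverse_inverse_eq)
      then show False using nx by blast
    qed
  qed
  have "place K_x (nonunits W)" unfolding place_iff using W by blast
  moreover have "\<phi> c \<in> V \<longleftrightarrow> 0 \<le> vx (nonunits W) c" if "c \<noteq> 0" for c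
  proof -
    have "\<phi> c \<in> V \<longleftrightarrow> c \<in> W" unfolding W_def by simp
    also have "\<dots> \<longleftrightarrow> 0 \<le> vx (nonunits W) c" using K_x_valuation_ring[OF W] that by blast
    finally show ?thesis .
  qed
  ultimately show ?thesis unfolding above_def using V by blast
qed

lemma above_unique:
  assumes "above V P" "above V P'" shows "P = P'"
  using assms place_K_x_eqI[of P P'] unfolding above_def by blast

text \<open>
  Suppose the place below \<open>V\<close> is \<open>P'\<close>. The inclusion of maximal ideals gives \<open>vx P' c > 0\<close> whenever
  \<open>vx P c > 0\<close>. If \<open>vx P c \<ge> 0 > vx P' c\<close> for some \<open>c\<close>, then multiplying a uniformizer of \<open>P\<close> by a high
  power of \<open>c\<close> violates this.
\<close>
lemma lies_over_imp_above:
  assumes V: "valuation_ring K' V" and P: "place K_x P" and lo: "lies_over \<phi> (nonunits V) P"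
  shows "above V P"
proof -
  obtain P' where ab: "above V P'" using above_restriction[OF V] by blast
  then have P': "place K_x P'" and res: "\<And>c. c \<noteq> 0 \<Longrightarrow> \<phi> c \<in> V \<longleftrightarrow> 0 \<le> vx P' c" unfolding above_def
    by auto
  interpret v: discrete_valuation "vx P" by (rule place_K_x_discrete[OF P])
  interpret v': discrete_valuation "vx P'" by (rule place_K_x_discrete[OF P'])
  have pos: "0 < vx P' c" if c: "c \<noteq> 0" "0 < vx P c" for c
  proof -
    have "c \<in> P" unfolding place_K_x_mem_iff[OF P] using c by simp
    then have "\<phi> c \<in> nonunits V" using lo unfolding lies_over_def by blast
    then have "\<phi> (inverse c) \<notin> V" using c unfolding nonunits_def by (auto simp: phi_inverse)
    then show ?thesis using res[of "inverse c"] c by simp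
  qed
  obtain t where t: "t \<noteq> 0" "vx P t = 1" using v.uniformizer_exists by blast
  have nonneg: "0 \<le> vx P' c" if c: "c \<noteq> 0" "0 \<le> vx P c" for c
  proof (rule ccontr)
    assume neg: "\<not> 0 \<le> vx P' c"
    define n where "n = nat (vx P' t)"
    have "0 < vx P (t * c ^ n)" using t c by (simp add: v.mult v.power add_pos_nonneg)
    then have "0 < vx P' (t * c ^ n)" using pos t c by simp
    then have "0 < vx P' t + int n * vx P' c" using t c by (simp add: v'.mult v'.power)
    moreover have "int n * vx P' c \<le> int n * (- 1)" using neg by (intro mult_left_mono) auto
    moreover have "int n = vx P' t" "0 < vx P' t" unfolding n_def using pos[of t] t by simp_all
    ultimately show False by linarith
  qed
  have "0 \<le> vx P' c \<longleftrightarrow> 0 \<le> vx P c" if c: "c \<noteq> 0" for c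
  proof
    assume "0 \<le> vx P' c"
    then show "0 \<le> vx P c" using pos[of "inverse c"] c by fastforce
  qed (use nonneg c in blast)
  then have "P = P'" using place_K_x_eqI[OF P P'] by blast
  then show ?thesis using ab by simp
qed

lemma above_discrete:
  assumes ab: "above V P"
  shows "discrete_valuation (vy V)"
    and "V = {z. z = 0 \<or> 0 \<le> vy V z}"
    and "\<exists>e>0. \<forall>c. c \<noteq> 0 \<longrightarrow> vy V (\<phi> c) = e * vx P c"
proof -
  have V: "valuation_ring K' V" and P: "place K_x P"
    and res: "\<And>c. c \<noteq> 0 \<Longrightarrow> \<phi> c \<in> V \<longleftrightarrow> 0 \<le> vx P c" using ab unfolding above_def by auto
  note VV = valuation_ringD[OF V]
  have tot: "z \<in> V \<or> inverse z \<in> V" for z using VV(3) by blast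
  obtain v' e where v': "discrete_valuation v'" "V = {z. z = 0 \<or> 0 \<le> v' z}" "e > 0"
    "\<And>c. c \<noteq> 0 \<Longrightarrow> v' (\<phi> c) = e * vx P c"
    using discrete_valuation_extension[OF VV(1) tot place_K_x_discrete[OF P] res algebraic] by metis
  note vr = valuation_of_ring[OF V v'(1,2)]
  show "discrete_valuation (vy V)"
    "V = {z. z = 0 \<or> 0 \<le> vy V z}" by (rule vr)+
  show "\<exists>e>0. \<forall>c. c \<noteq> 0 \<longrightarrow> vy V (\<phi> c) = e * vx P c"
    using v'(3,4) vr(3) by (intro exI[of _ e]) simp
qed

lemma val_const:
  assumes ab: "above V P" and a: "a \<noteq> 0" shows "vy V (\<kappa> a) = 0"
proof -
  obtain e where "\<And>c. c \<noteq> 0 \<Longrightarrow> vy V (\<phi> c) = e * vx P c"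
    using above_discrete(3)[OF ab] by blast
  moreover have "vx P (const_fract a) = 0" using ab a valuation_const unfolding above_def by blast
  ultimately show ?thesis using a unfolding \<kappa>_def by simp
qed

lemma kappa_in: "above V P \<Longrightarrow> \<kappa> a \<in> V"
  using valuation_ringD(2)[of K' V] unfolding above_def \<kappa>_def by auto

text \<open>
  The constants have value \<open>0\<close>, so at a pole of \<open>z\<close> the leading term of \<open>L(z)\<close> dominates.
\<close>
lemma val_L_of_pole:
  assumes ab: "above V P" and z: "z \<noteq> 0" "vy V z < 0"
  shows "vy V (const.ev L z) = int N * vy V z"
proof -
  define w where "w = vy V"
  interpret w: discrete_valuation w unfolding w_def by (rule above_discrete[OF ab])
  have neg: "w z < 0" using z(2) unfolding w_def .
  define I where "I = {i. i \<le> N \<and> coeff L i \<noteq> 0}"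
  have sum: "const.ev L z = (\<Sum>i\<in>I. \<kappa> (coeff L i) * z ^ i)"
  proof -
    have "const.ev L z = (\<Sum>i<Suc N. \<kappa> (coeff L i) * z ^ i)"
      by (rule const.ev_altdef) (simp add: N_def)
    also have "\<dots> = (\<Sum>i\<in>I. \<kappa> (coeff L i) * z ^ i)"
      by (rule sum.mono_neutral_right) (auto simp: I_def)
    finally show ?thesis .
  qed
  have val: "w (\<kappa> (coeff L i) * z ^ i) = int i * w z" if "i \<in> I" for i
    using that z(1) val_const[OF ab, of "coeff L i"] unfolding I_def w_def[symmetric]
    by (simp add: w.mult w.power)
  have NI: "N \<in> I" unfolding I_def N_def using L_pos by auto
  have "w (const.ev L z) = Min ((\<lambda>i. w (\<kappa> (coeff L i) * z ^ i)) ` I)"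
    unfolding sum
  proof (rule conjunct2[OF w.sum_distinct])
    show "inj_on (\<lambda>i. w (\<kappa> (coeff L i) * z ^ i)) I"
      by (rule inj_onI) (use val neg in auto)
  qed (use NI z(1) in \<open>auto simp: I_def\<close>)
  also have "\<dots> = int N * w z"
  proof (rule Min_eqI)
    show "int N * w z \<in> (\<lambda>i. w (\<kappa> (coeff L i) * z ^ i)) ` I" using NI val by force
    fix x assume "x \<in> (\<lambda>i. w (\<kappa> (coeff L i) * z ^ i)) ` I"
    then obtain i where "i \<in> I" "x = int i * w z" using val by auto
    then show "int N * w z \<le> x" using neg unfolding I_def by (simp add: mult_right_mono_neg)
  qed (simp add: I_def)
  finally show ?thesis unfolding w_def .
qed

lemma not_in_above_ring:
  assumes "above V P" "z \<notin> V" shows "z \<noteq> 0 \<and> vy V z < 0"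
proof -
  have "\<not> (z = 0 \<or> 0 \<le> vy V z)" using above_discrete(2)[OF assms(1)] assms(2) by blast
  then show ?thesis by simp
qed

lemma y_integral:
  assumes ab: "above V P" and h: "0 \<le> vx P h"
  shows "y \<in> V"
proof (rule ccontr)
  assume "y \<notin> V"
  from not_in_above_ring[OF ab this] have y: "y \<noteq> 0" "vy V y < 0" by auto
  have "int N * vy V y < 0" using y(2) N_pos by (simp add: mult_pos_neg)
  then have "vy V (\<phi> h) < 0" using val_L_of_pole[OF ab y] unfolding L_y by simp
  moreover have "\<phi> h \<in> V" using ab h h0 unfolding above_def by simp
  then have "\<phi> h = 0 \<or> 0 \<le> vy V (\<phi> h)" using above_discrete(2)[OF ab] by blast
  ultimately show False using h0 by simp
qed

lemma N_val_y:
  assumes ab: "above V P" and h: "vx P h < 0"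
  shows "y \<noteq> 0 \<and> int N * vy V y = vy V (\<phi> h)"
proof -
  have V: "is_subring V" using ab valuation_ringD(1) unfolding above_def by blast
  have "y \<notin> V"
  proof
    assume "y \<in> V"
    then have "const.ev L y \<in> V" unfolding const.ev_def
      by (intro is_subring_poly[OF V]) (auto simp: coeff_map_poly kappa_in[OF ab])
    moreover have "\<phi> h \<notin> V" using ab h h0 unfolding above_def by simp
    ultimately show False using L_y by simp
  qed
  from not_in_above_ring[OF ab this] val_L_of_pole[OF ab, of y] show ?thesis unfolding L_y by simp
qed

text \<open>
  Let \<open>e\<close> be the ramification index. By \<open>N_val_y\<close>, \<open>N\<close> times the value of \<open>c y ^ i\<close> equals \<open>e\<close> times
  \<open>\<nu> = N v(c) + i v(h)\<close>. As \<open>v(h)\<close> is prime to \<open>N\<close>, the numbers \<open>\<nu>\<close> differ modulo \<open>N\<close> for different \<open>i < N\<close>,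
  so \<open>N\<close> times the value of \<open>f(y)\<close> is \<open>e\<close> times the least \<open>\<nu>\<close>. Applied to a uniformizer above \<open>P\<close>
  this shows that \<open>e\<close> divides \<open>N\<close>; and as \<open>\<nu> = 1\<close> occurs by Bezout, \<open>N\<close> divides \<open>e\<close>.
\<close>
lemma ramified_valuation:
  assumes ab: "above V P" and h: "vx P h < 0" and f: "f \<noteq> 0" "degree f < N"
  shows "ev f y \<noteq> 0 \<and> vy V (ev f y)
    = Min ((\<lambda>i. int N * vx P (coeff f i) + int i * vx P h) ` {i. coeff f i \<noteq> 0})"
proof -
  define w where "w = vy V"
  interpret w: discrete_valuation w unfolding w_def by (rule above_discrete[OF ab])
  have P: "place K_x P" using ab unfolding above_def by simp
  interpret v: discrete_valuation "vx P" by (rule place_K_x_discrete[OF P])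
  obtain e where e: "e > 0" "\<And>c. c \<noteq> 0 \<Longrightarrow> w (\<phi> c) = e * vx P c"
    using above_discrete(3)[OF ab] unfolding w_def by blast
  have y: "y \<noteq> 0" "int N * w y = e * vx P h" using N_val_y[OF ab h] e(2)[OF h0] unfolding w_def
    by auto
  have cop: "coprime (int N) (vx P h)" using pole_order_coprime[OF P h] unfolding N_def
    by (simp add: coprime_commute)
  define \<nu>
    where "\<nu> f i = int N * vx P (coeff f i) + int i * vx P h" for f :: "'k poly fract poly" and i
  have term_val: "int N * w (\<phi> (coeff f i) * y ^ i) = e * \<nu> f i" if "coeff f i \<noteq> 0" for f i
  proof -
    have "int N * w (\<phi> (coeff f i) * y ^ i) = int N * (e * vx P (coeff f i)) + int i * (int N * w y)"
      using that y e by (simp add: w.mult w.power algebra_simps)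
    also have "\<dots> = e * \<nu> f i" unfolding y \<nu>_def by (simp add: algebra_simps)
    finally show ?thesis .
  qed
  have main: "ev f y \<noteq> 0 \<and> int N * w (ev f y) = e * Min (\<nu> f ` {i. coeff f i \<noteq> 0})"
    if f: "f \<noteq> 0" "degree f < N" for f
  proof -
    define I where "I = {i. coeff f i \<noteq> 0}"
    have I: "I \<subseteq> {..<N}" unfolding I_def using f(2) by (auto intro: le_less_trans[OF le_degree])
    then have fin: "finite I" using finite_subset by blast
    have ne: "I \<noteq> {}" unfolding I_def using f leading_coeff_0_iff by blast
    have inj: "inj_on (\<nu> f) I"
    proof (rule inj_onI)
      fix i j assume ij: "i \<in> I" "j \<in> I" "\<nu> f i = \<nu> f j"
      then have "(int i - int j) * vx P h = int N * (vx P (coeff f j) - vx P (coeff f i))"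
        unfolding \<nu>_def by (simp add: algebra_simps)
      then have "int N dvd (int i - int j) * vx P h" by simp
      then have "int N dvd int i - int j" using cop coprime_dvd_mult_left_iff by blast
      moreover have "i < N" "j < N" using ij(1,2) I by auto
      then have "\<bar>int i - int j\<bar> < int N" by linarith
      ultimately show "i = j" using zdvd_not_zless[of "\<bar>int i - int j\<bar>" "int N"] by fastforce
    qed
    have sum: "ev f y = (\<Sum>i\<in>I. \<phi> (coeff f i) * y ^ i)"
      unfolding ev_altdef[OF f(2)] by (rule sum.mono_neutral_right) (use I in \<open>auto simp: I_def\<close>)
    have nz: "\<phi> (coeff f i) * y ^ i \<noteq> 0" if "i \<in> I" for i using that y unfolding I_def by simp
    have inj2: "inj_on (\<lambda>i. w (\<phi> (coeff f i) * y ^ i)) I"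
    proof (rule inj_onI)
      fix i j assume ij: "i \<in> I" "j \<in> I" "w (\<phi> (coeff f i) * y ^ i) = w (\<phi> (coeff f j) * y ^ j)"
      then have ci: "coeff f i \<noteq> 0" "coeff f j \<noteq> 0" unfolding I_def by auto
      have "e * \<nu> f i = e * \<nu> f j" using term_val[OF ci(1)] term_val[OF ci(2)] ij(3) by metis
      then show "i = j" using inj_onD[OF inj _ ij(1,2)] e(1) by simp
    qed
    note sd = w.sum_distinct[OF fin ne nz inj2]
    have "int N * Min ((\<lambda>i. w (\<phi> (coeff f i) * y ^ i)) ` I) = e * Min (\<nu> f ` I)"
    proof -
      have "int N * Min ((\<lambda>i. w (\<phi> (coeff f i) * y ^ i)) ` I)
          = Min ((\<lambda>x. int N * x) ` (\<lambda>i. w (\<phi> (coeff f i) * y ^ i)) ` I)"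
        by (rule mono_Min_commute) (use fin ne in \<open>auto simp: mono_def mult_left_mono\<close>)
      also have "(\<lambda>x. int N * x) ` (\<lambda>i. w (\<phi> (coeff f i) * y ^ i)) ` I = (\<lambda>x. e * x) ` \<nu> f ` I"
        unfolding image_image by (rule image_cong) (use term_val in \<open>auto simp: I_def\<close>)
      also have "Min \<dots> = e * Min (\<nu> f ` I)"
        by (rule mono_Min_commute[symmetric]) (use fin ne e in \<open>auto simp: mono_def mult_left_mono\<close>)
      finally show ?thesis .
    qed
    then show ?thesis using sd unfolding sum I_def by auto
  qed
  have "e = int N"
  proof -
    \<comment> \<open>Bezout, with the multiplier of \<open>vx P h\<close> reduced into the range of exponents of \<open>y\<close>.\<close>
    have "\<exists>i a. i < N \<and> int N * a + int i * vx P h = 1"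
    proof -
      obtain x where x: "[vx P h * x = 1] (mod int N)"
        using cong_solve_coprime_int[of "vx P h" "int N"] cop by (auto simp: coprime_commute)
      define i where "i = nat (x mod int N)"
      have i: "int i = x mod int N" "i < N" unfolding i_def using N_pos by (auto simp: nat_less_iff)
      have "[int i * vx P h = 1] (mod int N)" unfolding i using x
        by (metis cong_def mod_mult_left_eq mult.commute)
      then have "int N dvd 1 - int i * vx P h" by (metis cong_iff_dvd_diff cong_sym)
      then obtain a where "1 - int i * vx P h = int N * a" by blast
      then show ?thesis using i(2) by (intro exI[of _ i] exI[of _ a]) simp
    qed
    then obtain i a where ia: "i < N" "int N * a + int i * vx P h = 1" by blast
    obtain t where t: "t \<noteq> 0" "vx P t = 1" using v.uniformizer_exists by blast
    define c where "c = t powi a"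
    have c: "c \<noteq> 0" "vx P c = a" unfolding c_def using t by (auto simp: v.powi)
    define g where "g = Polynomial.monom c i"
    have "coeff g i \<noteq> 0" unfolding g_def using c by simp
    from term_val[OF this] have "int N * w (\<phi> c * y ^ i) = e"
      unfolding \<nu>_def g_def using c ia by simp
    then have d1: "int N dvd e" by (metis dvd_triv_left)
    obtain z where z: "z \<noteq> 0" "w z = 1" using w.uniformizer_exists by blast
    obtain fz where fz: "degree fz < N" "z = ev fz y" using rep[of z] unfolding degree_M by blast
    then have "fz \<noteq> 0" using z by (auto simp: ev_simps)
    from main[OF this fz(1)] have "int N = e * Min (\<nu> fz ` {i. coeff fz i \<noteq> 0})" using fz z by simp
    then have d2: "e dvd int N" by (metis dvd_triv_left)
    have "0 \<le> e" using e(1) by simp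
    then show ?thesis by (rule zdvd_antisym_nonneg[OF _ of_nat_0_le_iff d2 d1])
  qed
  then show ?thesis using main[OF f] N_pos unfolding w_def \<nu>_def by simp
qed

text \<open>
  The formula for the valuation depends on \<open>P\<close> alone.
\<close>
lemma ramified_unique:
  assumes V: "above V P" and W: "above W P" and h: "vx P h < 0"
  shows "V = W"
proof -
  have "ev f y \<in> V \<longleftrightarrow> ev f y \<in> W" if f: "degree f < N" for f
  proof (cases "f = 0")
    case True
    have "0 \<in> V" "0 \<in> W" using above_discrete(2)[OF V] above_discrete(2)[OF W] by blast+
    then show ?thesis using True by (simp add: ev_simps)
  next
    case False
    note rv = ramified_valuation[OF V h False f] and rw = ramified_valuation[OF W h False f]
    have "ev f y \<in> V \<longleftrightarrow> 0 \<le> vy V (ev f y)"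
      using above_discrete(2)[OF V] rv by blast
    moreover have "ev f y \<in> W \<longleftrightarrow> 0 \<le> vy W (ev f y)"
      using above_discrete(2)[OF W] rw by blast
    ultimately show ?thesis using rv rw by simp
  qed
  then have "z \<in> V \<longleftrightarrow> z \<in> W" for z using rep[of z] unfolding degree_M by blast
  then show ?thesis by blast
qed

lemma independent:
  assumes "degree f < N" "ev f y = 0" shows "f = 0"
proof -
  obtain P where P: "place K_x P" "vx P h < 0" using pole_exists by blast
  obtain V where "above V P" using above_exists[OF P(1)] by blast
  from ramified_valuation[OF this P(2)] assms show ?thesis by blast
qed

text \<open>
  This makes the automorphism \<open>y \<mapsto> y + \<kappa> b\<close> over \<open>K(x)\<close> well defined on expressions \<open>ev f y\<close>. A
  polynomial vanishing at \<open>y\<close> is a multiple of \<open>M\<close> by independence, and \<open>M\<close> vanishes at \<open>y + \<kappa> b\<close>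
  by translation invariance of \<open>L\<close>.
\<close>
lemma root_shift:
  assumes b: "poly L b = 0" and f: "ev f y = 0" shows "ev f (y + \<kappa> b) = 0"
proof -
  have M0: "M \<noteq> 0" using degree_M N_pos by auto
  have fe: "f = f div M * M + f mod M" by (rule div_mult_mod_eq[symmetric])
  then have "ev f y = ev (f div M) y * ev M y + ev (f mod M) y" by (metis ev_simps(1,4))
  then have "ev (f mod M) y = 0" using f M_root by simp
  moreover have "degree (f mod M) < N" using degree_mod_less[OF M0, of f] degree_M N_pos by auto
  ultimately have "f mod M = 0" by (intro independent)
  then have "ev f (y + \<kappa> b) = ev (f div M) (y + \<kappa> b) * ev M (y + \<kappa> b)"
    using fe ev_simps(4) by (metis add.right_neutral)
  moreover have "ev M (y + \<kappa> b) = ev M y"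
    using shift[OF b, of y] unfolding ev_M const_ev by (simp add: \<kappa>_def)
  ultimately show ?thesis using M_root by simp
qed

text \<open>
  The set is the preimage of \<open>V\<close> under that automorphism.
\<close>
lemma translate_above:
  assumes ab: "above V P" and b: "poly L b = 0"
  shows "above {z. \<exists>f. z = ev f y \<and> ev f (y + \<kappa> b) \<in> V} P"
proof -
  define W where "W = {z. \<exists>f. z = ev f y \<and> ev f (y + \<kappa> b) \<in> V}"
  have V: "valuation_ring K' V" and P: "place K_x P" using ab unfolding above_def by auto
  note VV = valuation_ringD[OF V] note C = is_subringD[OF VV(1)]
  have W: "ev f y \<in> W \<longleftrightarrow> ev f (y + \<kappa> b) \<in> V" for f
  proof
    assume "ev f y \<in> W"
    then obtain g where g: "ev f y = ev g y" "ev g (y + \<kappa> b) \<in> V" unfolding W_def by blast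
    then have "ev (f - g) (y + \<kappa> b) = 0" by (intro root_shift[OF b]) (simp add: ev_simps)
    then show "ev f (y + \<kappa> b) \<in> V" using g by (simp add: ev_simps)
  qed (auto simp: W_def)
  have "above W P"
  proof (rule aboveI[OF _ _ P])
    show "is_subring W" unfolding is_subring_def
    proof (intro conjI ballI)
      show "1 \<in> W" using W[of 1] C by (simp add: ev_simps)
      fix x assume x: "x \<in> W"
      obtain f where f: "x = ev f y" using rep by blast
      show "- x \<in> W" using W[of f] W[of "- f"] C x f by (simp add: ev_simps)
      fix z assume z: "z \<in> W"
      obtain g where g: "z = ev g y" using rep by blast
      show "x + z \<in> W" using W[of f] W[of g] W[of "f + g"] C x z f g by (simp add: ev_simps)
      show "x * z \<in> W" using W[of f] W[of g] W[of "f * g"] C x z f g by (simp add: ev_simps)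
    qed
    show "z \<in> W \<or> inverse z \<in> W" for z
    proof (cases "z = 0")
      case True
      then show ?thesis using W[of 0] C by (simp add: ev_simps)
    next
      case False
      obtain f where f: "z = ev f y" using rep by blast
      obtain g where g: "inverse z = ev g y" using rep by blast
      have "ev (f * g - 1) y = 0" using False by (simp add: ev_simps flip: f g)
      then have "ev (f * g - 1) (y + \<kappa> b) = 0" by (rule root_shift[OF b])
      then have "ev f (y + \<kappa> b) * ev g (y + \<kappa> b) = 1" by (simp add: ev_simps)
      then have "ev g (y + \<kappa> b) = inverse (ev f (y + \<kappa> b))" by (metis inverse_unique)
      then show ?thesis using VV(3)[of "ev f (y + \<kappa> b)"] W[of f] W[of g] f g by auto
    qed
    show "\<phi> c \<in> W \<longleftrightarrow> 0 \<le> vx P c" if "c \<noteq> 0" for c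
      using W[of "[:c:]"] ab that unfolding above_def by (simp add: ev_simps)
  qed
  then show ?thesis unfolding W_def .
qed

text \<open>
  Fix one \<open>V\<close> above \<open>P\<close>. By \<open>translate_above\<close> the values of \<open>f\<close> at the \<open>N\<close> points \<open>y + \<kappa> b\<close> lie in
  \<open>V\<close>. So do the coefficients of the Lagrange polynomials \<open>e b\<close> at these points, since their
  denominators are differences of constants. As \<open>f\<close> has degree less than \<open>N\<close>, it equals its
  interpolation polynomial \<open>G\<close>.
\<close>
lemma unramified_coeffs:
  assumes P: "place K_x P" and h: "0 \<le> vx P h" and f: "degree f < N"
    and int: "\<And>V. above V P \<Longrightarrow> ev f y \<in> V" and i: "coeff f i \<noteq> 0"
  shows "0 \<le> vx P (coeff f i)"
proof -
  obtain V where ab: "above V P" using above_exists[OF P] by blast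
  then have V: "valuation_ring K' V" unfolding above_def by simp
  note VC = valuation_ringD(1)[OF V] note C = is_subringD[OF VC]
  have yV: "y \<in> V" by (rule y_integral[OF ab h])
  define R where "R = {b. poly L b = 0}"
  have L0: "L \<noteq> 0" using L_pos by auto
  have finR: "finite R" unfolding R_def using poly_roots_finite[OF L0] .
  have cardR: "card R = N" unfolding R_def N_def by (rule roots)
  have val: "ev f (y + \<kappa> b) \<in> V" if "b \<in> R" for b
  proof -
    have b: "poly L b = 0" using that unfolding R_def by simp
    from int[OF translate_above[OF ab b]] obtain g where g: "ev f y = ev g y" "ev g (y + \<kappa> b) \<in> V"
      by blast
    then have "ev (f - g) (y + \<kappa> b) = 0" by (intro root_shift[OF b]) (simp add: ev_simps)
    then show ?thesis using g by (simp add: ev_simps)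
  qed
  define F where "F = map_poly \<phi> f"
  define e where "e b = (\<Prod>b'\<in>R - {b}. smult (inverse (\<kappa> b - \<kappa> b')) [:- (y + \<kappa> b'), 1:])" for b
  define G where "G = (\<Sum>b\<in>R. smult (ev f (y + \<kappa> b)) (e b))"
  have coeff_mult_V: "coeff (p * q) k \<in> V" if "\<And>k. coeff p k \<in> V" "\<And>k. coeff q k \<in> V" for p q k
    unfolding coeff_mult by (intro is_subring_sum[OF VC] C(6) that)
  have coeff_prod_V: "coeff (prod p J) k \<in> V"
    if "\<And>j k. j \<in> J \<Longrightarrow> coeff (p j) k \<in> V" for p :: "'k \<Rightarrow> 'f poly" and J k
    using that
  proof (induction J arbitrary: k rule: infinite_finite_induct)
    case (insert x J)
    then show ?case by (simp add: coeff_mult_V)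
  qed (use C in \<open>auto simp: coeff_1\<close>)
  have eV: "coeff (e b) k \<in> V" for b k unfolding e_def
  proof (rule coeff_prod_V)
    fix b' k assume "b' \<in> R - {b}"
    have "coeff [:- (y + \<kappa> b'), 1:] k \<in> V" using yV kappa_in[OF ab] C
      by (auto simp: coeff_pCons split: nat.splits)
    moreover have "inverse (\<kappa> b - \<kappa> b') \<in> V"
      using kappa_in[OF ab, of "inverse (b - b')"] by (simp add: const.phi_inverse const.phi_diff)
    ultimately show "coeff (smult (inverse (\<kappa> b - \<kappa> b')) [:- (y + \<kappa> b'), 1:]) k \<in> V"
      unfolding coeff_smult by (rule C(6)[rotated])
  qed
  have GV: "coeff G k \<in> V" for k unfolding G_def coeff_sum coeff_smult
    by (intro is_subring_sum[OF VC] C(6) val eV)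
  have e_val: "poly (e b) (y + \<kappa> b') = (if b = b' then 1 else 0)" if "b \<in> R" "b' \<in> R" for b b'
  proof (cases "b = b'")
    case True
    have "poly (smult (inverse (\<kappa> b - \<kappa> b')) [:- (y + \<kappa> b'), 1:]) (y + \<kappa> b) = 1"
      if "b' \<in> R - {b}" for b'
    proof -
      have "\<kappa> b - \<kappa> b' \<noteq> 0" using that by (auto simp: const.phi_inj)
      moreover have "poly [:- (y + \<kappa> b'), 1:] (y + \<kappa> b) = \<kappa> b - \<kappa> b'" by simp
      ultimately show ?thesis unfolding poly_smult by simp
    qed
    then have "poly (e b) (y + \<kappa> b) = (\<Prod>b'\<in>R - {b}. 1)" unfolding e_def poly_prod
      by (intro prod.cong) auto
    then show ?thesis using True by simp
  next
    case False
    then have "poly (e b) (y + \<kappa> b') = 0" unfolding e_def poly_prod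
    proof (intro prod_zero bexI[of _ b'])
      have "poly [:- (y + \<kappa> b'), 1:] (y + \<kappa> b') = 0" by simp
      then show "poly (smult (inverse (\<kappa> b - \<kappa> b')) [:- (y + \<kappa> b'), 1:]) (y + \<kappa> b') = 0"
        unfolding poly_smult by simp
    qed (use finR that False in auto)
    then show ?thesis using False by simp
  qed
  have "F = G"
  proof (rule poly_eqI_degree[of "(\<lambda>b. y + \<kappa> b) ` R"])
    have card: "card ((\<lambda>b. y + \<kappa> b) ` R) = N" unfolding cardR[symmetric]
      by (rule card_image) (auto intro!: inj_onI simp: const.phi_inj)
    show "degree F < card ((\<lambda>b. y + \<kappa> b) ` R)" unfolding card F_def using f
      by (simp add: degree_map_poly)
    have "degree (e b) \<le> N - 1" if "b \<in> R" for b
    proof -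
      have "degree (e b) \<le> (\<Sum>b'\<in>R - {b}. degree (smult (inverse (\<kappa> b - \<kappa> b')) [:- (y + \<kappa> b'), 1:]))"
        unfolding e_def by (rule degree_prod_sum_le[OF finite_Diff[OF finR], unfolded comp_def])
      also have "\<dots> \<le> (\<Sum>b'\<in>R - {b}. 1)" by (rule sum_mono) simp
      also have "\<dots> = N - 1" using that finR cardR by simp
      finally show ?thesis .
    qed
    then have "degree G \<le> N - 1" unfolding G_def
      by (intro degree_sum_le finR order.trans[OF degree_smult_le]) auto
    then show "degree G < card ((\<lambda>b. y + \<kappa> b) ` R)" unfolding card using N_pos by linarith
    fix x assume "x \<in> (\<lambda>b. y + \<kappa> b) ` R"
    then obtain b where b: "b \<in> R" "x = y + \<kappa> b" by blast
    have "poly G x = (\<Sum>b'\<in>R. if b' = b then ev f (y + \<kappa> b) else 0)"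
      unfolding G_def poly_sum poly_smult b(2) by (rule sum.cong) (use e_val b in auto)
    also have "\<dots> = poly F x" using finR b unfolding F_def ev_def by simp
    finally show "poly F x = poly G x" by simp
  qed
  then have "\<phi> (coeff f i) \<in> V" using GV[of i] unfolding F_def by (metis coeff_map_poly phi_zero)
  then show ?thesis using ab i unfolding above_def by blast
qed

section \<open>Riemann-Roch spaces of the curve\<close>

text \<open>
  The quantity whose nonnegativity is the condition that a divisor with coefficient \<open>A P\<close> above
  \<open>P\<close> imposes on the coefficient \<open>c\<close> of \<open>y ^ i\<close>. Above a place that is not a pole of \<open>h\<close> the divisor is
  to have coefficient \<open>0\<close>.
\<close>
definition coeff_bound where "coeff_bound A P i c =
  (if vx P h < 0 then int N * vx P c + int i * vx P h + A P else vx P c)"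

lemma riemann_roch_iff:
  fixes D :: "'f set \<Rightarrow>\<^sub>0 int" and A :: "'k poly fract set \<Rightarrow> int"
  assumes D: "\<And>V P. above V P \<Longrightarrow> Poly_Mapping.lookup D (nonunits V) = A P"
    and D0: "\<And>Q. \<not> place K' Q \<Longrightarrow> Poly_Mapping.lookup D Q = 0"
    and A0: "\<And>P. place K_x P \<Longrightarrow> 0 \<le> vx P h \<Longrightarrow> A P = 0"
    and f: "f \<noteq> 0" "degree f < N"
  shows "ev f y \<in> riemann_roch_space K' D \<longleftrightarrow>
    (\<forall>P. place K_x P \<longrightarrow> (\<forall>i. coeff f i \<noteq> 0 \<longrightarrow> 0 \<le> coeff_bound A P i (coeff f i)))"
proof -
  have z0: "ev f y \<noteq> 0" using independent f by blast
  have "ev f y \<in> riemann_roch_space K' D \<longleftrightarrow> (\<forall>Q. place K' Q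
    \<longrightarrow> 0 \<le> valuation K' Q (ev f y) + Poly_Mapping.lookup D Q)"
    unfolding riemann_roch_space_def principal_divisor_def using z0 D0 by auto
  also have "\<dots> \<longleftrightarrow> (\<forall>V P. above V P \<longrightarrow> 0 \<le> vy V (ev f y) + A P)"
  proof (intro iffI allI impI)
    fix V P assume *: "\<forall>Q. place K' Q
      \<longrightarrow> 0 \<le> valuation K' Q (ev f y) + Poly_Mapping.lookup D Q" "above V P"
    then have "place K' (nonunits V)" unfolding place_iff above_def by blast
    then show "0 \<le> vy V (ev f y) + A P" using *(1) D[OF *(2)] by fastforce
  next
    fix Q assume *: "\<forall>V P. above V P \<longrightarrow> 0 \<le> vy V (ev f y) + A P" "place K' Q"
    then obtain V where V: "valuation_ring K' V" "Q = nonunits V" unfolding place_iff by blast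
    obtain P where "above V P" using above_restriction[OF V(1)] by blast
    then show "0 \<le> valuation K' Q (ev f y) + Poly_Mapping.lookup D Q" using *(1) D V(2) by simp
  qed
  also have "\<dots> \<longleftrightarrow> (\<forall>P. place K_x P \<longrightarrow> (\<forall>V. above V P \<longrightarrow> 0 \<le> vy V (ev f y) + A P))"
    unfolding above_def by blast
  also have "\<dots> \<longleftrightarrow> (\<forall>P. place K_x P \<longrightarrow> (\<forall>i. coeff f i \<noteq> 0 \<longrightarrow> 0 \<le> coeff_bound A P i (coeff f i)))"
  proof -
    have "(\<forall>V. above V P \<longrightarrow> 0 \<le> vy V (ev f y) + A P)
      \<longleftrightarrow> (\<forall>i. coeff f i \<noteq> 0 \<longrightarrow> 0 \<le> coeff_bound A P i (coeff f i))" if P: "place K_x P" for P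
    proof (cases "vx P h < 0")
      case True
      define I where "I = {i. coeff f i \<noteq> 0}"
      have fin: "finite I" unfolding I_def
        by (rule finite_subset[of _ "{..degree f}"]) (auto intro: le_degree)
      have ne: "I \<noteq> {}" unfolding I_def using f leading_coeff_0_iff by blast
      have "0 \<le> vy V (ev f y) + A P
        \<longleftrightarrow> (\<forall>i. coeff f i \<noteq> 0 \<longrightarrow> 0 \<le> coeff_bound A P i (coeff f i))" if ab: "above V P" for V
      proof -
        have "vy V (ev f y) = Min ((\<lambda>i. int N * vx P (coeff f i) + int i * vx P h) ` I)"
          using ramified_valuation[OF ab True f] unfolding I_def by simp
        then have "0 \<le> vy V (ev f y) + A P
          \<longleftrightarrow> - A P \<le> Min ((\<lambda>i. int N * vx P (coeff f i) + int i * vx P h) ` I)" by linarith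
        also have "\<dots> \<longleftrightarrow> (\<forall>i\<in>I. - A P \<le> int N * vx P (coeff f i) + int i * vx P h)"
          using fin ne by (subst Min_ge_iff) auto
        also have "\<dots> \<longleftrightarrow> (\<forall>i. coeff f i \<noteq> 0 \<longrightarrow> 0 \<le> coeff_bound A P i (coeff f i))"
          unfolding coeff_bound_def I_def using True by (auto simp: algebra_simps)
        finally show ?thesis .
      qed
      then show ?thesis using above_exists[OF P] by blast
    next
      case False
      then have h: "0 \<le> vx P h" by simp
      have mem: "0 \<le> vy V (ev f y) + A P \<longleftrightarrow> ev f y \<in> V" if "above V P" for V
        using above_discrete(2)[OF that] z0 A0[OF P h] by auto
      show ?thesis
      proof
        assume "\<forall>V. above V P \<longrightarrow> 0 \<le> vy V (ev f y) + A P"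
        then have "\<And>V. above V P \<Longrightarrow> ev f y \<in> V" using mem by blast
        from unramified_coeffs[OF P h f(2) this]
        show "\<forall>i. coeff f i \<noteq> 0 \<longrightarrow> 0 \<le> coeff_bound A P i (coeff f i)"
          unfolding coeff_bound_def using False by simp
      next
        assume c: "\<forall>i. coeff f i \<noteq> 0 \<longrightarrow> 0 \<le> coeff_bound A P i (coeff f i)"
        have "ev f y \<in> V" if ab: "above V P" for V
        proof -
          have VC: "is_subring V" using ab valuation_ringD(1) unfolding above_def by blast
          have "\<phi> (coeff f i) \<in> V" for i
            using c ab False is_subringD(2)[OF VC] unfolding above_def coeff_bound_def
            by (cases "coeff f i = 0") auto
          then show ?thesis unfolding ev_def
            by (intro is_subring_poly[OF VC]) (auto simp: coeff_map_poly y_integral[OF ab h])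
        qed
        then show "\<forall>V. above V P \<longrightarrow> 0 \<le> vy V (ev f y) + A P" using mem by blast
      qed
    qed
    then show ?thesis by (intro iff_allI imp_cong refl)
  qed
  finally show ?thesis .
qed

text \<open>
  An element lost by lowering the coefficient above \<open>P0\<close> has a term with \<open>coeff_bound\<close> zero at \<open>P0\<close>.
  By the divisibility hypothesis \<open>N\<close> divides \<open>(t - i) v(h)\<close> for the exponent \<open>i\<close> of \<open>y\<close> in that term,
  so \<open>i = t\<close>. Conversely \<open>c y ^ t\<close> is lost whenever \<open>c\<close> is as on the right. Integer division turns the
  inequality for \<open>N v(c)\<close> into one for \<open>v(c)\<close>, and is exact at \<open>P0\<close>.
\<close>
lemma riemann_roch_drop_iff:
  fixes D D' :: "'f set \<Rightarrow>\<^sub>0 int" and A :: "'k poly fract set \<Rightarrow> int"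
  assumes D: "\<And>V P. above V P \<Longrightarrow> Poly_Mapping.lookup D (nonunits V) = A P"
    and D': "\<And>V P. above V P
      \<Longrightarrow> Poly_Mapping.lookup D' (nonunits V) = A P - (if P = P0 then 1 else 0)"
    and D0: "\<And>Q. \<not> place K' Q \<Longrightarrow> Poly_Mapping.lookup D Q = 0"
    and D'0: "\<And>Q. \<not> place K' Q \<Longrightarrow> Poly_Mapping.lookup D' Q = 0"
    and A0: "\<And>P. place K_x P \<Longrightarrow> 0 \<le> vx P h \<Longrightarrow> A P = 0"
    and P0: "place K_x P0" "vx P0 h < 0"
    and t: "t < N" "int N dvd A P0 + int t * vx P0 h"
  shows "riemann_roch_space K' D = riemann_roch_space K' D' \<longleftrightarrow>
    \<not> (\<exists>c. c \<noteq> 0 \<and> (\<forall>P. place K_x P \<longrightarrow>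
          0 \<le> vx P c + (if vx P h < 0 then (A P + int t * vx P h) div int N else 0))
        \<and> vx P0 c + (A P0 + int t * vx P0 h) div int N = 0)"
    (is "_ \<longleftrightarrow> \<not> (\<exists>c. ?Q c)")
proof -
  define A' where "A' P = A P - (if P = P0 then 1 else 0)" for P
  have A'0: "A' P = 0" if "place K_x P" "0 \<le> vx P h" for P
    using A0[OF that] P0 that unfolding A'_def by auto
  have mem: "ev f y \<in> riemann_roch_space K' D \<longleftrightarrow>
      (\<forall>P. place K_x P \<longrightarrow> (\<forall>i. coeff f i \<noteq> 0 \<longrightarrow> 0 \<le> coeff_bound A P i (coeff f i)))"
    if "f \<noteq> 0" "degree f < N" for f
    by (rule riemann_roch_iff) (erule D D0 | erule (1) A0 | rule that)+
  have mem': "ev f y \<in> riemann_roch_space K' D' \<longleftrightarrow>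
      (\<forall>P. place K_x P \<longrightarrow> (\<forall>i. coeff f i \<noteq> 0 \<longrightarrow> 0 \<le> coeff_bound A' P i (coeff f i)))"
    if "f \<noteq> 0" "degree f < N" for f
    by (rule riemann_roch_iff) (erule D'[folded A'_def] D'0 | erule (1) A'0 | rule that)+
  have bound: "0 \<le> coeff_bound A P t c
    \<longleftrightarrow> 0 \<le> vx P c + (if vx P h < 0 then (A P + int t * vx P h) div int N else 0)" for P c
  proof (cases "vx P h < 0")
    case True
    have "0 \<le> int N * vx P c + int t * vx P h + A P \<longleftrightarrow> - vx P c * int N \<le> A P + int t * vx P h"
      by (simp add: algebra_simps) linarith
    also have "\<dots> \<longleftrightarrow> - vx P c \<le> (A P + int t * vx P h) div int N"
      using N_pos by (simp add: le_div_iff_mult_le)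
    finally show ?thesis using True unfolding coeff_bound_def by auto
  qed (simp add: coeff_bound_def)
  have exact: "coeff_bound A P0 t c = 0 \<longleftrightarrow> vx P0 c + (A P0 + int t * vx P0 h) div int N = 0" for c
  proof -
    obtain k where k: "A P0 + int t * vx P0 h = int N * k" using t(2) by blast
    have "coeff_bound A P0 t c = int N * (vx P0 c + k)"
      unfolding coeff_bound_def using P0 k by (simp add: algebra_simps)
    then show ?thesis using N_pos unfolding k by simp
  qed
  have less: "coeff_bound A' P i c \<le> coeff_bound A P i c" for P i c
    unfolding coeff_bound_def A'_def by simp
  have sub: "riemann_roch_space K' D' \<subseteq> riemann_roch_space K' D"
  proof
    fix z assume z: "z \<in> riemann_roch_space K' D'"
    obtain f where f: "degree f < N" "z = ev f y" using rep[of z] unfolding degree_M by blast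
    show "z \<in> riemann_roch_space K' D"
    proof (cases "f = 0")
      case True
      then show ?thesis unfolding f riemann_roch_space_def by (simp add: ev_simps)
    next
      case False
      then show ?thesis using z mem[OF False f(1)] mem'[OF False f(1)] less order_trans
        unfolding f(2) by blast
    qed
  qed
  have "riemann_roch_space K' D = riemann_roch_space K' D' \<longleftrightarrow> \<not> (\<exists>z. z \<in> riemann_roch_space K' D
    \<and> z \<notin> riemann_roch_space K' D')"
    using sub by blast
  moreover have "(\<exists>z. z \<in> riemann_roch_space K' D \<and> z \<notin> riemann_roch_space K' D') \<longleftrightarrow> (\<exists>c. ?Q c)"
  proof
    assume "\<exists>z. z \<in> riemann_roch_space K' D \<and> z \<notin> riemann_roch_space K' D'"
    then obtain z where z: "z \<in> riemann_roch_space K' D" "z \<notin> riemann_roch_space K' D'" by blast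
    obtain f where f: "degree f < N" "z = ev f y" using rep[of z] unfolding degree_M by blast
    have f0: "f \<noteq> 0" using z(2) unfolding f riemann_roch_space_def by (auto simp: ev_simps)
    have all: "\<And>P i. place K_x P \<Longrightarrow> coeff f i \<noteq> 0 \<Longrightarrow> 0 \<le> coeff_bound A P i (coeff f i)"
      using z(1) mem[OF f0 f(1)] unfolding f(2) by blast
    obtain P i where Pi: "place K_x P" "coeff f i \<noteq> 0" "coeff_bound A' P i (coeff f i) < 0"
      using z(2) mem'[OF f0 f(1)] unfolding f(2) by (auto simp: not_le)
    have ge: "0 \<le> coeff_bound A P i (coeff f i)" using all Pi by blast
    then have PP: "P = P0" using Pi(3) unfolding coeff_bound_def A'_def by (auto split: if_splits)
    have zero: "coeff_bound A P0 i (coeff f i) = 0"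
      using ge Pi(3) P0 unfolding PP coeff_bound_def A'_def by simp
    have "i < N" using le_degree[OF Pi(2)] f(1) by simp
    obtain k where k: "A P0 + int t * vx P0 h = int N * k" using t(2) by blast
    have "(int t - int i) * vx P0 h = int N * (k + vx P0 (coeff f i))"
      using zero k P0 unfolding coeff_bound_def by (simp add: algebra_simps)
    then have "int N dvd (int t - int i) * vx P0 h" by simp
    then have "int N dvd int t - int i" using pole_order_coprime[OF P0] coprime_dvd_mult_left_iff
      unfolding N_def by (metis coprime_commute)
    moreover have "\<bar>int t - int i\<bar> < int N" using \<open>i < N\<close> t(1) by auto
    ultimately have ti: "t = i" using zdvd_not_zless[of "\<bar>int t - int i\<bar>" "int N"] by fastforce
    have "0 \<le> vx R (coeff f i) + (if vx R h < 0 then (A R + int t * vx R h) div int N else 0)"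
      if "place K_x R" for R
      using all[OF that Pi(2)] unfolding ti[symmetric] bound .
    moreover have "vx P0 (coeff f i) + (A P0 + int t * vx P0 h) div int N = 0"
      using zero unfolding ti[symmetric] exact .
    ultimately have "?Q (coeff f i)" using Pi(2) by blast
    then show "\<exists>c. ?Q c" by blast
  next
    assume "\<exists>c. ?Q c"
    then obtain c where c: "?Q c" by blast
    define f where "f = Polynomial.monom c t"
    have f: "f \<noteq> 0" "degree f < N" unfolding f_def using c t by (auto simp: degree_monom_eq)
    have cf: "coeff f i \<noteq> 0 \<longleftrightarrow> i = t" "coeff f t = c" for i unfolding f_def using c by auto
    have "ev f y \<in> riemann_roch_space K' D" unfolding mem[OF f] using c bound cf by metis
    moreover have "coeff_bound A' P0 t c < 0"
    proof -
      have "coeff_bound A P0 t c = 0" using exact c by blast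
      then show ?thesis using P0(2) unfolding coeff_bound_def A'_def by simp
    qed
    then have "ev f y \<notin> riemann_roch_space K' D'" unfolding mem'[OF f] using P0(1) cf c
      by (metis not_le)
    ultimately show "\<exists>z. z \<in> riemann_roch_space K' D \<and> z \<notin> riemann_roch_space K' D'" by blast
  qed
  ultimately show ?thesis by blast
qed

end

section \<open>Linearized polynomials and the criterion\<close>

lemma (in field_embedding) ev_phi: "ev f (\<phi> b) = \<phi> (poly f b)"
  by (induction f) (simp_all add: ev_simps phi_add phi_mult)

lemma (in field_embedding) phi_of_nat: "\<phi> (of_nat n) = of_nat n"
  by (induction n) (simp_all add: phi_add)

lemma CHAR_eq_prime:
  assumes "Factorial_Ring.prime p" and "of_nat p = (0 :: 'a::field)" shows "CHAR('a) = p"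
proof -
  have "CHAR('a) dvd p" using assms(2) by (simp add: of_nat_eq_0_iff_char_dvd)
  then show ?thesis using assms(1) by (auto simp: prime_nat_iff)
qed

lemma CHAR_finite_field:
  assumes p: "Factorial_Ring.prime p" and card: "card (UNIV :: 'k::{field,finite} set) = p ^ n"
  shows "CHAR('k) = p"
proof -
  have "0 < CHAR('k)" by (rule finite_imp_CHAR_pos) simp
  then have pr: "Factorial_Ring.prime CHAR('k)" by (rule prime_CHAR_semidom)
  moreover have "CHAR('k) dvd p ^ n" using CHAR_dvd_CARD[where ?'a = 'k] unfolding card .
  ultimately have "CHAR('k) dvd p" by (rule prime_dvd_power)
  then show ?thesis using p pr by (metis primes_dvd_imp_eq)
qed

context
  fixes p e q m :: nat and a :: "nat \<Rightarrow> 'k::field"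
  assumes p: "Factorial_Ring.prime p" and char: "CHAR('k) = p" and e: "0 < e" and q: "q = p ^ e"
begin

lemma q_gt_1: "1 < q"
  unfolding q using prime_gt_1_nat[OF p] e by (rule one_less_power)

lemma coeff_linearized: "coeff (linearized_poly q m a) i = (\<Sum>k\<le>m. if q ^ k = i then a k else 0)"
  unfolding linearized_poly_def by (simp add: coeff_sum)

lemma degree_linearized:
  assumes "a m \<noteq> 0" shows "degree (linearized_poly q m a) = q ^ m"
proof (rule antisym)
  show "degree (linearized_poly q m a) \<le> q ^ m" unfolding linearized_poly_def
  proof (rule degree_sum_le)
    fix k assume "k \<in> {..m}"
    then have "q ^ k \<le> q ^ m" using q_gt_1 by (intro power_increasing) auto
    then show "degree (Polynomial.monom (a k) (q ^ k)) \<le> q ^ m"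
      by (rule order.trans[OF degree_monom_le])
  qed simp
  have "coeff (linearized_poly q m a) (q ^ m) = (\<Sum>k\<le>m. if k = m then a m else 0)"
    unfolding coeff_linearized by (rule sum.cong) (use q_gt_1 in auto)
  then show "q ^ m \<le> degree (linearized_poly q m a)" using assms by (intro le_degree) simp
qed

text \<open>
  Only the exponent \<open>q ^ 0 = 1\<close> is nonzero in characteristic \<open>p\<close>. With \<open>a 0 \<noteq> 0\<close> this makes the roots
  simple.
\<close>
lemma pderiv_linearized: "pderiv (linearized_poly q m a) = [:a 0:]"
proof (rule poly_eqI)
  fix n
  have 0: "of_nat (q ^ k) = (0 :: 'k)" if "0 < k" for k
    using that e unfolding q char[symmetric] by (simp add: zero_power flip: power_mult)
  have "of_nat (Suc n) * (if q ^ k = Suc n then a k else 0) = (if k = 0 then if n = 0 then a 0 else 0 else 0)" for k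
  proof (cases "k = 0")
    case False
    then show ?thesis using 0[of k] by (metis mult_zero_left mult_zero_right neq0_conv)
  qed auto
  then have "coeff (pderiv (linearized_poly q m a)) n
      = (\<Sum>k\<le>m. if k = 0 then if n = 0 then a 0 else 0 else 0)"
    unfolding coeff_pderiv coeff_linearized sum_distrib_left by simp
  also have "\<dots> = coeff [:a 0:] n" by (simp add: coeff_pCons split: nat.splits)
  finally show "coeff (pderiv (linearized_poly q m a)) n = coeff [:a 0:] n" .
qed

lemma linearized_shift:
  assumes emb: "field_embedding (\<kappa> :: 'k \<Rightarrow> 'f::field)" and b: "poly (linearized_poly q m a) b = 0"
  shows "poly (map_poly \<kappa> (linearized_poly q m a)) (z + \<kappa> b) = poly (map_poly \<kappa> (linearized_poly q m a)) z"
proof -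
  interpret field_embedding \<kappa> by fact
  have "of_nat p = (0 :: 'f)" using phi_of_nat[of p] of_nat_CHAR[where ?'a = 'k] char by simp
  then have cf: "CHAR('f) = p" using p by (rule CHAR_eq_prime[rotated])
  have ev: "ev (linearized_poly q m a) x = (\<Sum>k\<le>m. \<kappa> (a k) * x ^ q ^ k)" for x
    unfolding linearized_poly_def ev_sum ev_simps ..
  have fd: "(x + x') ^ q ^ k = x ^ q ^ k + x' ^ q ^ k" for x x' :: 'f and k
    by (rule freshmans_dream'[where n = "e * k"]) (use p cf in \<open>simp_all add: q power_mult\<close>)
  have "ev (linearized_poly q m a) (z + \<kappa> b) = ev (linearized_poly q m a) z + ev (linearized_poly q m a) (\<kappa> b)"
    unfolding ev fd by (simp add: algebra_simps sum.distrib)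
  moreover have "ev (linearized_poly q m a) (\<kappa> b) = 0" unfolding ev_phi b by simp
  ultimately show ?thesis unfolding ev_def by simp
qed

end

theorem theorem3p2:
  fixes p e q s m u r n j t :: nat
    and a :: "nat \<Rightarrow> 'k::{field, finite}"
    and L :: "'k poly"
    and h :: "'k poly fract"
    and T P :: "nat \<Rightarrow> 'k poly fract set"
    and \<gamma> lam :: "nat \<Rightarrow> nat"
    and \<phi> :: "'k poly fract \<Rightarrow> 'f::field"
    and y :: 'f
    and Q :: "nat \<Rightarrow> 'f set"
    and \<alpha> :: "nat \<Rightarrow> int"
    and K :: "'k poly fract set" and K' :: "'f set"
    and D :: "'f set \<Rightarrow>\<^sub>0 int"
  assumes "0 < m" and "m \<le> s"
    and "Factorial_Ring.prime p" and "0 < e" and "q = p ^ e"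
    and "card (UNIV :: 'k set) = q ^ s"
    and "L = linearized_poly q m a"
    and "a m \<noteq> 0" and "a 0 \<noteq> 0"
    and "\<forall>z :: 'k alg_closure. poly (map_poly to_ac L) z = 0 \<longrightarrow> z \<in> range to_ac"
    and "K = range const_fract"
    and "h \<noteq> 0"
    and "\<forall>i\<in>{1..u}. place K (T i) \<and> 0 < \<gamma> i"
    and "\<forall>k\<in>{1..r}. place K (P k) \<and> 0 < lam k \<and> \<not> p dvd lam k"
    and "inj_on T {1..u}" and "inj_on P {1..r}" and "T ` {1..u} \<inter> P ` {1..r} = {}"
    and "principal_divisor K h =
           Poly_Mapping.lookup ((\<Sum>i = 1..u. Poly_Mapping.single (T i) (int (\<gamma> i)))
                 - (\<Sum>k = 1..r. Poly_Mapping.single (P k) (int (lam k))))"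
    and "curve_function_field L h \<phi> y"
    and "K' = \<phi> ` K"
    and "1 \<le> n" and "n \<le> r"
    and "\<forall>k\<in>{1..n}. place K' (Q k) \<and> lies_over \<phi> (Q k) (P k)"
    and "D = (\<Sum>k = 1..n. Poly_Mapping.single (Q k) (\<alpha> k))"
    and "1 \<le> j" and "j \<le> n"
    and "t \<in> {0..q ^ m - 1}" and "[\<alpha> j - int t * int (lam j) = 0] (mod int (q ^ m))"
  shows "riemann_roch_space K' D = riemann_roch_space K' (D - Poly_Mapping.single (Q j) 1) \<longleftrightarrow>
    (\<Sum>k = 1..n. \<lfloor>real_of_int (\<alpha> k - int t * int (lam k)) / real (q ^ m)\<rfloor>
                   * int (place_degree K (P k)))
    < (\<Sum>k = n+1..r. \<lceil>real (t * lam k) / real (q ^ m)\<rceil> * int (place_degree K (P k)))"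
proof -
  note p = assms(3) and e = assms(4) and q = assms(5) and L = assms(7) and K = assms(11) and K' = assms(20)
  have char: "CHAR('k) = p"
    by (rule CHAR_finite_field[OF p, of "e * s"]) (use assms(6) q in \<open>simp add: power_mult\<close>)
  define N where "N = q ^ m"
  have degL: "degree L = N" unfolding L N_def    
    by (rule degree_linearized[where a = a and m = m, OF p char e q assms(8)])
  have q1: "1 < q" by (rule q_gt_1[where 'k = 'k, OF p char e q])
  have N0: "0 < N" unfolding N_def using q1 by simp
  have Pk: "place K_x (P k)" "0 < lam k" "\<not> p dvd lam k" if "k \<in> {1..r}" for k
    using assms(14) that unfolding K by auto
  have lookup_sum: "Poly_Mapping.lookup (\<Sum>i\<in>I. Poly_Mapping.single (f i) (g i :: int)) x
      = (\<Sum>i\<in>I. if f i = x then g i else 0)" for f :: "nat \<Rightarrow> 'x" and g I x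
    by (induction I rule: infinite_finite_induct) (auto simp: lookup_add lookup_single when_def)
  have vh: "valuation K_x R h = (\<Sum>i = 1..u. if T i = R then int (\<gamma> i) else 0) - (\<Sum>k = 1..r. if P k = R then int (lam k) else 0)"
    if "place K_x R" for R
    using fun_cong[OF assms(18), of R] that unfolding K principal_divisor_def
    by (simp add: lookup_minus lookup_sum)
  have vhP: "valuation K_x (P k) h = - int (lam k)" if k: "k \<in> {1..r}" for k
  proof -
    have "(\<Sum>i = 1..u. if T i = P k then int (\<gamma> i) else 0) = 0"
      by (rule sum.neutral) (use assms(17) k in auto)
    moreover have "(\<Sum>l = 1..r. if P l = P k then int (lam l) else 0) = (\<Sum>l = 1..r. if l = k then int (lam k) else 0)"
      by (rule sum.cong) (use inj_onD[OF assms(16) _ _ k] in auto)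
    ultimately show ?thesis using vh[OF Pk(1)[OF k]] k by simp
  qed
  have vhneg: "R \<in> P ` {1..r}" if R: "place K_x R" "valuation K_x R h < 0" for R
  proof (rule ccontr)
    assume "R \<notin> P ` {1..r}"
    then have "(\<Sum>k = 1..r. if P k = R then int (lam k) else 0) = 0" by (intro sum.neutral) auto
    moreover have "0 \<le> (\<Sum>i = 1..u. if T i = R then int (\<gamma> i) else 0)" by (intro sum_nonneg) auto
    ultimately show False using vh[OF R(1)] R(2) by simp
  qed
  have emb: "field_embedding \<phi>"
  proof
    have "\<phi> \<in> ring_hom ring_of_type_algebra ring_of_type_algebra"
      using assms(19) unfolding curve_function_field_def by blast
    from ring_hom_one[OF this] ring_hom_add[OF this] ring_hom_mult[OF this]
    show "\<phi> 1 = 1" "\<And>a b. \<phi> (a + b) = \<phi> a + \<phi> b" "\<And>a b. \<phi> (a * b) = \<phi> a * \<phi> b" by simp_all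
  qed
  then interpret emb: field_embedding \<phi> .
  have kap: "field_embedding (\<phi> \<circ> const_fract)"
    by unfold_locales (simp_all add: emb.phi_add emb.phi_mult)
  interpret C: additive_curve \<phi> L h y
  proof
    show "0 < degree L" unfolding degL by (rule N0)
    show "curve_function_field L h \<phi> y" by (rule assms(19))
    show "poly (map_poly (\<phi> \<circ> const_fract) L) (z + \<phi> (const_fract b)) = poly (map_poly (\<phi> \<circ> const_fract) L) z"
      if "poly L b = 0" for b z
      using linearized_shift[where m = m and a = a, OF p char e q kap, of b z] that unfolding L
        by simp
    show "card {b. poly L b = 0} = degree L"
    proof (rule card_roots_separable)
      show "L \<noteq> 0" using degL N0 by auto
      show "pderiv L = [:a 0:]" unfolding L by (rule pderiv_linearized[OF p char e q])
      show "a 0 \<noteq> 0" by (rule assms(9))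
      show "\<And>z. poly (map_poly to_ac L) z = 0 \<Longrightarrow> z \<in> range to_ac" using assms(10) by blast
    qed
    have "1 \<in> {1..r}" using assms(21,22) by simp
    then show "\<exists>P. place K_x P \<and> valuation K_x P h < 0"
      using Pk(1,2) vhP by (intro exI[of _ "P 1"]) auto
    show "coprime (valuation K_x R h) (int (degree L))"
      if R: "place K_x R" "valuation K_x R h < 0" for R
    proof -
      obtain k where k: "k \<in> {1..r}" "R = P k" using vhneg[OF R] by blast
      have "coprime (lam k) p" using p Pk(3)[OF k(1)] by (metis coprime_commute prime_imp_coprime)
      then have "coprime (lam k) N" unfolding N_def q by simp
      then show ?thesis unfolding k(2) vhP[OF k(1)] degL by simp
    qed
    show "h \<noteq> 0" by (rule assms(12))
  qed
  have CN: "C.N = N" unfolding C.N_def degL ..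
  have K'eq: "K' = \<phi> ` K_x" unfolding K' K ..
  \<comment> \<open>the coefficient of \<open>D\<close> at the places above \<open>R\<close>\<close>
  define A where "A R = (\<Sum>k = 1..n. if P k = R then \<alpha> k else 0)" for R
  have AP: "A (P k) = (if k \<le> n then \<alpha> k else 0)" if k: "k \<in> {1..r}" for k
  proof -
    have "A (P k) = (\<Sum>l = 1..n. if l = k then \<alpha> k else 0)" unfolding A_def
      by (rule sum.cong) (use inj_onD[OF assms(16) _ _ k] assms(22) in auto)
    then show ?thesis using k by simp
  qed
  have Qk: "\<exists>V. C.above V (P k) \<and> Q k = nonunits V" if k: "k \<in> {1..n}" for k
  proof -
    have "place K' (Q k)" "lies_over \<phi> (Q k) (P k)" using assms(23) k by auto
    then obtain V
      where V: "valuation_ring (\<phi> ` K_x) V" "Q k = nonunits V" "lies_over \<phi> (nonunits V) (P k)"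
      unfolding place_iff K'eq by auto
    moreover have "place K_x (P k)" using Pk k assms(22) by auto
    ultimately have "C.above V (P k)" by (intro C.lies_over_imp_above)
    then show ?thesis using V(2) by blast
  qed
  have Q_iff: "Q k = nonunits V \<longleftrightarrow> P k = R" if k: "k \<in> {1..n}" and V: "C.above V R" for k V R
  proof -
    obtain W where W: "C.above W (P k)" "Q k = nonunits W" using Qk[OF k] by blast
    have kr: "k \<in> {1..r}" using k assms(22) by auto
    have vr: "valuation_ring (\<phi> ` K_x) V" "valuation_ring (\<phi> ` K_x) W" using V W
      unfolding C.above_def by auto
    show ?thesis
    proof
      assume "Q k = nonunits V"
      then have "V = W"
        using W(2) valuation_ring_of_nonunits[OF vr(1)] valuation_ring_of_nonunits[OF vr(2)] by simp
      then show "P k = R" using C.above_unique W(1) V by blast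
    next
      assume "P k = R"
      moreover have "valuation K_x (P k) h < 0" using vhP[OF kr] Pk(2)[OF kr] by simp
      ultimately have "V = W" using C.ramified_unique V W(1) by blast
      then show "Q k = nonunits V" using W(2) by simp
    qed
  qed
  define D' where "D' = D - Poly_Mapping.single (Q j) 1"
  have jn: "j \<in> {1..n}" "j \<in> {1..r}" using assms(21,22,25,26) by auto
  have lD: "Poly_Mapping.lookup D x = (\<Sum>k = 1..n. if Q k = x then \<alpha> k else 0)" for x
    unfolding assms(24) by (rule lookup_sum)
  have lD': "Poly_Mapping.lookup D' x = Poly_Mapping.lookup D x - (if Q j = x then 1 else 0)" for x
    unfolding D'_def by (simp add: lookup_minus lookup_single when_def)
  have D_above: "Poly_Mapping.lookup D (nonunits V) = A R" if "C.above V R" for V R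
    unfolding lD A_def by (rule sum.cong) (use Q_iff[OF _ that] in auto)
  have D'_above: "Poly_Mapping.lookup D' (nonunits V) = A R - (if R = P j then 1 else 0)"
    if "C.above V R" for V R
    unfolding lD' D_above[OF that] using Q_iff[OF jn(1) that] by auto
  have D_zero: "Poly_Mapping.lookup D x = 0" if "\<not> place (\<phi> ` K_x) x" for x
    unfolding lD by (rule sum.neutral) (use assms(23) that in \<open>auto simp: K'eq\<close>)
  have D'_zero: "Poly_Mapping.lookup D' x = 0" if "\<not> place (\<phi> ` K_x) x" for x
    unfolding lD' using D_zero[OF that] assms(23) jn that by (auto simp: K'eq)
  have A_zero: "A R = 0" if "place K_x R" "0 \<le> valuation K_x R h" for R
    unfolding A_def
  proof (rule sum.neutral, intro ballI)
    fix k assume "k \<in> {1..n}"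
    then have "k \<in> {1..r}" using assms(22) by auto
    then show "(if P k = R then \<alpha> k else 0) = 0" using vhP[of k] Pk(2)[of k] that by auto
  qed
  have tN: "t < N" using assms(27)[folded N_def] N0 unfolding atLeastAtMost_iff by linarith
  have vj: "valuation K_x (P j) h < 0" using vhP[OF jn(2)] Pk(2)[OF jn(2)] by simp
  have "int N dvd \<alpha> j - int t * int (lam j)" using assms(28) unfolding N_def
    by (simp add: cong_0_iff)
  then have div: "int N dvd A (P j) + int t * valuation K_x (P j) h"
    using AP[OF jn(2)] vhP[OF jn(2)] jn by simp
  \<comment> \<open>The divisor called \<open>E\<^sub>t\<close> in the introduction. The guard on \<open>R\<close> makes it vanish on sets that are not
      places.\<close>
  define E where "E R = (if place K_x R
    \<and> valuation K_x R h < 0 then (A R + int t * valuation K_x R h) div int N else 0)" for R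
  have EP: "E (P k) = (A (P k) - int t * int (lam k)) div int N" if k: "k \<in> {1..r}" for k
    unfolding E_def using Pk[OF k] vhP[OF k] by simp
  have "riemann_roch_space K' D = riemann_roch_space K' D' \<longleftrightarrow>
    \<not> (\<exists>c. c \<noteq> 0 \<and> (\<forall>R. place K_x R \<longrightarrow> 0 \<le> valuation K_x R c + (if valuation K_x R h < 0 then (A R + int t * valuation K_x R h) div int N else 0))
        \<and> valuation K_x (P j) c + (A (P j) + int t * valuation K_x (P j) h) div int N = 0)"
    unfolding K'eq
    by (rule C.riemann_roch_drop_iff[unfolded CN])
      (erule D_above D'_above D_zero D'_zero | erule (1) A_zero | rule Pk(1)[OF jn(2)] vj tN div)+
  also have "\<dots> \<longleftrightarrow> \<not> (\<exists>c. c \<noteq> 0 \<and> (\<forall>R. place K_x R \<longrightarrow> 0 \<le> valuation K_x R c + E R)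
    \<and> valuation K_x (P j) c + E (P j) = 0)"
  proof -
    have "E R = (if valuation K_x R h < 0 then (A R + int t * valuation K_x R h) div int N else 0)"
      if "place K_x R" for R
      unfolding E_def using that by simp
    moreover have "E (P j) = (A (P j) + int t * valuation K_x (P j) h) div int N"
      unfolding E_def using Pk(1)[OF jn(2)] vj by simp
    ultimately show ?thesis by simp
  qed
  also have "\<dots> \<longleftrightarrow> \<not> 0 \<le> (\<Sum>R\<in>P ` {1..r}. E R * int (place_degree K_x R))"
  proof (subst genus_zero_exact)
    show "E R = 0" if "R \<notin> P ` {1..r}" for R using that vhneg unfolding E_def by auto
  qed (use Pk(1) jn in auto)
  also have "(\<Sum>R\<in>P ` {1..r}. E R * int (place_degree K_x R)) = (\<Sum>k = 1..r. E (P k) * int (place_degree K_x (P k)))"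
    unfolding sum.reindex[OF assms(16)] comp_def ..
  also have "\<dots> = (\<Sum>k = 1..n. E (P k) * int (place_degree K_x (P k))) + (\<Sum>k = n+1..r. E (P k) * int (place_degree K_x (P k)))"
  proof -
    have "{1..r} = {1..n} \<union> {n+1..r}" using assms(21,22) by auto
    then show ?thesis by (simp only:) (rule sum.union_disjoint, auto)
  qed
  also have "(\<Sum>k = 1..n. E (P k) * int (place_degree K_x (P k)))
    = (\<Sum>k = 1..n. \<lfloor>real_of_int (\<alpha> k - int t * int (lam k)) / real (q ^ m)\<rfloor> * int (place_degree K (P k)))"
  proof (rule sum.cong[OF refl])
    fix k assume k: "k \<in> {1..n}"
    then have kr: "k \<in> {1..r}" using assms(22) by auto
    have "\<lfloor>real_of_int (\<alpha> k - int t * int (lam k)) / real (q ^ m)\<rfloor> = (\<alpha> k - int t * int (lam k)) div int N"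
      using floor_divide_of_int_eq[of "\<alpha> k - int t * int (lam k)" "int N", where ?'a = real]
        unfolding N_def by simp
    then show "E (P k) * int (place_degree K_x (P k)) = \<lfloor>real_of_int (\<alpha> k - int t * int (lam k)) / real (q ^ m)\<rfloor> * int (place_degree K (P k))"
      unfolding EP[OF kr] AP[OF kr] K using k by simp
  qed
  also have "(\<Sum>k = n+1..r. E (P k) * int (place_degree K_x (P k)))
    = - (\<Sum>k = n+1..r. \<lceil>real (t * lam k) / real (q ^ m)\<rceil> * int (place_degree K (P k)))"
    unfolding sum_negf[symmetric]
  proof (rule sum.cong[OF refl])
    fix k assume k: "k \<in> {n+1..r}"
    then have kr: "k \<in> {1..r}" by auto
    have "\<lceil>real (t * lam k) / real (q ^ m)\<rceil> = - \<lfloor>real_of_int (- (int t * int (lam k))) / real_of_int (int N)\<rfloor>"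
      unfolding ceiling_def N_def by simp
    then have "\<lceil>real (t * lam k) / real (q ^ m)\<rceil> = - ((- (int t * int (lam k))) div int N)"
      unfolding floor_divide_of_int_eq .
    then show "E (P k) * int (place_degree K_x (P k)) = - (\<lceil>real (t * lam k) / real (q ^ m)\<rceil> * int (place_degree K (P k)))"
      unfolding EP[OF kr] AP[OF kr] K using k by simp
  qed
  finally show ?thesis unfolding D'_def by linarith
qed

end
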